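(* Let $\Sigma$ be a connected smooth complex projective curve, $n\ge1$, let $\lambda,\mu\vdash n$, and let $W_\lambda^+=W_p^+\subset M_n(\Sigma)=\mathrm{Hilb}^n(\Sigma\times\mathbb C)$ be the upward flow of a generic point $p\in F_\lambda^\circ$ of the fixed component $F_\lambda$. Then the number of branches of $$h_n|_{W_\lambda^+}:W_\lambda^+\to\mathrm{Sym}^n\mathbb C$$ over any point of the collision stratum $S_\mu\subset\mathrm{Sym}^n\mathbb C$ is precisely $n_\lambda^\mu$, where $h_\lambda=\sum_{\mu\vdash n}n_\lambda^\mu m_\mu$ is the expansion of the complete homogeneous symmetric function $h_\lambda$ in monomial symmetric functions.
   Context: All varieties are over $\mathbb C$. $M_n(\Sigma)$ is the Hilbert scheme of length-$n$ zero-dimensional subschemes of $\Sigma\times\mathbb C$, and $h_n:M_n(\Sigma)\to\mathrm{Sym}^n\mathbb C$ is the composition of the Hilbert--Chow morphism $M_n(\Sigma)\to\mathrm{Sym}^n(\Sigma\times\mathbb C)$ with $\mathrm{Sym}^n(p)$, $p:\Sigma\times\mathbb C\to\mathbb C$ the projection. $\mathbb C^*$ acts on $\Sigma\times\mathbb C$ by $t\cdot(x,z)=(x,tz)$, hence on $M_n(\Sigma)$. The components of the fixed locus are indexed by partitions $\lambda=(1^{\alpha_1}2^{\alpha_2}\cdots)\vdash n$ ($\alpha_i$ = multiplicity of the part $i$): $F_\lambda\cong\prod_{i\ge1}\mathrm{Sym}^{\alpha_i}\Sigma$, where a tuple of effective divisors $(D_i)_{i\ge1}$, $\deg D_i=\alpha_i$,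 corresponds to the subscheme with ideal $\bigoplus_{k\ge0}\mathcal O_\Sigma(-E_k)z^k$, $E_k=\sum_{i>k}D_i$. $F_\lambda^\circ\subset F_\lambda$ is the open locus where every $D_i$ is reduced and the supports of the $D_i$ are pairwise disjoint; "generic" means $p\in F_\lambda^\circ$. $W_p^+=\{q\in M_n(\Sigma)\mid\lim_{t\to0}t\cdot q=p\}$. For $\mu=(\mu_1,\dots,\mu_s)\vdash n$, $S_\mu=\{\mu_1z_1+\cdots+\mu_sz_s\mid z_i\in\mathbb C,\ z_i\ne z_j\text{ for }i\neq j\}\subset\mathrm{Sym}^n\mathbb C$. The number of branches (local sheets) over a point $y$ means the number of points of the set-theoretic fiber $(h_n|_{W_\lambda^+})^{-1}(y)$. Symmetric functions in $x_1,x_2,\dots$: $h_k=\sum_{i_1\le\cdots\le i_k}x_{i_1}\cdots x_{i_k}$, $h_\lambda=\prod_ih_{\lambda_i}$, and $m_\mu$ is the sum of all distinct monomials obtained by assigning the parts of $\mu$ as exponents to distinct variables. *)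

theory Defs
  imports "HOL-Analysis.Analysis" "HOL-Library.Multiset"
begin

section \<open>Projective varieties and regular functions\<close>

text \<open>Points of projective space are lines through the origin; the dimension of the
  projective space is \<open>CARD('n) - 1\<close>.\<close>

typedef 'n proj = "{range (\<lambda>c. c *s v) | v. v \<noteq> 0} :: (complex ^ 'n::finite) set set"
proof -
  have "(1 :: complex ^ 'n) \<noteq> 0" by simp
  then show ?thesis by blast
qed

text \<open>Some choice of homogeneous coordinates. It is only used in ways that do not depend on
  the choice: vanishing of forms, and quotients of forms of equal degree.\<close>

definition hcoords :: "'n::finite proj \<Rightarrow> complex ^ 'n" where
  "hcoords x = (SOME v. v \<in> Rep_proj x \<and> v \<noteq> 0)"

definition hom_form :: "nat \<Rightarrow> (complex ^ 'n::finite \<Rightarrow> complex) \<Rightarrow> bool" where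
  "hom_form d F \<longleftrightarrow>
     (\<exists>a :: ('n \<Rightarrow> nat) \<Rightarrow> complex.
        F = (\<lambda>v. \<Sum>m | (\<Sum>i\<in>UNIV. m i) = d. a m * (\<Prod>i\<in>UNIV. (v $ i) ^ m i)))"

text \<open>Polynomials in the homogeneous coordinates and in the coordinate \<open>z\<close> of the affine line,
  homogeneous of degree \<open>d\<close> in the former.\<close>

definition cyl_form :: "nat \<Rightarrow> (complex ^ 'n::finite \<Rightarrow> complex \<Rightarrow> complex) \<Rightarrow> bool" where
  "cyl_form d F \<longleftrightarrow>
     (\<exists>r G. (\<forall>j\<le>r. hom_form d (G j)) \<and> F = (\<lambda>v z. \<Sum>j\<le>r. G j v * z ^ j))"

text \<open>Pairs (numerator, denominator) defining the regular functions on subvarieties of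
  projective space, respectively of its product with the affine line. The non-vanishing loci
  of the denominators form a basis of the Zariski topology.\<close>

definition proj_ratios :: "(('n::finite proj \<Rightarrow> complex) \<times> ('n proj \<Rightarrow> complex)) set" where
  "proj_ratios = {(\<lambda>x. F (hcoords x), \<lambda>x. G (hcoords x)) | F G d. hom_form d F \<and> hom_form d G}"

definition cyl_ratios ::
  "(('n::finite proj \<times> complex \<Rightarrow> complex) \<times> ('n proj \<times> complex \<Rightarrow> complex)) set" where
  "cyl_ratios = {(\<lambda>(x, z). F (hcoords x) z, \<lambda>(x, z). G (hcoords x) z) | F G d.
                   cyl_form d F \<and> cyl_form d G}"

text \<open>In what follows \<open>A\<close> is one of these two sets of ratios and \<open>X\<close> is a subvariety. Germs
  are not formed as equivalence classes: \<open>germs A X P\<close> consists of all total functions that are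
  regular in a Zariski neighbourhood of \<open>P\<close> in \<open>X\<close>, and the local ring of \<open>X\<close> at \<open>P\<close> is its
  quotient by the functions vanishing in a neighbourhood, \<open>null_germs A X P\<close>. Ideals of the
  local ring are therefore the ideals of \<open>germs A X P\<close> that contain \<open>null_germs A X P\<close>.\<close>

definition germs ::
  "(('p \<Rightarrow> complex) \<times> ('p \<Rightarrow> complex)) set \<Rightarrow> 'p set \<Rightarrow> 'p \<Rightarrow> ('p \<Rightarrow> complex) set" where
  "germs A X P = {f. \<exists>(F, G)\<in>A. G P \<noteq> 0 \<and> (\<forall>Q\<in>X. G Q \<noteq> 0 \<longrightarrow> f Q = F Q / G Q)}"

definition null_germs ::
  "(('p \<Rightarrow> complex) \<times> ('p \<Rightarrow> complex)) set \<Rightarrow> 'p set \<Rightarrow> 'p \<Rightarrow> ('p \<Rightarrow> complex) set" where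
  "null_germs A X P = {f. \<exists>(F, G)\<in>A. G P \<noteq> 0 \<and> (\<forall>Q\<in>X. G Q \<noteq> 0 \<longrightarrow> f Q = 0)}"

definition germ_ideal ::
  "(('p \<Rightarrow> complex) \<times> ('p \<Rightarrow> complex)) set \<Rightarrow> 'p set \<Rightarrow> 'p \<Rightarrow> ('p \<Rightarrow> complex) set \<Rightarrow> bool" where
  "germ_ideal A X P I \<longleftrightarrow>
     null_germs A X P \<subseteq> I \<and> I \<subseteq> germs A X P \<and>
     (\<forall>f\<in>I. \<forall>g\<in>I. (\<lambda>Q. f Q + g Q) \<in> I) \<and>
     (\<forall>f\<in>germs A X P. \<forall>g\<in>I. (\<lambda>Q. f Q * g Q) \<in> I)"

definition gen_ideal ::
  "(('p \<Rightarrow> complex) \<times> ('p \<Rightarrow> complex)) set \<Rightarrow> 'p set \<Rightarrow> 'p \<Rightarrow>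
   ('p \<Rightarrow> complex) set \<Rightarrow> ('p \<Rightarrow> complex) set" where
  "gen_ideal A X P S = \<Inter>{I. germ_ideal A X P I \<and> S \<subseteq> I}"

definition max_ideal ::
  "(('p \<Rightarrow> complex) \<times> ('p \<Rightarrow> complex)) set \<Rightarrow> 'p set \<Rightarrow> 'p \<Rightarrow> ('p \<Rightarrow> complex) set" where
  "max_ideal A X P = {f \<in> germs A X P. f P = 0}"

primrec max_ideal_pow ::
  "(('p \<Rightarrow> complex) \<times> ('p \<Rightarrow> complex)) set \<Rightarrow> 'p set \<Rightarrow> 'p \<Rightarrow> nat \<Rightarrow> ('p \<Rightarrow> complex) set" where
  "max_ideal_pow A X P 0 = germs A X P"
| "max_ideal_pow A X P (Suc k) =
     gen_ideal A X P {\<lambda>Q. f Q * g Q | f g. f \<in> max_ideal A X P \<and> g \<in> max_ideal_pow A X P k}"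

definition zariski_open ::
  "(('p \<Rightarrow> complex) \<times> ('p \<Rightarrow> complex)) set \<Rightarrow> 'p set \<Rightarrow> 'p set \<Rightarrow> bool" where
  "zariski_open A X V \<longleftrightarrow>
     V \<subseteq> X \<and> (\<forall>P\<in>V. \<exists>(F, G)\<in>A. G P \<noteq> 0 \<and> {Q \<in> X. G Q \<noteq> 0} \<subseteq> V)"

definition sections ::
  "(('p \<Rightarrow> complex) \<times> ('p \<Rightarrow> complex)) set \<Rightarrow> 'p set \<Rightarrow> 'p set \<Rightarrow> ('p \<Rightarrow> complex) set" where
  "sections A X V = {f. \<forall>P\<in>V. f \<in> germs A X P}"

text \<open>For complex vector spaces \<open>I \<subseteq> R\<close> of functions: the classes of \<open>b 0, \<dots>, b (d - 1)\<close> form a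
  basis of \<open>R / I\<close>.\<close>

definition basis_mod ::
  "('p \<Rightarrow> complex) set \<Rightarrow> ('p \<Rightarrow> complex) set \<Rightarrow> nat \<Rightarrow> (nat \<Rightarrow> 'p \<Rightarrow> complex) \<Rightarrow> bool" where
  "basis_mod R I d b \<longleftrightarrow>
     (\<forall>i<d. b i \<in> R) \<and>
     (\<forall>f\<in>R. \<exists>!c. c \<in> {..<d} \<rightarrow>\<^sub>E UNIV \<and> (\<lambda>Q. f Q - (\<Sum>i<d. c i * b i Q)) \<in> I)"

definition has_codim :: "('p \<Rightarrow> complex) set \<Rightarrow> ('p \<Rightarrow> complex) set \<Rightarrow> nat \<Rightarrow> bool" where
  "has_codim R I d \<longleftrightarrow> (\<exists>b. basis_mod R I d b)"

definition codim :: "('p \<Rightarrow> complex) set \<Rightarrow> ('p \<Rightarrow> complex) set \<Rightarrow> nat" where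
  "codim R I = (THE d. has_codim R I d)"

section \<open>Connected smooth projective curves\<close>

definition proj_closed :: "'n::finite proj set \<Rightarrow> bool" where
  "proj_closed Z \<longleftrightarrow>
     (\<exists>S. (\<forall>F\<in>S. \<exists>d. hom_form d F) \<and> Z = {x. \<forall>F\<in>S. F (hcoords x) = 0})"

definition proj_irreducible :: "'n::finite proj set \<Rightarrow> bool" where
  "proj_irreducible Z \<longleftrightarrow> proj_closed Z \<and> Z \<noteq> {} \<and>
     (\<forall>Y Y'. proj_closed Y \<and> proj_closed Y' \<and> Z = Y \<union> Y' \<longrightarrow> Z = Y \<or> Z = Y')"

definition proj_connected :: "'n::finite proj set \<Rightarrow> bool" where
  "proj_connected Z \<longleftrightarrow> Z \<noteq> {} \<and>
     (\<forall>Y Y'. proj_closed Y \<and> proj_closed Y' \<and> Z = Y \<union> Y' \<and> Y \<inter> Y' = {} \<longrightarrow> Y = {} \<or> Y' = {})"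

definition irreducible_chain :: "'n::finite proj set \<Rightarrow> nat \<Rightarrow> bool" where
  "irreducible_chain Z d \<longleftrightarrow>
     (\<exists>Y. (\<forall>i\<le>d. proj_irreducible (Y i) \<and> Y i \<subseteq> Z) \<and> (\<forall>i<d. Y i \<subset> Y (Suc i)))"

definition has_dimension :: "'n::finite proj set \<Rightarrow> nat \<Rightarrow> bool" where
  "has_dimension Z d \<longleftrightarrow> irreducible_chain Z d \<and> \<not> irreducible_chain Z (Suc d)"

text \<open>Smoothness: the Zariski cotangent space \<open>\<mm>\<^sub>x / \<mm>\<^sub>x\<^sup>2\<close> has dimension 1 at every point.\<close>

definition smooth_projective_curve :: "'n::finite proj set \<Rightarrow> bool" where
  "smooth_projective_curve C \<longleftrightarrow>
     proj_closed C \<and> proj_connected C \<and> has_dimension C 1 \<and>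
     (\<forall>x\<in>C. has_codim (max_ideal proj_ratios C x) (max_ideal_pow proj_ratios C x 2) 1)"

section \<open>The Hilbert scheme of points of a curve times the affine line\<close>

abbreviation cyl :: "'n::finite proj set \<Rightarrow> ('n proj \<times> complex) set" where
  "cyl C \<equiv> C \<times> UNIV"

text \<open>A zero-dimensional closed subscheme of finite length is given by the stalks of its ideal
  sheaf. (Conversely, any choice of ideals of finite colength in the local rings, all but
  finitely many of which are the unit ideal, comes from a coherent ideal sheaf.)\<close>

type_synonym 'n subscheme = "'n proj \<times> complex \<Rightarrow> ('n proj \<times> complex \<Rightarrow> complex) set"

definition support :: "'n::finite proj set \<Rightarrow> 'n subscheme \<Rightarrow> ('n proj \<times> complex) set" where
  "support C Z = {P \<in> cyl C. Z P \<noteq> germs cyl_ratios (cyl C) P}"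

definition local_length :: "'n::finite proj set \<Rightarrow> 'n subscheme \<Rightarrow> 'n proj \<times> complex \<Rightarrow> nat" where
  "local_length C Z P = codim (germs cyl_ratios (cyl C) P) (Z P)"

definition Hilb :: "'n::finite proj set \<Rightarrow> nat \<Rightarrow> 'n subscheme set" where
  "Hilb C n = {Z \<in> (\<Pi>\<^sub>E P\<in>cyl C. {I. germ_ideal cyl_ratios (cyl C) P I}).
     finite (support C Z) \<and>
     (\<forall>P\<in>cyl C. \<exists>d. has_codim (germs cyl_ratios (cyl C) P) (Z P) d) \<and>
     (\<Sum>P\<in>support C Z. local_length C Z P) = n}"

definition ideal_sections ::
  "'n::finite proj set \<Rightarrow> 'n subscheme \<Rightarrow> ('n proj \<times> complex) set \<Rightarrow>
   ('n proj \<times> complex \<Rightarrow> complex) set" where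
  "ideal_sections C Z V = {f \<in> sections cyl_ratios (cyl C) V. \<forall>P\<in>V. f \<in> Z P}"

text \<open>The standard charts of the Hilbert scheme: subschemes \<open>Z\<close> contained in \<open>V\<close> for which given
  functions \<open>b 0, \<dots>, b (n - 1)\<close> on \<open>V\<close> form a basis of \<open>\<O>(Z)\<close>. The coordinate functions on the
  chart are the coefficients, in this basis, of the restrictions to \<open>Z\<close> of the functions \<open>f\<close>
  on \<open>V\<close>. (Affine \<open>V\<close> would suffice to cover; as \<open>\<O>(V) \<rightarrow> \<O>(Z)\<close> is onto as soon as
  its image has dimension \<open>n\<close>, the other \<open>V\<close> do not change the topology.)\<close>

definition Hilb_chart ::
  "'n::finite proj set \<Rightarrow> nat \<Rightarrow> ('n proj \<times> complex) set \<Rightarrow>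
   (nat \<Rightarrow> 'n proj \<times> complex \<Rightarrow> complex) \<Rightarrow> 'n subscheme set" where
  "Hilb_chart C n V b = {Z \<in> Hilb C n. support C Z \<subseteq> V \<and>
     basis_mod (sections cyl_ratios (cyl C) V) (ideal_sections C Z V) n b}"

text \<open>The classical topology: generated by the charts and the preimages of open sets under
  their coordinate functions.\<close>

definition Hilb_topology :: "'n::finite proj set \<Rightarrow> nat \<Rightarrow> 'n subscheme topology" where
  "Hilb_topology C n = topology_generated_by
     {{Z \<in> Hilb_chart C n V b. \<exists>c. c i \<in> U \<and>
          (\<lambda>Q. f Q - (\<Sum>j<n. c j * b j Q)) \<in> ideal_sections C Z V} | V b f i U.
        zariski_open cyl_ratios (cyl C) V \<and> f \<in> sections cyl_ratios (cyl C) V \<and>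
        i < n \<and> open U}"

text \<open>The induced action \<open>t \<cdot> Z\<close> for \<open>t \<noteq> 0\<close>: a function vanishes on \<open>t \<cdot> Z\<close> if its pullback along
  \<open>(x, z) \<mapsto> (x, t z)\<close> vanishes on \<open>Z\<close>.\<close>

definition act :: "'n::finite proj set \<Rightarrow> complex \<Rightarrow> 'n subscheme \<Rightarrow> 'n subscheme" where
  "act C t Z = (\<lambda>(x, z)\<in>cyl C. {f. (\<lambda>(y, w). f (y, t * w)) \<in> Z (x, z / t)})"

definition upward_flow ::
  "'n::finite proj set \<Rightarrow> nat \<Rightarrow> 'n subscheme \<Rightarrow> 'n subscheme set" where
  "upward_flow C n p = {q \<in> Hilb C n. limitin (Hilb_topology C n) (\<lambda>t. act C t q) p (at 0)}"

text \<open>Points of the symmetric powers are multisets.\<close>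

definition hilbert_chow ::
  "'n::finite proj set \<Rightarrow> 'n subscheme \<Rightarrow> ('n proj \<times> complex) multiset" where
  "hilbert_chow C Z = (\<Sum>P\<in>support C Z. replicate_mset (local_length C Z P) P)"

definition h_map :: "'n::finite proj set \<Rightarrow> 'n subscheme \<Rightarrow> complex multiset" where
  "h_map C Z = image_mset snd (hilbert_chow C Z)"

section \<open>Partitions, fixed points and collision strata\<close>

definition partition_of :: "nat multiset \<Rightarrow> nat \<Rightarrow> bool" where
  "partition_of lam n \<longleftrightarrow> 0 \<notin># lam \<and> sum_mset lam = n"

definition divisor_tuples ::
  "'n::finite proj set \<Rightarrow> nat multiset \<Rightarrow> (nat \<Rightarrow> 'n proj multiset) set" where
  "divisor_tuples C lam = {D. \<forall>i\<ge>1. set_mset (D i) \<subseteq> C \<and> size (D i) = count lam i}"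

definition generic_tuples ::
  "'n::finite proj set \<Rightarrow> nat multiset \<Rightarrow> (nat \<Rightarrow> 'n proj multiset) set" where
  "generic_tuples C lam = {D \<in> divisor_tuples C lam.
     (\<forall>i\<ge>1. \<forall>x. count (D i) x \<le> 1) \<and>
     (\<forall>i\<ge>1. \<forall>j\<ge>1. i \<noteq> j \<longrightarrow> set_mset (D i) \<inter> set_mset (D j) = {})}"

text \<open>Multiplicity at \<open>x\<close> of \<open>E\<^sub>k = \<Sum>\<^bsub>i>k\<^esub> D\<^sub>i\<close>; all \<open>D\<^sub>i\<close> with \<open>i > sum_mset lam\<close> are zero.\<close>

definition E_mult :: "nat multiset \<Rightarrow> (nat \<Rightarrow> 'n::finite proj multiset) \<Rightarrow> nat \<Rightarrow> 'n proj \<Rightarrow> nat" where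
  "E_mult lam D k x = (\<Sum>i\<in>{k<..sum_mset lam}. count (D i) x)"

text \<open>The subscheme with ideal \<open>\<Oplus>\<^sub>k \<O>(-E\<^sub>k) z\<^sup>k\<close>; the stalk of \<open>\<O>(-E)\<close> at \<open>x\<close> is the power of the
  maximal ideal whose exponent is the multiplicity of \<open>E\<close> at \<open>x\<close>.\<close>

definition fixed_subscheme ::
  "'n::finite proj set \<Rightarrow> nat multiset \<Rightarrow> (nat \<Rightarrow> 'n proj multiset) \<Rightarrow> 'n subscheme" where
  "fixed_subscheme C lam D = (\<lambda>(x, z)\<in>cyl C.
     gen_ideal cyl_ratios (cyl C) (x, z)
       {\<lambda>(y, w). g y * w ^ k | g k. g \<in> max_ideal_pow proj_ratios C x (E_mult lam D k x)})"

definition generic_fixed :: "'n::finite proj set \<Rightarrow> nat multiset \<Rightarrow> 'n subscheme set" where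
  "generic_fixed C lam = fixed_subscheme C lam ` generic_tuples C lam"

definition collision_stratum :: "nat multiset \<Rightarrow> complex multiset set" where
  "collision_stratum mu =
     {(\<Sum>i<length ms. replicate_mset (ms ! i) (z i)) | ms z.
        mset ms = mu \<and> inj_on z {..<length ms}}"

section \<open>Symmetric functions\<close>

text \<open>Formal series in \<open>x\<^sub>0, x\<^sub>1, \<dots>\<close> are represented by their coefficient functions, the
  monomial \<open>\<Prod>i\<in>#M. x\<^sub>i\<close> being represented by the multiset \<open>M\<close>.\<close>

type_synonym series = "nat multiset \<Rightarrow> int"

definition series_one :: series where
  "series_one M = (if M = {#} then 1 else 0)"

definition series_times :: "series \<Rightarrow> series \<Rightarrow> series" where
  "series_times f g M = (\<Sum>A | A \<subseteq># M. f A * g (M - A))"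

definition h_sym1 :: "nat \<Rightarrow> series" where
  "h_sym1 k M = int (card {is. length is = k \<and> sorted is \<and> mset is = M})"

definition h_sym :: "nat multiset \<Rightarrow> series" where
  "h_sym lam = foldr (\<lambda>k. series_times (h_sym1 k)) (sorted_list_of_multiset lam) series_one"

definition m_sym :: "nat multiset \<Rightarrow> series" where
  "m_sym mu M = (if image_mset (count M) (mset_set (set_mset M)) = mu then 1 else 0)"

definition hm_coeff :: "nat multiset \<Rightarrow> nat multiset \<Rightarrow> int" where
  "hm_coeff lam = (THE N.
     (\<forall>mu. \<not> partition_of mu (sum_mset lam) \<longrightarrow> N mu = 0) \<and>
     h_sym lam = (\<lambda>M. \<Sum>mu | partition_of mu (sum_mset lam). N mu * m_sym mu M))"

end

theory Submission
  imports Defs "Jordan_Normal_Form.Determinant" "HOL-Computational_Algebra.Computational_Algebra"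
begin

text \<open>At a point \<open>x\<close> of \<open>D\<^sub>i\<close> the ideal of a generic fixed point \<open>p\<close> is \<open>(\<mm>\<^sub>x, z\<^sup>i)\<close>, so \<open>p\<close> is a
  disjoint union of fat points on vertical lines. In a chart around \<open>p\<close>, the coefficients of
  functions pulled back from the curve are scaled by negative powers of \<open>t\<close> along the action;
  hence a subscheme flowing to \<open>p\<close> lies on the vertical lines over the supports of the \<open>D\<^sub>i\<close>, with
  degree \<open>i\<close> over the points of \<open>D\<^sub>i\<close>. Conversely every such subscheme flows to \<open>p\<close>: the functions
  on it are described by Newton interpolation coefficients at nodes \<open>t a\<^sub>1, t a\<^sub>2, \<dots>\<close>, which converge
  to Taylor coefficients at 0, and being a basis is an open condition. So the upward flow is a
  product of symmetric powers of the affine line, on which the map to the symmetric power is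
  addition of divisors. Its fibre over \<open>y\<close> consists of the ways to write \<open>y\<close> as a sum of multisets
  of sizes \<open>\<lambda>\<^sub>1, \<lambda>\<^sub>2, \<dots>\<close>, and their number is a coefficient of \<open>h\<^sub>\<lambda>\<close>.\<close>

section \<open>Bases modulo an ideal and their perturbation\<close>

text \<open>The obstacle is that the points of the subscheme collide on each line as t tends to 0,
  so evaluation at them degenerates in the limit. Newton coefficients involve no division by
  differences of nodes, cut out the right ideal for distinct and for repeated nodes, and stay
  independent at t = 0. Every member of the family is thus the common kernel of n functionals
  depending continuously on t, and near the limit a basis is detected by a determinant. In the other
  direction, negative powers of t become visible because each element of the chart basis is a
  function on the curve times a power of z. Convergence forces the ideal to contain the functions
  from the curve that vanish on the supports. What is left over each point is governed by ideals of
  local rings of a line, which are powers of z - a; expanding the first missing power of z in the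
  chart basis bounds the degree over a point of D_i by i, and the total length n turns all bounds
  into equalities.\<close>

lemma tendsto_det:
  fixes A :: "complex \<Rightarrow> complex mat"
  assumes "\<And>t. A t \<in> carrier_mat n n"
    and "\<And>i j. i < n \<Longrightarrow> j < n \<Longrightarrow> ((\<lambda>t. A t $$ (i, j)) \<longlongrightarrow> A 0 $$ (i, j)) F"
  shows "((\<lambda>t. Determinant.det (A t)) \<longlongrightarrow> Determinant.det (A 0)) F"
proof -
  have "((\<lambda>t. \<Sum>p | p permutes {0..<n}. signof p * (\<Prod>i = 0..<n. A t $$ (i, p i)))
      \<longlongrightarrow> (\<Sum>p | p permutes {0..<n}. signof p * (\<Prod>i = 0..<n. A 0 $$ (i, p i)))) F"
    by (intro tendsto_sum tendsto_mult tendsto_const tendsto_prod assms(2))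
      (auto dest: permutes_in_image)
  then show ?thesis
    by (simp add: det_def'[OF assms(1)])
qed

text \<open>Cramer's rule: \<open>N t\<close> is the adjugate divided by the determinant, hence
  continuous where the determinant is nonzero. Injectivity is asked only at 0, and the filter
  \<open>nhds 0\<close> makes the inverse identities available at 0 itself as well as
  nearby.\<close>

lemma inverse_matrix_perturbation:
  fixes M :: "complex \<Rightarrow> nat \<Rightarrow> nat \<Rightarrow> complex"
  assumes conv: "\<And>i j. i < n \<Longrightarrow> j < n \<Longrightarrow> (\<lambda>t. M t i j) \<midarrow>0\<rightarrow> M 0 i j"
    and inj: "\<And>v. (\<And>i. i < n \<Longrightarrow> (\<Sum>j<n. M 0 i j * v j) = 0) \<Longrightarrow> (\<And>j. j < n \<Longrightarrow> v j = 0)"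
  obtains N where "\<And>i j. i < n \<Longrightarrow> j < n \<Longrightarrow> (\<lambda>t. N t i j) \<midarrow>0\<rightarrow> N 0 i j"
    and "\<forall>\<^sub>F t in nhds 0. \<forall>i<n. \<forall>j<n. (\<Sum>k<n. N t i k * M t k j) = of_bool (i = j)"
    and "\<forall>\<^sub>F t in nhds 0. \<forall>i<n. \<forall>j<n. (\<Sum>k<n. M t i k * N t k j) = of_bool (i = j)"
proof -
  define A where "A t = Matrix.mat n n (\<lambda>(i, j). M t i j)" for t
  have A: "A t \<in> carrier_mat n n" for t by (simp add: A_def)
  define N where "N t i j = adj_mat (A t) $$ (i, j) / Determinant.det (A t)" for t i j
  have convA: "(\<lambda>t. A t $$ (i, j)) \<midarrow>0\<rightarrow> A 0 $$ (i, j)" if "i < n" "j < n" for i j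
    using conv[OF that] that by (simp add: A_def)
  have det: "(\<lambda>t. Determinant.det (A t)) \<midarrow>0\<rightarrow> Determinant.det (A 0)"
    by (rule tendsto_det[OF A convA])
  have det0: "Determinant.det (A 0) \<noteq> 0"
  proof
    assume "Determinant.det (A 0) = 0"
    then obtain v where v: "v \<in> carrier_vec n" "v \<noteq> 0\<^sub>v n" "A 0 *\<^sub>v v = 0\<^sub>v n"
      using det_0_iff_vec_prod_zero[OF A] by auto
    have "(\<Sum>j<n. M 0 i j * vec_index v j) = 0" if "i < n" for i
    proof -
      have "vec_index (A 0 *\<^sub>v v) i = 0" using v(3) that by simp
      then show ?thesis using that v(1)
        by (simp add: A_def scalar_prod_def lessThan_atLeast0)
    qed
    then have "vec_index v j = 0" if "j < n" for j using inj that by blast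
    then have "v = 0\<^sub>v n" using v(1) by (intro eq_vecI) auto
    with v(2) show False by simp
  qed
  have "\<forall>\<^sub>F t in at 0. Determinant.det (A t) \<noteq> 0"
    using tendsto_imp_eventually_ne[OF det det0] .
  then have ev: "\<forall>\<^sub>F t in nhds 0. Determinant.det (A t) \<noteq> 0"
    using det0 by (simp add: eventually_nhds_conv_at)
  have adjc: "adj_mat (A t) \<in> carrier_mat n n" for t using adj_mat(1)[OF A] .
  have "(\<lambda>t. adj_mat (A t) $$ (i, j)) \<midarrow>0\<rightarrow> adj_mat (A 0) $$ (i, j)" if "i < n" "j < n" for i j
  proof -
    have "(\<lambda>t. Determinant.det (mat_delete (A t) j i)) \<midarrow>0\<rightarrow> Determinant.det (mat_delete (A 0) j i)"
    proof (rule tendsto_det)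
      show "mat_delete (A t) j i \<in> carrier_mat (n - 1) (n - 1)" for t
        using mat_delete_carrier[OF A] .
      fix k l assume kl: "k < n - 1" "l < n - 1"
      then show "(\<lambda>t. mat_delete (A t) j i $$ (k, l)) \<midarrow>0\<rightarrow> mat_delete (A 0) j i $$ (k, l)"
        using that by (auto simp: mat_delete_def A_def intro!: conv)
    qed
    then show ?thesis using that A[THEN carrier_matD(1)] A[THEN carrier_matD(2)]
      unfolding adj_mat_def cofactor_def by (auto intro!: tendsto_mult_left)
  qed
  then have "(\<lambda>t. N t i j) \<midarrow>0\<rightarrow> N 0 i j" if "i < n" "j < n" for i j
    unfolding N_def using that det det0 by (intro tendsto_divide) auto
  moreover have "(\<Sum>k<n. N t i k * M t k j) = of_bool (i = j)"
    "(\<Sum>k<n. M t i k * N t k j) = of_bool (i = j)"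
    if "Determinant.det (A t) \<noteq> 0" "i < n" "j < n" for t i j
  proof -
    have "(adj_mat (A t) * A t) $$ (i, j) = Determinant.det (A t) * of_bool (i = j)"
      "(A t * adj_mat (A t)) $$ (i, j) = Determinant.det (A t) * of_bool (i = j)"
      using adj_mat(2,3)[OF A] that by simp_all
    then have "(\<Sum>k<n. adj_mat (A t) $$ (i, k) * M t k j) = Determinant.det (A t) * of_bool (i = j)"
      "(\<Sum>k<n. M t i k * adj_mat (A t) $$ (k, j)) = Determinant.det (A t) * of_bool (i = j)"
      using that adjc[of t] A[of t]
      by (simp_all add: scalar_prod_def lessThan_atLeast0 A_def)
    then show "(\<Sum>k<n. N t i k * M t k j) = of_bool (i = j)"
      "(\<Sum>k<n. M t i k * N t k j) = of_bool (i = j)"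
      using that by (simp_all add: N_def sum_divide_distrib[symmetric])
  qed
  ultimately show thesis
    using that[of N] ev by (simp add: eventually_mono)
qed

text \<open>The ideal is the common kernel of the functionals \<open>T a\<close>, and
  \<open>N\<close> inverts the matrix of their values on \<open>b\<close>. A left inverse makes the
  coefficients of an expansion unique, a right inverse makes them exist; they are \<open>N\<close>
  applied to the vector of the \<open>T k f\<close>. Linearity is asked only for the combinations
  that occur, since the functionals are meaningful only on \<open>R\<close>.\<close>

lemma basis_modI:
  assumes bR: "\<And>i. i < n \<Longrightarrow> b i \<in> R"
    and lin: "\<And>a f c. a < n \<Longrightarrow> f \<in> R \<Longrightarrow>
      T a (\<lambda>Q. f Q - (\<Sum>i<n. c i * b i Q)) = T a f - (\<Sum>i<n. c i * T a (b i))"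
    and clos: "\<And>f c. f \<in> R \<Longrightarrow> (\<lambda>Q. f Q - (\<Sum>i<n. c i * b i Q)) \<in> R"
    and NM: "\<And>i j. i < n \<Longrightarrow> j < n \<Longrightarrow> (\<Sum>k<n. N i k * T k (b j)) = of_bool (i = j)"
    and MN: "\<And>i j. i < n \<Longrightarrow> j < n \<Longrightarrow> (\<Sum>k<n. T i (b k) * N k j) = of_bool (i = j)"
  shows "basis_mod R {f \<in> R. \<forall>a<n. T a f = 0} n b"
    and "\<And>f c i. f \<in> R \<Longrightarrow> (\<lambda>Q. f Q - (\<Sum>i<n. c i * b i Q)) \<in> {f \<in> R. \<forall>a<n. T a f = 0} \<Longrightarrow>
            i < n \<Longrightarrow> c i = (\<Sum>k<n. N i k * T k f)"
proof -
  have expand: "(\<lambda>Q. f Q - (\<Sum>i<n. c i * b i Q)) \<in> {f \<in> R. \<forall>a<n. T a f = 0} \<longleftrightarrow>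
      (\<forall>i<n. c i = (\<Sum>k<n. N i k * T k f))" if f: "f \<in> R" for f c
  proof -
    have "(\<lambda>Q. f Q - (\<Sum>i<n. c i * b i Q)) \<in> {f \<in> R. \<forall>a<n. T a f = 0} \<longleftrightarrow>
      (\<forall>a<n. T a f = (\<Sum>i<n. c i * T a (b i)))"
      using clos[OF f] lin[OF _ f] by auto
    also have "\<dots> \<longleftrightarrow> (\<forall>i<n. c i = (\<Sum>k<n. N i k * T k f))"
    proof (intro iffI allI impI)
      fix i assume *: "\<forall>a<n. T a f = (\<Sum>i<n. c i * T a (b i))" and i: "i < n"
      have "(\<Sum>k<n. N i k * T k f) = (\<Sum>k<n. \<Sum>j<n. c j * (N i k * T k (b j)))"
        using * by (simp add: sum_distrib_left mult_ac)
      also have "\<dots> = (\<Sum>j<n. c j * (\<Sum>k<n. N i k * T k (b j)))"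
        by (subst sum.swap) (simp add: sum_distrib_left)
      also have "\<dots> = (\<Sum>j<n. if i = j then c j else 0)"
        using NM i by (intro sum.cong) auto
      finally show "c i = (\<Sum>k<n. N i k * T k f)" using i by simp
    next
      fix a assume *: "\<forall>i<n. c i = (\<Sum>k<n. N i k * T k f)" and a: "a < n"
      have "(\<Sum>i<n. c i * T a (b i)) = (\<Sum>i<n. \<Sum>k<n. T k f * (T a (b i) * N i k))"
        using * by (simp add: sum_distrib_right sum_distrib_left mult_ac)
      also have "\<dots> = (\<Sum>k<n. T k f * (\<Sum>i<n. T a (b i) * N i k))"
        by (subst sum.swap) (simp add: sum_distrib_left)
      also have "\<dots> = (\<Sum>k<n. if a = k then T k f else 0)"
        using MN a by (intro sum.cong) auto
      finally show "T a f = (\<Sum>i<n. c i * T a (b i))" using a by simp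
    qed
    finally show ?thesis .
  qed
  show "basis_mod R {f \<in> R. \<forall>a<n. T a f = 0} n b"
    unfolding basis_mod_def
  proof (intro conjI allI impI ballI bR)
    fix f assume f: "f \<in> R"
    show "\<exists>!c. c \<in> {..<n} \<rightarrow>\<^sub>E UNIV \<and>
      (\<lambda>Q. f Q - (\<Sum>i<n. c i * b i Q)) \<in> {f \<in> R. \<forall>a<n. T a f = 0}"
      unfolding expand[OF f]
    proof (rule ex1I[of _ "\<lambda>i\<in>{..<n}. \<Sum>k<n. N i k * T k f"])
      fix c assume c: "c \<in> {..<n} \<rightarrow>\<^sub>E UNIV \<and> (\<forall>i<n. c i = (\<Sum>k<n. N i k * T k f))"
      show "c = (\<lambda>i\<in>{..<n}. \<Sum>k<n. N i k * T k f)"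
        by (rule PiE_ext[of _ "{..<n}" "\<lambda>_. UNIV"]) (use c in auto)
    qed auto
  qed
  show "c i = (\<Sum>k<n. N i k * T k f)" if "f \<in> R"
    "(\<lambda>Q. f Q - (\<Sum>i<n. c i * b i Q)) \<in> {f \<in> R. \<forall>a<n. T a f = 0}" "i < n" for f c i
    using expand[OF that(1)] that by blast
qed

lemma ex1_unique: "\<exists>!x. P x \<Longrightarrow> P a \<Longrightarrow> P b \<Longrightarrow> a = b"
  by blast

lemma basis_mod_ex1:
  assumes "basis_mod R I d b" "f \<in> R"
  shows "\<exists>!c. c \<in> {..<d} \<rightarrow>\<^sub>E UNIV \<and> (\<lambda>Q. f Q - (\<Sum>i<d. c i * b i Q)) \<in> I"
  using assms unfolding basis_mod_def by (elim conjE bspec)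

lemma basis_mod_expand:
  assumes "basis_mod R I d b" "f \<in> R"
  shows "\<exists>c. (\<lambda>Q. f Q - (\<Sum>i<d. c i * b i Q)) \<in> I"
  using basis_mod_ex1[OF assms] by blast

lemma basis_mod_mem: "basis_mod R I d b \<Longrightarrow> i < d \<Longrightarrow> b i \<in> R"
  by (simp add: basis_mod_def)

lemma basis_mod_unique:
  assumes "basis_mod R I d b" "f \<in> R"
    and "(\<lambda>Q. f Q - (\<Sum>i<d. c i * b i Q)) \<in> I" "(\<lambda>Q. f Q - (\<Sum>i<d. c' i * b i Q)) \<in> I" "i < d"
  shows "c i = c' i"
proof -
  have "(\<lambda>i\<in>{..<d}. c i) = (\<lambda>i\<in>{..<d}. c' i)"
    by (rule ex1_unique[OF basis_mod_ex1[OF assms(1,2)]]) (use assms(3,4) in simp_all)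
  then show ?thesis using \<open>i < d\<close> by (metis lessThan_iff restrict_apply')
qed

text \<open>The basis property at \<open>t = 0\<close> makes the matrix of the values
  \<open>T 0 a (b j)\<close> injective; its inverse persists for small \<open>t\<close>, and the
  coefficients obtained by applying \<open>N t\<close> to the values \<open>T t k f\<close> converge
  to those at 0. Linearity is assumed only eventually because the functionals of interest are sound
  only once their nodes lie in the chart.\<close>

lemma basis_mod_perturbation:
  fixes T :: "complex \<Rightarrow> nat \<Rightarrow> ('p \<Rightarrow> complex) \<Rightarrow> complex"
  assumes basis: "basis_mod R {f \<in> R. \<forall>a<n. T 0 a f = 0} n b"
    and lin: "\<forall>\<^sub>F t in nhds 0. \<forall>a<n. \<forall>f\<in>R. \<forall>c.
      T t a (\<lambda>Q. f Q - (\<Sum>i<n. c i * b i Q)) = T t a f - (\<Sum>i<n. c i * T t a (b i))"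
    and clos: "\<And>f c. f \<in> R \<Longrightarrow> (\<lambda>Q. f Q - (\<Sum>i<n. c i * b i Q)) \<in> R"
    and zero: "(\<lambda>_. 0) \<in> R" "\<And>a. a < n \<Longrightarrow> T 0 a (\<lambda>_. 0) = 0"
    and conv: "\<And>f a. f \<in> R \<Longrightarrow> a < n \<Longrightarrow> (\<lambda>t. T t a f) \<midarrow>0\<rightarrow> T 0 a f"
    and f: "f \<in> R" and c: "(\<lambda>Q. f Q - (\<Sum>i<n. c i * b i Q)) \<in> {f \<in> R. \<forall>a<n. T 0 a f = 0}"
    and i: "i < n" and U: "open U" "c i \<in> U"
  shows "\<forall>\<^sub>F t in at 0. basis_mod R {f \<in> R. \<forall>a<n. T t a f = 0} n b \<and>
    (\<exists>c. c i \<in> U \<and> (\<lambda>Q. f Q - (\<Sum>i<n. c i * b i Q)) \<in> {f \<in> R. \<forall>a<n. T t a f = 0})"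
proof -
  have bR: "b j \<in> R" if "j < n" for j using basis that by (simp add: basis_mod_def)
  have lin0: "T 0 a (\<lambda>Q. f Q - (\<Sum>i<n. c i * b i Q)) = T 0 a f - (\<Sum>i<n. c i * T 0 a (b i))"
    if "a < n" "f \<in> R" for a f c
    using eventually_nhds_x_imp_x[OF lin] that by blast
  \<comment> \<open>A vector in the kernel of the matrix and the zero vector both expand the
    function 0, so uniqueness of expansions identifies them.\<close>
  have inj: "v j = 0" if v: "\<And>a. a < n \<Longrightarrow> (\<Sum>j<n. T 0 a (b j) * v j) = 0" and j: "j < n" for v j
  proof -
    let ?I = "{f \<in> R. \<forall>a<n. T 0 a f = 0}"
    have *: "(\<lambda>Q. 0 - (\<Sum>i<n. c i * b i Q)) \<in> ?I"
      if "\<And>a. a < n \<Longrightarrow> (\<Sum>j<n. T 0 a (b j) * c j) = 0" for c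
      using lin0[OF _ zero(1), of _ c] zero(2) clos[OF zero(1), of c] that
      by (auto simp: mult.commute)
    show ?thesis
      by (rule basis_mod_unique[OF basis zero(1) *[of v] *[of "\<lambda>_. 0"] j]) (use v in auto)
  qed
  obtain N where N: "\<And>i j. i < n \<Longrightarrow> j < n \<Longrightarrow> (\<lambda>t. N t i j) \<midarrow>0\<rightarrow> N 0 i j"
    and NM: "\<forall>\<^sub>F t in nhds 0. \<forall>i<n. \<forall>j<n. (\<Sum>k<n. N t i k * T t k (b j)) = of_bool (i = j)"
    and MN: "\<forall>\<^sub>F t in nhds 0. \<forall>i<n. \<forall>j<n. (\<Sum>k<n. T t i (b k) * N t k j) = of_bool (i = j)"
  proof (rule inverse_matrix_perturbation[of n "\<lambda>t a k. T t a (b k)"])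
    show "(\<lambda>t. T t i (b j)) \<midarrow>0\<rightarrow> T 0 i (b j)" if "i < n" "j < n" for i j
      using conv[OF bR] that by blast
    show "v j = 0" if "\<And>i. i < n \<Longrightarrow> (\<Sum>j<n. T 0 i (b j) * v j) = 0" "j < n" for v j
      using inj[of v j] that by blast
  qed (rule that)
  note bm = basis_modI[where R = R and b = b and n = n]
  have NM0: "(\<Sum>k<n. N 0 i k * T 0 k (b j)) = of_bool (i = j)"
    and MN0: "(\<Sum>k<n. T 0 i (b k) * N 0 k j) = of_bool (i = j)" if "i < n" "j < n" for i j
    using eventually_nhds_x_imp_x[OF NM] eventually_nhds_x_imp_x[OF MN] that by blast+
  have "c i = (\<Sum>k<n. N 0 i k * T 0 k f)"
    by (rule bm(2)[where T = "T 0" and N = "N 0" and f = f and c = c and i = i];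
        fact bR lin0 clos NM0 MN0 f c i)
  moreover have "(\<lambda>t. \<Sum>k<n. N t i k * T t k f) \<midarrow>0\<rightarrow> (\<Sum>k<n. N 0 i k * T 0 k f)"
    using i f by (intro tendsto_sum tendsto_mult N conv) auto
  ultimately have "\<forall>\<^sub>F t in at 0. (\<Sum>k<n. N t i k * T t k f) \<in> U"
    using topological_tendstoD[OF _ U(1)] U(2) by simp
  moreover have "\<forall>\<^sub>F t in at 0. \<forall>a<n. \<forall>f\<in>R. \<forall>c.
      T t a (\<lambda>Q. f Q - (\<Sum>i<n. c i * b i Q)) = T t a f - (\<Sum>i<n. c i * T t a (b i))"
    "\<forall>\<^sub>F t in at 0. \<forall>i<n. \<forall>j<n. (\<Sum>k<n. N t i k * T t k (b j)) = of_bool (i = j)"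
    "\<forall>\<^sub>F t in at 0. \<forall>i<n. \<forall>j<n. (\<Sum>k<n. T t i (b k) * N t k j) = of_bool (i = j)"
    by (rule lin[unfolded eventually_nhds_conv_at, THEN conjunct1]
        NM[unfolded eventually_nhds_conv_at, THEN conjunct1]
        MN[unfolded eventually_nhds_conv_at, THEN conjunct1])+
  ultimately show ?thesis
  proof eventually_elim
    case (elim t)
    note lin = elim(2)[rule_format] and NM = elim(3)[rule_format] and MN = elim(4)[rule_format]
    have B: "basis_mod R {f \<in> R. \<forall>a<n. T t a f = 0} n b"
      by (rule bm(1)[where T = "T t" and N = "N t"]; fact bR lin clos NM MN)
    then obtain c' where c': "(\<lambda>Q. f Q - (\<Sum>i<n. c' i * b i Q)) \<in> {f \<in> R. \<forall>a<n. T t a f = 0}"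
      using basis_mod_ex1[OF B f] by blast
    have "c' i = (\<Sum>k<n. N t i k * T t k f)"
      by (rule bm(2)[where T = "T t" and N = "N t" and f = f and c = c' and i = i];
          fact bR lin clos NM MN f c' i)
    then show ?case using B c' elim(1) by (intro conjI exI[of _ c']) simp_all
  qed
qed

text \<open>Substituting one change of basis into the other expands \<open>b i\<close> in the basis
  \<open>b\<close> itself, so the coefficients are those of the identity matrix. Only the diagonal
  is recorded, because it is used for a trace.\<close>

lemma basis_mod_transition:
  assumes b: "basis_mod R I d b" and b': "basis_mod R I d' b'"
    and zero: "(\<lambda>_. 0) \<in> I"
    and add: "\<And>f g. f \<in> I \<Longrightarrow> g \<in> I \<Longrightarrow> (\<lambda>Q. f Q + g Q) \<in> I"
    and scale: "\<And>f c. f \<in> I \<Longrightarrow> (\<lambda>Q. c * f Q) \<in> I"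
    and M: "\<And>i. i < d \<Longrightarrow> (\<lambda>Q. b i Q - (\<Sum>j<d'. M i j * b' j Q)) \<in> I"
    and N: "\<And>j. j < d' \<Longrightarrow> (\<lambda>Q. b' j Q - (\<Sum>k<d. N j k * b k Q)) \<in> I"
    and i: "i < d"
  shows "(\<Sum>j<d'. M i j * N j i) = (1 :: complex)"
proof -
  have sumI: "(\<lambda>Q. \<Sum>j<k. c j * f j Q) \<in> I" if "\<And>j. j < k \<Longrightarrow> f j \<in> I" for f c and k :: nat
    using that
  proof (induction k)
    case (Suc k)
    then show ?case
      using add[of "\<lambda>Q. \<Sum>j<k. c j * f j Q" "\<lambda>Q. c k * f k Q"] scale[of "f k" "c k"] by simp
  qed (use zero in simp)
  define c where "c = (\<lambda>k\<in>{..<d}. \<Sum>j<d'. M i j * N j k)"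
  define c' where "c' = (\<lambda>k\<in>{..<d}. of_bool (i = k) :: complex)"
  have "(\<lambda>Q. (b i Q - (\<Sum>j<d'. M i j * b' j Q)) +
      (\<Sum>j<d'. M i j * (b' j Q - (\<Sum>k<d. N j k * b k Q)))) \<in> I"
    using M[OF i] sumI[of d' "\<lambda>j Q. b' j Q - (\<Sum>k<d. N j k * b k Q)" "M i"] N
    by (intro add) auto
  moreover have "(b i Q - (\<Sum>j<d'. M i j * b' j Q)) +
      (\<Sum>j<d'. M i j * (b' j Q - (\<Sum>k<d. N j k * b k Q))) = b i Q - (\<Sum>k<d. c k * b k Q)" for Q
  proof -
    have "(\<Sum>k<d. c k * b k Q) = (\<Sum>k<d. \<Sum>j<d'. M i j * (N j k * b k Q))"
      by (simp add: c_def sum_distrib_right mult.assoc)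
    also have "\<dots> = (\<Sum>j<d'. M i j * (\<Sum>k<d. N j k * b k Q))"
      by (subst sum.swap) (simp add: sum_distrib_left)
    finally show ?thesis by (simp add: right_diff_distrib sum_subtractf)
  qed
  ultimately have 1: "(\<lambda>Q. b i Q - (\<Sum>k<d. c k * b k Q)) \<in> I" by simp
  have "(\<Sum>k<d. c' k * b k Q) = b i Q" for Q
  proof -
    have "(\<Sum>k<d. c' k * b k Q) = (\<Sum>k<d. if i = k then b k Q else 0)"
      by (intro sum.cong) (auto simp: c'_def)
    then show ?thesis using i by simp
  qed
  then have 2: "(\<lambda>Q. b i Q - (\<Sum>k<d. c' k * b k Q)) \<in> I" using zero by simp
  have "b i \<in> R" using b i by (simp add: basis_mod_def)
  from basis_mod_unique[OF b this 1 2 i] show ?thesis using i by (simp add: c_def c'_def)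
qed

text \<open>Both transition matrices multiply to the identity, and \<open>tr (M N) = tr (N M)\<close>.\<close>

lemma has_codim_unique:
  assumes d: "has_codim R I d" and d': "has_codim R I d'"
    and zero: "(\<lambda>_. 0) \<in> I"
    and add: "\<And>f g. f \<in> I \<Longrightarrow> g \<in> I \<Longrightarrow> (\<lambda>Q. f Q + g Q) \<in> I"
    and scale: "\<And>f c. f \<in> I \<Longrightarrow> (\<lambda>Q. c * f Q) \<in> I"
  shows "d = d'"
proof -
  obtain b b' where b: "basis_mod R I d b" and b': "basis_mod R I d' b'"
    using d d' by (auto simp: has_codim_def)
  have "\<forall>i. \<exists>c. i < d \<longrightarrow> (\<lambda>Q. b i Q - (\<Sum>j<d'. c j * b' j Q)) \<in> I"
    using basis_mod_expand[OF b' basis_mod_mem[OF b]] by blast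
  then obtain M where M: "\<And>i. i < d \<Longrightarrow> (\<lambda>Q. b i Q - (\<Sum>j<d'. M i j * b' j Q)) \<in> I"
    by metis
  have "\<forall>i. \<exists>c. i < d' \<longrightarrow> (\<lambda>Q. b' i Q - (\<Sum>j<d. c j * b j Q)) \<in> I"
    using basis_mod_expand[OF b basis_mod_mem[OF b']] by blast
  then obtain N where N: "\<And>i. i < d' \<Longrightarrow> (\<lambda>Q. b' i Q - (\<Sum>j<d. N i j * b j Q)) \<in> I"
    by metis
  have "(\<Sum>j<d'. M i j * N j i) = 1" if "i < d" for i
    by (rule basis_mod_transition[where M = M and N = N, OF b b']; fact zero add scale M N that)
  then have "(\<Sum>i<d. \<Sum>j<d'. M i j * N j i) = of_nat d" by simp
  moreover have "(\<Sum>i<d. N j i * M i j) = 1" if "j < d'" for j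
    by (rule basis_mod_transition[where M = N and N = M, OF b' b]; fact zero add scale M N that)
  then have "(\<Sum>j<d'. \<Sum>i<d. N j i * M i j) = of_nat d'" by simp
  moreover have "(\<Sum>i<d. \<Sum>j<d'. M i j * N j i) = (\<Sum>j<d'. \<Sum>i<d. N j i * M i j)"
    by (subst sum.swap) (simp add: mult.commute)
  ultimately have "of_nat d = (of_nat d' :: complex)" by simp
  then show ?thesis using of_nat_eq_iff by blast
qed

section \<open>Newton interpolation of rational functions\<close>

text \<open>Synthetic division is the quotient in \<open>p = (z - a) q + p(a)\<close>, which is
  determined by cancelling \<open>z - a\<close>; the same cancellation proves the rules for
  multiples below.\<close>

lemma synthetic_div_add:
  fixes p q :: "'a::idom poly"
  shows "synthetic_div (p + q) a = synthetic_div p a + synthetic_div q a"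
proof -
  have aux: "l * x = l * (y + y')" if "l * x + (u + v) = (l * y + u) + (l * y' + v)"
    for l x y y' u v :: "'a poly"
    using that by (simp add: algebra_simps)
  have const: "[:poly p a:] + [:poly q a:] = [:poly (p + q) a:]" by simp
  have "[:-a, 1:] * synthetic_div (p + q) a + ([:poly p a:] + [:poly q a:]) =
      ([:-a, 1:] * synthetic_div p a + [:poly p a:]) + ([:-a, 1:] * synthetic_div q a + [:poly q a:])"
    unfolding const by (simp only: synthetic_div_correct')
  then have "[:-a, 1:] * synthetic_div (p + q) a = [:-a, 1:] * (synthetic_div p a + synthetic_div q a)"
    by (rule aux)
  then show ?thesis by (metis mult_cancel_left pCons_eq_0_iff one_neq_zero)
qed

lemma synthetic_div_smult:
  fixes p :: "'a::idom poly"
  shows "synthetic_div (Polynomial.smult c p) a = Polynomial.smult c (synthetic_div p a)"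
proof -
  have "[:-a, 1:] * synthetic_div (Polynomial.smult c p) a + [:poly (Polynomial.smult c p) a:] =
      Polynomial.smult c ([:-a, 1:] * synthetic_div p a + [:poly p a:])"
    by (simp only: synthetic_div_correct')
  then have "[:-a, 1:] * synthetic_div (Polynomial.smult c p) a = [:-a, 1:] * Polynomial.smult c (synthetic_div p a)"
    by (simp add: smult_add_right)
  then show ?thesis by (metis mult_cancel_left pCons_eq_0_iff one_neq_zero)
qed

lemma linear_times_synthetic_div:
  fixes p :: "'a::idom poly"
  assumes "poly p a = 0"
  shows "[:-a, 1:] * synthetic_div p a = p"
  using synthetic_div_correct'[of a p] assms by simp

lemma synthetic_div_mult:
  fixes p q :: "'a::idom poly"
  assumes "poly p a = 0"
  shows "synthetic_div (p * q) a = synthetic_div p a * q"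
proof -
  have "[:-a, 1:] * synthetic_div (p * q) a = p * q"
    using assms by (intro linear_times_synthetic_div) simp
  also have "\<dots> = [:-a, 1:] * (synthetic_div p a * q)"
    using linear_times_synthetic_div[OF assms] by (metis mult.assoc)
  finally show ?thesis by (metis mult_cancel_left pCons_eq_0_iff one_neq_zero)
qed

text \<open>The coefficients of the Newton interpolation of \<open>A / B\<close> at the (possibly repeated) nodes;
  each step replaces \<open>g\<close> by \<open>(g(z) - g(a)) / (z - a)\<close>, which has the same denominator.\<close>

primrec newton :: "'a::field poly \<Rightarrow> 'a list \<Rightarrow> 'a poly \<Rightarrow> 'a list" where
  "newton B [] A = []"
| "newton B (a # as) A = poly A a / poly B a #
     newton B as (synthetic_div (A - Polynomial.smult (poly A a / poly B a) B) a)"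

lemma length_newton [simp]: "length (newton B as A) = length as"
  by (induction as arbitrary: A) auto

text \<open>Newton coefficients depend on a fraction only through its value: the remainder
  \<open>A - c B\<close> vanishes at the node, so a common factor \<open>Q\<close> passes through
  the division by \<open>z - a\<close>.\<close>

lemma newton_mult:
  assumes "\<forall>a\<in>set as. poly B a \<noteq> 0 \<and> poly Q a \<noteq> 0"
  shows "newton (B * Q) as (A * Q) = newton B as A"
  using assms
proof (induction as arbitrary: A)
  case (Cons a as)
  let ?c = "poly A a / poly B a"
  have "A * Q - Polynomial.smult ?c (B * Q) = (A - Polynomial.smult ?c B) * Q" by (simp add: algebra_simps)
  moreover have "synthetic_div ((A - Polynomial.smult ?c B) * Q) a = synthetic_div (A - Polynomial.smult ?c B) a * Q"
    by (rule synthetic_div_mult) (use Cons.prems in simp)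
  ultimately show ?case using Cons by simp
qed simp

lemma newton_add:
  "i < length as \<Longrightarrow> newton B as (A + A') ! i = newton B as A ! i + newton B as A' ! i"
proof (induction as arbitrary: A A' i)
  case (Cons a as)
  have "A + A' - Polynomial.smult (poly (A + A') a / poly B a) B =
      (A - Polynomial.smult (poly A a / poly B a) B) + (A' - Polynomial.smult (poly A' a / poly B a) B)"
    by (simp add: add_divide_distrib smult_add_left)
  then show ?case
    using Cons by (cases i) (simp_all only: newton.simps synthetic_div_add, simp_all add: add_divide_distrib)
qed simp

lemma newton_smult:
  "i < length as \<Longrightarrow> newton B as (Polynomial.smult c A) ! i = c * newton B as A ! i"
proof (induction as arbitrary: A i)
  case (Cons a as)
  have "Polynomial.smult c A - Polynomial.smult (poly (Polynomial.smult c A) a / poly B a) B = Polynomial.smult c (A - Polynomial.smult (poly A a / poly B a) B)"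
    by (simp add: smult_diff_right)
  then show ?case
    using Cons by (cases i) (simp_all only: newton.simps synthetic_div_smult, simp_all)
qed simp

text \<open>When the first coefficient is 0, \<open>A\<close> itself vanishes at \<open>a\<close>
  and the next numerator is just \<open>A / (z - a)\<close>. Repeated nodes therefore count
  multiplicities of zeros.\<close>

lemma newton_eq_0_iff:
  assumes "\<forall>a\<in>set as. poly B a \<noteq> 0"
  shows "(\<forall>i<length as. newton B as A ! i = 0) \<longleftrightarrow> (\<Prod>a\<leftarrow>as. [:-a, 1:]) dvd A"
  using assms
proof (induction as arbitrary: A)
  case (Cons a as)
  have "(\<forall>i<length (a # as). newton B (a # as) A ! i = 0) \<longleftrightarrow>
      poly A a = 0 \<and> (\<Prod>a\<leftarrow>as. [:-a, 1:]) dvd synthetic_div A a"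
    using Cons by (cases "poly A a = 0") (auto simp: All_less_Suc2)
  also have "\<dots> \<longleftrightarrow> (\<Prod>a\<leftarrow>a # as. [:-a, 1:]) dvd A"
  proof (cases "poly A a = 0")
    case True
    then have "(\<Prod>a\<leftarrow>a # as. [:-a, 1:]) dvd A \<longleftrightarrow>
      [:-a, 1:] * (\<Prod>a\<leftarrow>as. [:-a, 1:]) dvd [:-a, 1:] * synthetic_div A a"
      by (simp only: linear_times_synthetic_div list.map prod_list.Cons)
    then show ?thesis using True by (subst (asm) dvd_mult_cancel_left) auto
  next
    case False
    then have "\<not> [:-a, 1:] dvd A" by (simp add: poly_eq_0_iff_dvd)
    then show ?thesis using False by (auto dest: dvd_mult_left)
  qed
  finally show ?case .
qed simp

lemma coeff_synthetic_div:
  "coeff (synthetic_div p a) k = coeff p (Suc k) + a * coeff (synthetic_div p a) (Suc k)"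
  for p :: "'a::idom poly"
  using arg_cong[OF synthetic_div_correct'[of a p], of "\<lambda>p. coeff p (Suc k)"] by (simp add: algebra_simps)

text \<open>With all nodes at 0 and denominator 1, each step drops the constant term and divides by
  \<open>z\<close>. This makes the functionals at the fixed point dual to the powers of the affine
  coordinate.\<close>

lemma newton_zeros: "i < k \<Longrightarrow> newton 1 (replicate k 0) A ! i = coeff A i"
proof (induction k arbitrary: A i)
  case (Suc k)
  show ?case
  proof (cases i)
    case 0
    then show ?thesis by (simp add: poly_0_coeff_0)
  next
    case (Suc j)
    have "coeff (synthetic_div (A - Polynomial.smult (poly A 0) 1) 0) j = coeff A (Suc j)"
      using coeff_synthetic_div[of "A - Polynomial.smult (poly A 0) 1" 0 j] by simp
    then show ?thesis using Suc Suc.IH[of j] Suc.prems by simp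
  qed
qed simp

text \<open>The coefficients of the quotient satisfy a downward recursion, so convergence is proved
  from the top; the uniform degree bound \<open>N\<close> provides a common starting index, where
  the coefficient is 0.\<close>

lemma tendsto_coeff_synthetic_div:
  fixes A :: "complex \<Rightarrow> complex poly" and a :: "complex \<Rightarrow> complex"
  assumes A: "\<And>k. ((\<lambda>t. coeff (A t) k) \<longlongrightarrow> coeff (A s) k) F" and deg: "\<And>t. degree (A t) \<le> N"
    and a: "(a \<longlongrightarrow> a s) F"
  shows "((\<lambda>t. coeff (synthetic_div (A t) (a t)) k) \<longlongrightarrow> coeff (synthetic_div (A s) (a s)) k) F"
proof (cases "k \<le> N")
  case True
  then show ?thesis
  proof (induction rule: inc_induct)
    case base
    have "coeff (synthetic_div (A t) (a t)) N = 0" for t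
    proof (cases "degree (A t) = 0")
      case False
      then show ?thesis using deg[of t] by (intro coeff_eq_0) (simp add: degree_synthetic_div)
    qed (simp add: synthetic_div_eq_0_iff[THEN iffD2])
    then show ?case by simp
  next
    case (step k)
    show ?case
      by (subst (1 2) coeff_synthetic_div) (intro tendsto_add tendsto_mult A a step)
  qed
next
  case False
  have "coeff (synthetic_div (A t) (a t)) k = 0" for t
    using deg[of t] False by (intro coeff_eq_0) (simp add: degree_synthetic_div)
  then show ?thesis by simp
qed

lemma tendsto_poly:
  fixes A :: "complex \<Rightarrow> complex poly" and a :: "complex \<Rightarrow> complex"
  assumes A: "\<And>k. ((\<lambda>t. coeff (A t) k) \<longlongrightarrow> coeff (A s) k) F" and deg: "\<And>t. degree (A t) \<le> N"
    and a: "(a \<longlongrightarrow> a s) F"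
  shows "((\<lambda>t. poly (A t) (a t)) \<longlongrightarrow> poly (A s) (a s)) F"
proof -
  have "poly (A t) x = (\<Sum>i\<le>N. coeff (A t) i * x ^ i)" for t x
    unfolding poly_altdef using deg[of t]
    by (intro sum.mono_neutral_left) (auto simp: coeff_eq_0)
  then show ?thesis by (simp only:) (intro tendsto_intros A a)
qed

text \<open>The numerator must be allowed to vary with \<open>t\<close>, even if one starts with a
  fixed one: after one step the remainder depends on the node \<open>t * y\<close>. The only
  division is by values of the denominator, never by differences of nodes, so the nodes may
  collide.\<close>

lemma tendsto_newton:
  fixes A :: "complex \<Rightarrow> complex poly"
  assumes A: "\<And>k. (\<lambda>t. coeff (A t) k) \<midarrow>0\<rightarrow> coeff (A 0) k" and deg: "\<And>t. degree (A t) \<le> N"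
    and B: "poly B 0 \<noteq> 0" and i: "i < length ys"
  shows "(\<lambda>t. newton B (map ((*) t) ys) (A t) ! i) \<midarrow>0\<rightarrow> newton B (map ((*) 0) ys) (A 0) ! i"
  using A deg i
proof (induction ys arbitrary: A N i)
  case (Cons y ys)
  define c where "c t = poly (A t) (t * y) / poly B (t * y)" for t
  have y: "(\<lambda>t. t * y) \<midarrow>0\<rightarrow> 0 * y" by (intro tendsto_intros)
  have c: "c \<midarrow>0\<rightarrow> c 0"
    unfolding c_def using B
    by (intro tendsto_divide tendsto_poly[OF Cons.prems(1,2) y]
        tendsto_poly[where A = "\<lambda>_. B" and N = "degree B", OF tendsto_const _ y]) auto
  show ?case
  proof (cases i)
    case 0
    then show ?thesis using c by (simp add: c_def[abs_def])
  next
    case (Suc j)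
    let ?A = "\<lambda>t. A t - Polynomial.smult (c t) B"
    have deg': "degree (?A t) \<le> max N (degree B)" for t
      by (rule degree_diff_le) (use Cons.prems(2)[of t] in \<open>auto intro: order.trans[OF degree_smult_le]\<close>)
    have "(\<lambda>t. newton B (map ((*) t) ys) (synthetic_div (?A t) (t * y)) ! j) \<midarrow>0\<rightarrow>
        newton B (map ((*) 0) ys) (synthetic_div (?A 0) (0 * y)) ! j"
    proof (rule Cons.IH)
      fix k
      show "(\<lambda>t. coeff (synthetic_div (?A t) (t * y)) k) \<midarrow>0\<rightarrow> coeff (synthetic_div (?A 0) (0 * y)) k"
        by (rule tendsto_coeff_synthetic_div[where A = ?A, OF _ deg' y])
          (auto intro!: tendsto_intros Cons.prems c)
      show "degree (synthetic_div (?A t) (t * y)) \<le> max N (degree B)" for t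
        using deg'[of t] by (simp add: degree_synthetic_div)
      show "j < length ys" using Cons.prems Suc by simp
    qed
    then show ?thesis by (simp only: Suc newton.simps list.map nth_Cons_Suc c_def)
  qed
qed simp

text \<open>Passes from the list of nodes to orders at individual points, which is how stalks see
  the condition. If \<open>A\<close> does not vanish at the first node, both sides fail; otherwise
  one linear factor is split off and the order drops by one at that node.\<close>

lemma prod_linear_dvd_iff:
  fixes A :: "complex poly"
  shows "(\<Prod>a\<leftarrow>as. [:-a, 1:]) dvd A \<longleftrightarrow> (\<forall>z. [:-z, 1:] ^ count (mset as) z dvd A)"
proof (cases "A = 0")
  case False
  then show ?thesis
  proof (induction as arbitrary: A)
    case (Cons a as)
    show ?case
    proof (cases "poly A a = 0")
      case True
      define A' where "A' = synthetic_div A a"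
      have A: "A = [:-a, 1:] * A'" using linear_times_synthetic_div[OF True] by (simp add: A'_def)
      then have A': "A' \<noteq> 0" using Cons.prems by auto
      have lin: "order z [:-a, 1:] = of_bool (z = a)" for z
        using order_power_n_n[of a 1] by (auto intro: order_0I)
      have ord: "order z A = of_bool (z = a) + order z A'" for z
        using order_mult[of "[:-a, 1:]" A' z] Cons.prems A lin by simp
      have "(\<Prod>a\<leftarrow>a # as. [:-a, 1:]) dvd A \<longleftrightarrow> (\<Prod>a\<leftarrow>as. [:-a, 1:]) dvd A'"
        unfolding A list.map prod_list.Cons by (subst dvd_mult_cancel_left) auto
      also have "\<dots> \<longleftrightarrow> (\<forall>z. count (mset as) z \<le> order z A')"
        using Cons.IH[OF A'] A' by (simp add: order_divides)
      also have "\<dots> \<longleftrightarrow> (\<forall>z. count (mset (a # as)) z \<le> order z A)"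
        unfolding ord by auto
      also have "\<dots> \<longleftrightarrow> (\<forall>z. [:-z, 1:] ^ count (mset (a # as)) z dvd A)"
        using Cons.prems by (simp only: order_divides simp_thms)
      finally show ?thesis .
    next
      case False
      then have n: "\<not> [:-a, 1:] dvd A" by (simp add: poly_eq_0_iff_dvd)
      moreover have "[:-a, 1:] dvd [:-a, 1:] ^ count (mset (a # as)) a" by (rule dvd_power) simp
      ultimately have "\<not> [:-a, 1:] ^ count (mset (a # as)) a dvd A" by (meson dvd_trans)
      moreover have "\<not> (\<Prod>a\<leftarrow>a # as. [:-a, 1:]) dvd A" using n
        by (metis dvd_mult_left list.map(2) prod_list.Cons)
      ultimately show ?thesis by blast
    qed
  qed simp
qed simp

section \<open>Functions given by one fraction on an infinite set\<close>

definition represents :: "complex set \<Rightarrow> (complex \<Rightarrow> complex) \<Rightarrow> complex poly \<Rightarrow> complex poly \<Rightarrow> bool" where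
  "represents S g A B \<longleftrightarrow> (\<forall>z\<in>S. poly B z \<noteq> 0 \<and> g z = poly A z / poly B z)"

lemma poly_eqI_infinite:
  fixes p q :: "'a::idom poly"
  assumes "infinite S" "\<And>z. z \<in> S \<Longrightarrow> poly p z = poly q z"
  shows "p = q"
proof (rule ccontr)
  assume "p \<noteq> q"
  then have "finite {z. poly (p - q) z = 0}" by (intro poly_roots_finite) simp
  moreover have "S \<subseteq> {z. poly (p - q) z = 0}" using assms(2) by auto
  ultimately show False using assms(1) finite_subset by blast
qed

lemma represents_cross:
  assumes "infinite S" "represents S g A B" "represents S g A' B'"
  shows "A * B' = A' * B"
  by (rule poly_eqI_infinite[OF assms(1)]) (use assms(2,3) in \<open>auto simp: represents_def field_simps\<close>)

lemma represents_add_scale: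
  assumes "represents S g A B" "represents S h A' B'"
  shows "represents S (\<lambda>z. g z + c * h z) (A * B' + Polynomial.smult c (A' * B)) (B * B')"
  using assms by (auto simp: represents_def field_simps)

text \<open>Choosing some fraction turns the Newton coefficients into functionals of the function
  \<open>g\<close> alone. For a \<open>g\<close> without a fraction the value is arbitrary, so the
  facts below carry a \<open>represents\<close> hypothesis.\<close>

definition newton_coeffs :: "complex set \<Rightarrow> complex list \<Rightarrow> (complex \<Rightarrow> complex) \<Rightarrow> complex list" where
  "newton_coeffs S as g = (let (A, B) = (SOME (A, B). represents S g A B) in newton B as A)"

text \<open>Two fractions for \<open>g\<close> agree after cross-multiplication because
  \<open>S\<close> is infinite; \<open>newton_mult\<close> then brings both to the denominator
  \<open>B * B'\<close>.\<close>

lemma newton_coeffs_eq: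
  assumes "infinite S" "set as \<subseteq> S" "represents S g A B"
  shows "newton_coeffs S as g = newton B as A"
proof -
  obtain A' B' where AB': "(SOME (A, B). represents S g A B) = (A', B')" by fastforce
  have rep: "represents S g A' B'"
    using someI[of "\<lambda>(A, B). represents S g A B" "(A, B)"] assms(3) AB' by simp
  have nz: "\<forall>a\<in>set as. poly B a \<noteq> 0 \<and> poly B' a \<noteq> 0" "\<forall>a\<in>set as. poly B' a \<noteq> 0 \<and> poly B a \<noteq> 0"
    using assms(2,3) rep by (auto simp: represents_def)
  have "newton B' as A' = newton (B' * B) as (A' * B)" using newton_mult[OF nz(2)] by simp
  also have "\<dots> = newton (B * B') as (A * B')"
    using represents_cross[OF assms(1,3) rep] by (simp add: mult.commute)
  also have "\<dots> = newton B as A" using newton_mult[OF nz(1)] by simp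
  finally show ?thesis by (simp add: newton_coeffs_def AB')
qed

lemma newton_coeffs_add_scale:
  assumes S: "infinite S" "set as \<subseteq> S" and g: "represents S g A B" and h: "represents S h A' B'"
    and i: "i < length as"
  shows "newton_coeffs S as (\<lambda>z. g z + c * h z) ! i = newton_coeffs S as g ! i + c * newton_coeffs S as h ! i"
proof -
  have nz: "\<forall>a\<in>set as. poly B a \<noteq> 0 \<and> poly B' a \<noteq> 0" "\<forall>a\<in>set as. poly B' a \<noteq> 0 \<and> poly B a \<noteq> 0"
    using S g h by (auto simp: represents_def)
  have "newton_coeffs S as (\<lambda>z. g z + c * h z) ! i =
      newton (B * B') as (A * B') ! i + c * newton (B' * B) as (A' * B) ! i"
    using newton_coeffs_eq[OF S represents_add_scale[OF g h]] i
    by (simp add: newton_add newton_smult mult.commute)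
  then show ?thesis
    using newton_mult[OF nz(1)] newton_mult[OF nz(2)] newton_coeffs_eq[OF S g] newton_coeffs_eq[OF S h]
    by simp
qed

lemma newton_coeffs_lincomb:
  fixes n :: nat
  assumes S: "infinite S" "set as \<subseteq> S" and g: "represents S g A B"
    and h: "\<And>k. k < n \<Longrightarrow> \<exists>A B. represents S (h k) A B" and i: "i < length as"
  shows "newton_coeffs S as (\<lambda>z. g z - (\<Sum>k<n. c k * h k z)) ! i =
    newton_coeffs S as g ! i - (\<Sum>k<n. c k * newton_coeffs S as (h k) ! i)"
proof -
  \<comment> \<open>Representability is proved along with the formula, since the induction step
    needs a fraction for the partial difference.\<close>
  have "(\<exists>A B. represents S (\<lambda>z. g z - (\<Sum>k<n. c k * h k z)) A B) \<and> ?thesis"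
    using h
  proof (induction n)
    case 0
    show ?case using g by auto
  next
    case (Suc n)
    then obtain A1 B1 A2 B2 where 1: "represents S (\<lambda>z. g z - (\<Sum>k<n. c k * h k z)) A1 B1"
      and 2: "represents S (h n) A2 B2"
      by (metis less_Suc_eq)
    have eq: "(\<lambda>z. g z - (\<Sum>k<Suc n. c k * h k z)) = (\<lambda>z. (g z - (\<Sum>k<n. c k * h k z)) + (- c n) * h n z)"
      by (simp add: algebra_simps)
    show ?case
      unfolding eq newton_coeffs_add_scale[OF S 1 2 i]
      using represents_add_scale[OF 1 2, of "- c n"] Suc by (auto simp: algebra_simps)
  qed
  then show ?thesis by blast
qed

lemma newton_coeffs_eq_0_iff:
  assumes "infinite S" "set as \<subseteq> S" "represents S g A B"
  shows "(\<forall>i<length as. newton_coeffs S as g ! i = 0) \<longleftrightarrow> (\<forall>z. [:-z, 1:] ^ count (mset as) z dvd A)"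
  using newton_coeffs_eq[OF assms] newton_eq_0_iff[of as B A] prod_linear_dvd_iff[of as A] assms(2,3)
  by (auto simp: represents_def)

lemma eventually_nodes_in:
  assumes "open S" "(0::complex) \<in> S"
  shows "\<forall>\<^sub>F t in nhds 0. set (map ((*) t) ys) \<subseteq> S"
proof -
  have "\<forall>\<^sub>F t in nhds 0. t * y \<in> S" for y
  proof -
    have "((\<lambda>t. t * y) \<longlongrightarrow> 0 * y) (nhds 0)"
      by (rule tendsto_mult[OF filterlim_ident tendsto_const])
    then show ?thesis using topological_tendstoD[of _ "0 * y" "nhds 0" S] assms by simp
  qed
  then have "\<forall>\<^sub>F t in nhds 0. \<forall>y\<in>set ys. t * y \<in> S" by (intro eventually_ball_finite) auto
  then show ?thesis by eventually_elim auto
qed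

text \<open>For large \<open>t\<close> the nodes may leave \<open>S\<close>, where nothing is known
  about the chosen fraction; the limit sees only small \<open>t\<close>, for which the fixed
  fraction \<open>A / B\<close> computes the coefficients.\<close>

lemma tendsto_newton_coeffs:
  assumes S: "infinite S" "open S" "0 \<in> S" and g: "represents S g A B" and i: "i < length ys"
  shows "(\<lambda>t. newton_coeffs S (map ((*) t) ys) g ! i) \<midarrow>0\<rightarrow> newton_coeffs S (map ((*) 0) ys) g ! i"
proof -
  note ev = eventually_nodes_in[OF S(2,3), of ys]
  have eq: "newton_coeffs S (map ((*) t) ys) g = newton B (map ((*) t) ys) A"
    if "set (map ((*) t) ys) \<subseteq> S" for t
    using newton_coeffs_eq[OF S(1) that g] .
  have "(\<lambda>t. newton B (map ((*) t) ys) A ! i) \<midarrow>0\<rightarrow> newton B (map ((*) 0) ys) A ! i"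
    using tendsto_newton[of "\<lambda>_. A" "degree A" B i ys] S(3) g i by (auto simp: represents_def)
  moreover have "\<forall>\<^sub>F t in at 0. newton B (map ((*) t) ys) A ! i = newton_coeffs S (map ((*) t) ys) g ! i"
    using ev eq unfolding eventually_nhds_conv_at by (auto elim: eventually_mono)
  ultimately have "(\<lambda>t. newton_coeffs S (map ((*) t) ys) g ! i) \<midarrow>0\<rightarrow> newton B (map ((*) 0) ys) A ! i"
    by (rule Lim_transform_eventually)
  then show ?thesis by (simp only: eq[OF eventually_nhds_x_imp_x[OF ev]])
qed

section \<open>Forms\<close>

lemma finite_exponents: "finite {m :: 'n::finite \<Rightarrow> nat. (\<Sum>i\<in>UNIV. m i) = d}"
proof (rule finite_subset)
  show "{m :: 'n \<Rightarrow> nat. (\<Sum>i\<in>UNIV. m i) = d} \<subseteq> (\<Pi>\<^sub>E i\<in>UNIV. {..d})"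
    by (auto intro: member_le_sum)
qed (auto intro: finite_PiE)

lemma hom_form_zero: "hom_form d (\<lambda>_. 0)"
  unfolding hom_form_def by (rule exI[of _ "\<lambda>_. 0"]) simp

lemma hom_form_add: "hom_form d F \<Longrightarrow> hom_form d G \<Longrightarrow> hom_form d (\<lambda>v. F v + G v)"
  unfolding hom_form_def
proof (elim exE)
  fix a b
  assume "F = (\<lambda>v. \<Sum>m | (\<Sum>i\<in>UNIV. m i) = d. a m * (\<Prod>i\<in>UNIV. (v $ i) ^ m i))"
    "G = (\<lambda>v. \<Sum>m | (\<Sum>i\<in>UNIV. m i) = d. b m * (\<Prod>i\<in>UNIV. (v $ i) ^ m i))"
  then show "\<exists>a. (\<lambda>v. F v + G v) =
      (\<lambda>v. \<Sum>m | (\<Sum>i\<in>UNIV. m i) = d. a m * (\<Prod>i\<in>UNIV. (v $ i) ^ m i))"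
    by (intro exI[of _ "\<lambda>m. a m + b m"]) (simp add: sum.distrib distrib_right)
qed

lemma hom_form_scale: "hom_form d F \<Longrightarrow> hom_form d (\<lambda>v. c * F v)"
  unfolding hom_form_def
proof (elim exE)
  fix a
  assume "F = (\<lambda>v. \<Sum>m | (\<Sum>i\<in>UNIV. m i) = d. a m * (\<Prod>i\<in>UNIV. (v $ i) ^ m i))"
  then show "\<exists>a. (\<lambda>v. c * F v) =
      (\<lambda>v. \<Sum>m | (\<Sum>i\<in>UNIV. m i) = d. a m * (\<Prod>i\<in>UNIV. (v $ i) ^ m i))"
    by (intro exI[of _ "\<lambda>m. c * a m"]) (simp add: sum_distrib_left mult.assoc)
qed

lemma hom_form_diff: "hom_form d F \<Longrightarrow> hom_form d G \<Longrightarrow> hom_form d (\<lambda>v. F v - G v)"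
  using hom_form_add[OF _ hom_form_scale[of d G "-1"], of F] by simp

lemma hom_form_sum: "(\<And>x. x \<in> A \<Longrightarrow> hom_form d (F x)) \<Longrightarrow> hom_form d (\<lambda>v. \<Sum>x\<in>A. F x v)"
  by (induction A rule: infinite_finite_induct) (auto intro: hom_form_zero hom_form_add)

lemma hom_form_monomial:
  assumes "(\<Sum>i\<in>UNIV. m i) = d"
  shows "hom_form d (\<lambda>v :: complex ^ 'n::finite. \<Prod>i\<in>UNIV. (v $ i) ^ m i)"
  unfolding hom_form_def
proof (intro exI ext)
  fix v :: "complex ^ 'n"
  have "(\<Sum>k | (\<Sum>i\<in>UNIV. k i) = d. of_bool (k = m) * (\<Prod>i\<in>UNIV. (v $ i) ^ k i)) =
      (\<Sum>k | (\<Sum>i\<in>UNIV. k i) = d. if k = m then \<Prod>i\<in>UNIV. (v $ i) ^ k i else 0)"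
    by (intro sum.cong) auto
  then show "(\<Prod>i\<in>UNIV. (v $ i) ^ m i) =
      (\<Sum>k | (\<Sum>i\<in>UNIV. k i) = d. of_bool (k = m) * (\<Prod>i\<in>UNIV. (v $ i) ^ k i))"
    using assms finite_exponents[of d, where 'n = 'n] by simp
qed

lemma hom_form_mult:
  fixes F G :: "complex ^ 'n::finite \<Rightarrow> complex"
  assumes "hom_form d F" "hom_form e G"
  shows "hom_form (d + e) (\<lambda>v. F v * G v)"
proof -
  obtain a b where a: "F = (\<lambda>v. \<Sum>m | (\<Sum>i\<in>UNIV. m i) = d. a m * (\<Prod>i\<in>UNIV. (v $ i) ^ m i))"
    and b: "G = (\<lambda>v. \<Sum>m | (\<Sum>i\<in>UNIV. m i) = e. b m * (\<Prod>i\<in>UNIV. (v $ i) ^ m i))"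
    using assms by (auto simp: hom_form_def)
  have eq: "(\<lambda>v. F v * G v) = (\<lambda>v. \<Sum>m | (\<Sum>i\<in>UNIV. m i) = d. \<Sum>m' | (\<Sum>i\<in>UNIV. m' i) = e.
      (a m * b m') * (\<Prod>i\<in>UNIV. (v $ i) ^ (m i + m' i)))"
    unfolding a b by (simp add: sum_product power_add prod.distrib mult_ac)
  show ?thesis unfolding eq
    by (intro hom_form_sum hom_form_scale hom_form_monomial) (auto simp: sum.distrib)
qed

lemma hom_form_const: "hom_form 0 (\<lambda>v :: complex ^ 'n::finite. c)"
  using hom_form_scale[OF hom_form_monomial[of "\<lambda>_ :: 'n. 0" 0], of c] by simp

lemma hom_form_coord: "hom_form 1 (\<lambda>v :: complex ^ 'n::finite. v $ j)"
proof -
  have "(\<lambda>v :: complex ^ 'n. \<Prod>i\<in>UNIV. (v $ i) ^ (if i = j then 1 else 0)) = (\<lambda>v. v $ j)"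
  proof
    fix v :: "complex ^ 'n"
    have "(\<Prod>i\<in>UNIV. (v $ i) ^ (if i = j then 1 else 0)) = (\<Prod>i\<in>UNIV. if i = j then v $ i else 1)"
      by (intro prod.cong) auto
    then show "(\<Prod>i\<in>UNIV. (v $ i) ^ (if i = j then 1 else 0)) = v $ j" by simp
  qed
  then show ?thesis using hom_form_monomial[of "\<lambda>i :: 'n. if i = j then 1 else 0" 1] by simp
qed

section \<open>Forms on the product with the affine line\<close>

lemma cyl_form_monomial: "hom_form d G \<Longrightarrow> cyl_form d (\<lambda>v z. G v * z ^ k)"
  unfolding cyl_form_def
proof (intro exI conjI)
  assume "hom_form d G"
  then show "\<forall>j\<le>k. hom_form d (if j = k then G else (\<lambda>_. 0))" by (simp add: hom_form_zero)
  have "(if j = k then G else (\<lambda>_. 0)) v * z ^ j = (if j = k then G v * z ^ k else 0)" for j v and z :: complex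
    by simp
  then show "(\<lambda>v z. G v * z ^ k) = (\<lambda>v z. \<Sum>j\<le>k. (if j = k then G else (\<lambda>_. 0)) v * z ^ j)"
    by (simp only:) simp
qed

lemma cyl_form_zero: "cyl_form d (\<lambda>v z. 0)"
  using cyl_form_monomial[OF hom_form_zero, of d 0] by simp

lemma cyl_form_add:
  assumes "cyl_form d F" "cyl_form d G"
  shows "cyl_form d (\<lambda>v z. F v z + G v z)"
proof -
  obtain r a where a: "\<forall>j\<le>r. hom_form d (a j)" "F = (\<lambda>v z. \<Sum>j\<le>r. a j v * z ^ j)"
    using assms(1) by (auto simp: cyl_form_def)
  obtain s b where b: "\<forall>j\<le>s. hom_form d (b j)" "G = (\<lambda>v z. \<Sum>j\<le>s. b j v * z ^ j)"
    using assms(2) by (auto simp: cyl_form_def)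
  define c where "c j v = (if j \<le> r then a j v else 0) + (if j \<le> s then b j v else 0)" for j v
  have "hom_form d (\<lambda>v. if j \<le> r then a j v else 0)" for j
    using a(1) by (cases "j \<le> r") (simp_all add: hom_form_zero)
  moreover have "hom_form d (\<lambda>v. if j \<le> s then b j v else 0)" for j
    using b(1) by (cases "j \<le> s") (simp_all add: hom_form_zero)
  ultimately have "hom_form d (c j)" for j
    unfolding c_def by (rule hom_form_add)
  moreover have "F v z + G v z = (\<Sum>j\<le>max r s. c j v * z ^ j)" for v z
  proof -
    have "F v z = (\<Sum>j\<le>max r s. (if j \<le> r then a j v else 0) * z ^ j)"
      unfolding a by (rule sum.mono_neutral_cong_left) auto
    moreover have "G v z = (\<Sum>j\<le>max r s. (if j \<le> s then b j v else 0) * z ^ j)"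
      unfolding b by (rule sum.mono_neutral_cong_left) auto
    ultimately show ?thesis by (simp add: c_def sum.distrib distrib_right)
  qed
  ultimately show ?thesis unfolding cyl_form_def by blast
qed

lemma cyl_form_sum: "(\<And>x. x \<in> A \<Longrightarrow> cyl_form d (F x)) \<Longrightarrow> cyl_form d (\<lambda>v z. \<Sum>x\<in>A. F x v z)"
  by (induction A rule: infinite_finite_induct) (auto intro: cyl_form_zero cyl_form_add)

lemma cyl_form_mult:
  assumes "cyl_form d F" "cyl_form e G"
  shows "cyl_form (d + e) (\<lambda>v z. F v z * G v z)"
proof -
  obtain r a where a: "\<forall>j\<le>r. hom_form d (a j)" "F = (\<lambda>v z. \<Sum>j\<le>r. a j v * z ^ j)"
    using assms(1) by (auto simp: cyl_form_def)
  obtain s b where b: "\<forall>j\<le>s. hom_form e (b j)" "G = (\<lambda>v z. \<Sum>j\<le>s. b j v * z ^ j)"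
    using assms(2) by (auto simp: cyl_form_def)
  have eq: "(\<lambda>v z. F v z * G v z) = (\<lambda>v z. \<Sum>j\<le>r. \<Sum>k\<le>s. (a j v * b k v) * z ^ (j + k))"
    unfolding a b by (simp add: sum_product power_add mult_ac)
  show ?thesis unfolding eq
    using a b by (intro cyl_form_sum cyl_form_monomial hom_form_mult) auto
qed

lemma cyl_form_hom: "hom_form d G \<Longrightarrow> cyl_form d (\<lambda>v z. G v)"
  using cyl_form_monomial[of d G 0] by simp

lemma cyl_form_poly: "cyl_form 0 (\<lambda>v z. poly p z)"
  unfolding poly_altdef by (intro cyl_form_sum cyl_form_monomial hom_form_const)

lemma cyl_form_const: "cyl_form 0 (\<lambda>v z. c)"
  by (intro cyl_form_hom hom_form_const)

lemma cyl_form_scale: "cyl_form d F \<Longrightarrow> cyl_form d (\<lambda>v z. c * F v z)"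
  using cyl_form_mult[OF cyl_form_const, of d F c] by simp

lemma cyl_form_line:
  assumes "cyl_form d F"
  obtains p where "\<And>z. F v z = poly p z"
proof -
  obtain r a where "F = (\<lambda>v z. \<Sum>j\<le>r. a j v * z ^ j)"
    using assms by (auto simp: cyl_form_def)
  then have "F v z = poly (\<Sum>j\<le>r. monom (a j v) j) z" for z
    by (simp add: poly_sum poly_monom)
  then show thesis by (rule that)
qed

section \<open>Separating points of projective space by forms\<close>

lemma hcoords:
  shows hcoords_nonzero: "hcoords x \<noteq> 0"
    and Rep_proj_eq: "Rep_proj x = range (\<lambda>c. c *s hcoords x)"
proof -
  obtain v where v: "v \<noteq> 0" "Rep_proj x = range (\<lambda>c. c *s v)" using Rep_proj[of x] by auto
  have "v \<in> Rep_proj x" unfolding v(2) by (rule range_eqI[of _ _ 1]) simp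
  then have "hcoords x \<in> Rep_proj x \<and> hcoords x \<noteq> 0"
    unfolding hcoords_def using v(1) by (intro someI[of "\<lambda>v. v \<in> Rep_proj x \<and> v \<noteq> 0" v]) simp
  then show nz: "hcoords x \<noteq> 0" and "Rep_proj x = range (\<lambda>c. c *s hcoords x)"
  proof -
    assume h: "hcoords x \<in> Rep_proj x \<and> hcoords x \<noteq> 0"
    then show "hcoords x \<noteq> 0" by simp
    obtain k where k: "hcoords x = k *s v" using h v(2) by auto
    then have "k \<noteq> 0" using h by auto
    have "c *s v = (c / k) *s hcoords x" for c using k \<open>k \<noteq> 0\<close> by (simp add: vector_smult_assoc)
    moreover have "c *s hcoords x = (c * k) *s v" for c using k by (simp add: vector_smult_assoc)
    ultimately show "Rep_proj x = range (\<lambda>c. c *s hcoords x)"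
      unfolding v(2) by (metis (no_types, lifting) image_cong image_subsetI rangeI subset_antisym)
  qed
qed

text \<open>The 2 by 2 minors of a vector with the coordinates of \<open>y\<close> are linear forms
  vanishing at \<open>y\<close>. If all minors involving an index where \<open>y\<close> has a
  nonzero coordinate vanished at \<open>x\<close>, the two coordinate vectors would be
  proportional.\<close>

lemma separate_points:
  assumes "x \<noteq> y"
  obtains L where "hom_form 1 L" "L (hcoords x) \<noteq> 0" "L (hcoords y) = 0"
proof -
  let ?u = "hcoords x" and ?w = "hcoords y"
  obtain i where i: "?w $ i \<noteq> 0" using hcoords_nonzero[of y] by (auto simp: Finite_Cartesian_Product.vec_eq_iff)
  have "\<exists>j. ?u $ j * ?w $ i - ?u $ i * ?w $ j \<noteq> 0"
  proof (rule ccontr)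
    assume "\<not> ?thesis"
    then have u: "?u = (?u $ i / ?w $ i) *s ?w"
      using i by (auto simp: Finite_Cartesian_Product.vec_eq_iff field_simps)
    define k where "k = ?u $ i / ?w $ i"
    have "k \<noteq> 0" using u hcoords_nonzero[of x] by (auto simp: k_def)
    have "c *s ?u = (c * k) *s ?w" "c *s ?w = (c / k) *s ?u" for c
      using u \<open>k \<noteq> 0\<close> unfolding k_def[symmetric] by (simp_all add: vector_smult_assoc)
    then have "range (\<lambda>c. c *s ?u) = range (\<lambda>c. c *s ?w)"
      by (metis (no_types, lifting) image_subsetI rangeI subset_antisym)
    then have "Rep_proj x = Rep_proj y" by (simp add: Rep_proj_eq)
    then show False using assms by (simp add: Rep_proj_inject)
  qed
  then obtain j where j: "?u $ j * ?w $ i - ?u $ i * ?w $ j \<noteq> 0" ..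
  have "hom_form 1 (\<lambda>v. ?w $ i * v $ j - ?w $ j * v $ i)"
    by (intro hom_form_diff hom_form_scale hom_form_coord)
  then show thesis by (rule that) (use j in \<open>auto simp: algebra_simps\<close>)
qed

lemma separate_point_from_finite:
  assumes "finite X" "x \<notin> X"
  obtains E where "hom_form (card X) E" "E (hcoords x) \<noteq> 0" "\<And>y. y \<in> X \<Longrightarrow> E (hcoords y) = 0"
proof -
  have "\<exists>E. hom_form (card X) E \<and> E (hcoords x) \<noteq> 0 \<and> (\<forall>y\<in>X. E (hcoords y) = 0)"
    using assms
  proof (induction X rule: finite_induct)
    case empty
    show ?case by (intro exI[of _ "\<lambda>_. 1"]) (simp add: hom_form_const)
  next
    case (insert y X)
    then obtain E where E: "hom_form (card X) E" "E (hcoords x) \<noteq> 0" "\<forall>y\<in>X. E (hcoords y) = 0"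
      by auto
    obtain L where "hom_form 1 L" "L (hcoords x) \<noteq> 0" "L (hcoords y) = 0"
      using separate_points[of x y] insert.prems by auto
    then show ?case
      using E insert.hyps hom_form_mult[of 1 L "card X" E] by (intro exI[of _ "\<lambda>v. L v * E v"]) auto
  qed
  then show thesis using that by blast
qed

lemma hom_form_power: "hom_form d F \<Longrightarrow> hom_form (d * k) (\<lambda>v. F v ^ k)"
proof (induction k)
  case 0
  show ?case using hom_form_const[of 1] by simp
next
  case (Suc k)
  then show ?case using hom_form_mult[of d F "d * k" "\<lambda>v. F v ^ k"] by simp
qed

lemma ex_nonvanishing_linear:
  obtains L where "hom_form 1 L" "L (hcoords x) \<noteq> 0"
proof -
  obtain i where "hcoords x $ i \<noteq> 0" using hcoords_nonzero[of x] by (auto simp: Finite_Cartesian_Product.vec_eq_iff)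
  then show thesis using that[OF hom_form_coord[of i]] by simp
qed

lemma lagrange_forms:
  assumes "finite X"
  obtains E where "\<forall>x\<in>X. hom_form (card X) (E x)" "\<forall>x\<in>X. E x (hcoords x) \<noteq> 0"
    "\<forall>x\<in>X. \<forall>y\<in>X. x \<noteq> y \<longrightarrow> E x (hcoords y) = 0"
proof -
  have "\<exists>E. x \<in> X \<longrightarrow> hom_form (card X) E \<and> E (hcoords x) \<noteq> 0 \<and>
      (\<forall>y\<in>X. x \<noteq> y \<longrightarrow> E (hcoords y) = 0)" for x
  proof (cases "x \<in> X")
    case True
    obtain E where E: "hom_form (card (X - {x})) E" "E (hcoords x) \<noteq> 0"
      "\<And>y. y \<in> X - {x} \<Longrightarrow> E (hcoords y) = 0"
      using separate_point_from_finite[of "X - {x}" x] assms by auto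
    \<comment> \<open>An extra factor not vanishing at \<open>x\<close> raises the degree to
      \<open>card X\<close>, which is positive even when \<open>X\<close> is a single point;
      clearing denominators in \<open>max_ideal_mem\<close> relies on this.\<close>
    obtain L where L: "hom_form 1 L" "L (hcoords x) \<noteq> 0" by (rule ex_nonvanishing_linear)
    have "1 + card (X - {x}) = card X" using True assms by (metis card_Suc_Diff1 plus_1_eq_Suc)
    then have "hom_form (card X) (\<lambda>v. L v * E v)" using hom_form_mult[OF L(1) E(1)] by simp
    then show ?thesis using E L by (intro exI[of _ "\<lambda>v. L v * E v"]) auto
  qed simp
  then obtain E where "\<And>x. x \<in> X \<Longrightarrow> hom_form (card X) (E x) \<and> E x (hcoords x) \<noteq> 0 \<and>
      (\<forall>y\<in>X. x \<noteq> y \<longrightarrow> E x (hcoords y) = 0)"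
    by metis
  then show thesis using that[of E] by blast
qed

section \<open>Local rings of the cylinder\<close>

abbreviation cyl_germs ::
  "'n::finite proj set \<Rightarrow> 'n proj \<times> complex \<Rightarrow> ('n proj \<times> complex \<Rightarrow> complex) set" where
  "cyl_germs C P \<equiv> germs cyl_ratios (cyl C) P"

abbreviation cyl_ideal ::
  "'n::finite proj set \<Rightarrow> 'n proj \<times> complex \<Rightarrow> ('n proj \<times> complex \<Rightarrow> complex) set \<Rightarrow> bool" where
  "cyl_ideal C P I \<equiv> germ_ideal cyl_ratios (cyl C) P I"

lemma cyl_germI:
  assumes "cyl_form d F" "cyl_form d G" "G (hcoords x) \<zeta> \<noteq> 0"
    and "\<And>y w. y \<in> C \<Longrightarrow> G (hcoords y) w \<noteq> 0 \<Longrightarrow> f (y, w) = F (hcoords y) w / G (hcoords y) w"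
  shows "f \<in> cyl_germs C (x, \<zeta>)"
proof -
  have "((\<lambda>(x, z). F (hcoords x) z), (\<lambda>(x, z). G (hcoords x) z)) \<in> cyl_ratios"
    using assms(1,2) unfolding cyl_ratios_def by blast
  then show ?thesis unfolding germs_def mem_Collect_eq
    by (rule bexI[rotated]) (use assms(3,4) in auto)
qed

lemma cyl_germE:
  assumes "f \<in> cyl_germs C (x, \<zeta>)"
  obtains d F G where "cyl_form d F" "cyl_form d G" "G (hcoords x) \<zeta> \<noteq> 0"
    "\<And>y w. y \<in> C \<Longrightarrow> G (hcoords y) w \<noteq> 0 \<Longrightarrow> f (y, w) = F (hcoords y) w / G (hcoords y) w"
proof -
  obtain F' G' where FG': "(F', G') \<in> cyl_ratios" "G' (x, \<zeta>) \<noteq> 0"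
    "\<forall>Q\<in>cyl C. G' Q \<noteq> 0 \<longrightarrow> f Q = F' Q / G' Q"
    using assms unfolding germs_def by blast
  then obtain d F G where FG: "cyl_form d F" "cyl_form d G"
    "F' = (\<lambda>(x, z). F (hcoords x) z)" "G' = (\<lambda>(x, z). G (hcoords x) z)"
    unfolding cyl_ratios_def by blast
  show thesis by (rule that[OF FG(1,2)]) (use FG' FG(3,4) in auto)
qed

lemma proj_germI:
  assumes "hom_form d F" "hom_form d G" "G (hcoords x) \<noteq> 0"
    and "\<And>y. y \<in> C \<Longrightarrow> G (hcoords y) \<noteq> 0 \<Longrightarrow> f y = F (hcoords y) / G (hcoords y)"
  shows "f \<in> germs proj_ratios C x"
proof -
  have "((\<lambda>x. F (hcoords x)), (\<lambda>x. G (hcoords x))) \<in> proj_ratios"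
    using assms(1,2) unfolding proj_ratios_def by blast
  then show ?thesis unfolding germs_def mem_Collect_eq
    by (rule bexI[rotated]) (use assms(3,4) in auto)
qed

lemma proj_germE:
  assumes "f \<in> germs proj_ratios C x"
  obtains d F G where "hom_form d F" "hom_form d G" "G (hcoords x) \<noteq> 0"
    "\<And>y. y \<in> C \<Longrightarrow> G (hcoords y) \<noteq> 0 \<Longrightarrow> f y = F (hcoords y) / G (hcoords y)"
proof -
  obtain F' G' where FG': "(F', G') \<in> proj_ratios" "G' x \<noteq> 0"
    "\<forall>Q\<in>C. G' Q \<noteq> 0 \<longrightarrow> f Q = F' Q / G' Q"
    using assms unfolding germs_def by blast
  then obtain d F G where FG: "hom_form d F" "hom_form d G"
    "F' = (\<lambda>x. F (hcoords x))" "G' = (\<lambda>x. G (hcoords x))"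
    unfolding proj_ratios_def by blast
  show thesis by (rule that[OF FG(1,2)]) (use FG' FG(3,4) in auto)
qed

lemma cyl_nullI:
  assumes "cyl_form d G" "G (hcoords x) \<zeta> \<noteq> 0"
    and "\<And>y w. y \<in> C \<Longrightarrow> G (hcoords y) w \<noteq> 0 \<Longrightarrow> f (y, w) = 0"
  shows "f \<in> null_germs cyl_ratios (cyl C) (x, \<zeta>)"
proof -
  have "((\<lambda>(x, z). G (hcoords x) z), (\<lambda>(x, z). G (hcoords x) z)) \<in> cyl_ratios"
    using assms(1) unfolding cyl_ratios_def by blast
  then show ?thesis unfolding null_germs_def mem_Collect_eq
    by (rule bexI[rotated]) (use assms(2,3) in auto)
qed

lemma cyl_nullE:
  assumes "f \<in> null_germs cyl_ratios (cyl C) (x, \<zeta>)"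
  obtains d G where "cyl_form d G" "G (hcoords x) \<zeta> \<noteq> 0"
    "\<And>y w. y \<in> C \<Longrightarrow> G (hcoords y) w \<noteq> 0 \<Longrightarrow> f (y, w) = 0"
proof -
  obtain F' G' where FG': "(F', G') \<in> cyl_ratios" "G' (x, \<zeta>) \<noteq> 0"
    "\<forall>Q\<in>cyl C. G' Q \<noteq> 0 \<longrightarrow> f Q = 0"
    using assms unfolding null_germs_def by blast
  then obtain d F G where FG: "cyl_form d F" "cyl_form d G"
    "F' = (\<lambda>(x, z). F (hcoords x) z)" "G' = (\<lambda>(x, z). G (hcoords x) z)"
    unfolding cyl_ratios_def by blast
  show thesis by (rule that[OF FG(2)]) (use FG' FG(3,4) in auto)
qed

lemma cyl_germs_const: "(\<lambda>_. c) \<in> cyl_germs C P"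
  using cyl_germI[OF cyl_form_const cyl_form_const[of 1], where x = "fst P" and \<zeta> = "snd P" and C = C and f = "\<lambda>_. c"] by simp

lemma cyl_germs_mult:
  assumes "f \<in> cyl_germs C P" "g \<in> cyl_germs C P"
  shows "(\<lambda>Q. f Q * g Q) \<in> cyl_germs C P"
proof -
  obtain x \<zeta> where P: "P = (x, \<zeta>)" by fastforce
  obtain d F G where f: "cyl_form d F" "cyl_form d G" "G (hcoords x) \<zeta> \<noteq> 0"
    "\<And>y w. y \<in> C \<Longrightarrow> G (hcoords y) w \<noteq> 0 \<Longrightarrow> f (y, w) = F (hcoords y) w / G (hcoords y) w"
    using cyl_germE assms(1) P by blast
  obtain d' F' G' where g: "cyl_form d' F'" "cyl_form d' G'" "G' (hcoords x) \<zeta> \<noteq> 0"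
    "\<And>y w. y \<in> C \<Longrightarrow> G' (hcoords y) w \<noteq> 0 \<Longrightarrow> g (y, w) = F' (hcoords y) w / G' (hcoords y) w"
    using cyl_germE assms(2) P by blast
  show ?thesis unfolding P
    by (rule cyl_germI[OF cyl_form_mult[OF f(1) g(1)] cyl_form_mult[OF f(2) g(2)]])
      (use f(3,4) g(3,4) in auto)
qed

lemma cyl_germs_add:
  assumes "f \<in> cyl_germs C P" "g \<in> cyl_germs C P"
  shows "(\<lambda>Q. f Q + g Q) \<in> cyl_germs C P"
proof -
  obtain x \<zeta> where P: "P = (x, \<zeta>)" by fastforce
  obtain d F G where f: "cyl_form d F" "cyl_form d G" "G (hcoords x) \<zeta> \<noteq> 0"
    "\<And>y w. y \<in> C \<Longrightarrow> G (hcoords y) w \<noteq> 0 \<Longrightarrow> f (y, w) = F (hcoords y) w / G (hcoords y) w"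
    using cyl_germE assms(1) P by blast
  obtain d' F' G' where g: "cyl_form d' F'" "cyl_form d' G'" "G' (hcoords x) \<zeta> \<noteq> 0"
    "\<And>y w. y \<in> C \<Longrightarrow> G' (hcoords y) w \<noteq> 0 \<Longrightarrow> g (y, w) = F' (hcoords y) w / G' (hcoords y) w"
    using cyl_germE assms(2) P by blast
  show ?thesis unfolding P
    by (rule cyl_germI[OF cyl_form_add[OF cyl_form_mult[OF f(1) g(2)] cyl_form_mult[OF f(2) g(1)]]
          cyl_form_mult[OF f(2) g(2)]])
      (use f(3,4) g(3,4) in \<open>auto simp: field_simps\<close>)
qed

lemma cyl_germs_scale: "f \<in> cyl_germs C P \<Longrightarrow> (\<lambda>Q. c * f Q) \<in> cyl_germs C P"
  using cyl_germs_mult[OF cyl_germs_const] by blast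

lemma cyl_germs_lincomb:
  fixes n :: nat
  assumes "f \<in> cyl_germs C P" "\<And>i. i < n \<Longrightarrow> b i \<in> cyl_germs C P"
  shows "(\<lambda>Q. f Q - (\<Sum>i<n. c i * b i Q)) \<in> cyl_germs C P"
  using assms(2)
proof (induction n)
  case (Suc n)
  have "(\<lambda>Q. (f Q - (\<Sum>i<n. c i * b i Q)) + (- c n) * b n Q) \<in> cyl_germs C P"
    using Suc by (intro cyl_germs_add cyl_germs_scale) auto
  then show ?case by (simp add: algebra_simps)
qed (use assms(1) in simp)

lemma cyl_null_subset: "null_germs cyl_ratios (cyl C) P \<subseteq> cyl_germs C P"
proof
  fix f assume f: "f \<in> null_germs cyl_ratios (cyl C) P"
  obtain x \<zeta> where P: "P = (x, \<zeta>)" by fastforce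
  obtain d G where "cyl_form d G" "G (hcoords x) \<zeta> \<noteq> 0"
    "\<And>y w. y \<in> C \<Longrightarrow> G (hcoords y) w \<noteq> 0 \<Longrightarrow> f (y, w) = 0"
    using cyl_nullE f P by blast
  then show "f \<in> cyl_germs C P"
    unfolding P by (intro cyl_germI[OF cyl_form_zero, of d G]) auto
qed

lemma cyl_ideal_germs: "cyl_ideal C P (cyl_germs C P)"
  unfolding germ_ideal_def using cyl_null_subset cyl_germs_add cyl_germs_mult by blast

lemma cyl_germs_fst:
  assumes "g \<in> germs proj_ratios C x"
  shows "(\<lambda>(y, w). g y) \<in> cyl_germs C (x, \<zeta>)"
proof -
  obtain d F G where g: "hom_form d F" "hom_form d G" "G (hcoords x) \<noteq> 0"
    "\<And>y. y \<in> C \<Longrightarrow> G (hcoords y) \<noteq> 0 \<Longrightarrow> g y = F (hcoords y) / G (hcoords y)"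
    using proj_germE[OF assms] by blast
  show ?thesis
    by (rule cyl_germI[OF cyl_form_hom[OF g(1)] cyl_form_hom[OF g(2)]]) (use g(3,4) in auto)
qed

lemma cyl_germs_poly: "(\<lambda>(y, w). poly p w) \<in> cyl_germs C P"
  using cyl_germI[OF cyl_form_poly cyl_form_const[of 1], where x = "fst P" and \<zeta> = "snd P" and C = C and f = "\<lambda>(y, w). poly p w"]
  by simp

section \<open>Calculus of ideals in a local ring of the cylinder\<close>

context
  fixes C :: "'n::finite proj set" and x \<zeta> I
  assumes I: "cyl_ideal C (x, \<zeta>) I"
begin

lemma ideal_subset: "I \<subseteq> cyl_germs C (x, \<zeta>)"
  using I by (simp add: germ_ideal_def)

lemma ideal_add: "f \<in> I \<Longrightarrow> g \<in> I \<Longrightarrow> (\<lambda>Q. f Q + g Q) \<in> I"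
  using I by (simp add: germ_ideal_def)

lemma ideal_mult: "f \<in> cyl_germs C (x, \<zeta>) \<Longrightarrow> g \<in> I \<Longrightarrow> (\<lambda>Q. f Q * g Q) \<in> I"
  using I by (simp add: germ_ideal_def)

lemma ideal_scale: "f \<in> I \<Longrightarrow> (\<lambda>Q. c * f Q) \<in> I"
  using ideal_mult[OF cyl_germs_const] by blast

lemma ideal_diff: "f \<in> I \<Longrightarrow> g \<in> I \<Longrightarrow> (\<lambda>Q. f Q - g Q) \<in> I"
  using ideal_add[of f "\<lambda>Q. (-1) * g Q"] ideal_scale[of g "-1"] by simp

lemma ideal_null:
  assumes "cyl_form d G" "G (hcoords x) \<zeta> \<noteq> 0"
    and "\<And>y w. y \<in> C \<Longrightarrow> G (hcoords y) w \<noteq> 0 \<Longrightarrow> f (y, w) = 0"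
  shows "f \<in> I"
proof -
  have "f \<in> null_germs cyl_ratios (cyl C) (x, \<zeta>)"
    by (rule cyl_nullI[OF assms(1,2)]) (rule assms(3))
  then show ?thesis using I unfolding germ_ideal_def by blast
qed

lemma ideal_zero: "(\<lambda>_. 0) \<in> I"
  by (rule ideal_null[OF cyl_form_const[of 1]]) auto

lemma ideal_sum: "(\<And>i. i \<in> A \<Longrightarrow> f i \<in> I) \<Longrightarrow> (\<lambda>Q. \<Sum>i\<in>A. f i Q) \<in> I"
  by (induction A rule: infinite_finite_induct) (auto intro: ideal_zero ideal_add)

text \<open>Ideals contain the null germs, so membership depends only on the values near the
  point.\<close>

lemma ideal_cong:
  assumes "f \<in> I" "cyl_form d G" "G (hcoords x) \<zeta> \<noteq> 0"
    and "\<And>y w. y \<in> C \<Longrightarrow> G (hcoords y) w \<noteq> 0 \<Longrightarrow> g (y, w) = f (y, w)"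
  shows "g \<in> I"
proof -
  have "(\<lambda>Q. g Q - f Q) \<in> I" by (rule ideal_null[OF assms(2,3)]) (use assms(4) in simp)
  from ideal_add[OF assms(1) this] show ?thesis by simp
qed

lemma ideal_one: "(\<lambda>_. 1) \<in> I \<Longrightarrow> I = cyl_germs C (x, \<zeta>)"
  using ideal_subset ideal_mult[of _ "\<lambda>_. 1"] by auto

text \<open>Cancels a unit: \<open>F / G\<close> is invertible at the point, and multiplying by
  \<open>G / F\<close> gives back \<open>g\<close> wherever neither form vanishes;
  \<open>ideal_cong\<close> discards the values elsewhere.\<close>

lemma ideal_divide:
  assumes f: "f \<in> I" and FG: "cyl_form d F" "cyl_form d G" "F (hcoords x) \<zeta> \<noteq> 0" "G (hcoords x) \<zeta> \<noteq> 0"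
    and fg: "\<And>y w. y \<in> C \<Longrightarrow> F (hcoords y) w \<noteq> 0 \<Longrightarrow> G (hcoords y) w \<noteq> 0 \<Longrightarrow>
      f (y, w) = g (y, w) * (F (hcoords y) w / G (hcoords y) w)"
  shows "g \<in> I"
proof -
  define u where "u = (\<lambda>(y, w). G (hcoords y) w / F (hcoords y) w)"
  have "u \<in> cyl_germs C (x, \<zeta>)"
    by (rule cyl_germI[OF FG(2,1,3)]) (simp add: u_def)
  from ideal_mult[OF this f] show ?thesis
    by (rule ideal_cong[OF _ cyl_form_mult[OF FG(1,2)]]) (use FG fg in \<open>auto simp: u_def\<close>)
qed

end

text \<open>The function \<open>g\<close> is, up to finitely many values, a rational function vanishing to order at
  least \<open>m\<close> at \<open>\<zeta>\<close>. Germs at \<open>(x, \<zeta>)\<close> restrict to such functions on the line over \<open>x\<close>; away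
  from \<open>\<zeta>\<close> their values need not be meaningful where the denominator vanishes.\<close>

definition vanishing :: "nat \<Rightarrow> complex \<Rightarrow> (complex \<Rightarrow> complex) \<Rightarrow> bool" where
  "vanishing m \<zeta> g \<longleftrightarrow> (\<exists>A B. poly B \<zeta> \<noteq> 0 \<and> [:-\<zeta>, 1:] ^ m dvd A \<and>
     finite {z. g z \<noteq> poly A z / poly B z})"

lemma finite_poly_zeros: "poly B \<zeta> \<noteq> 0 \<Longrightarrow> finite {z. poly B z = 0}" for B :: "complex poly"
  by (intro poly_roots_finite) auto

lemma cofinite_cross:
  fixes A B A' B' :: "complex poly"
  assumes "finite {z. g z \<noteq> poly A z / poly B z}" "finite {z. g z \<noteq> poly A' z / poly B' z}"
    and "B \<noteq> 0" "B' \<noteq> 0"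
  shows "A * B' = A' * B"
proof (rule poly_eqI_infinite)
  let ?E = "{z. g z \<noteq> poly A z / poly B z} \<union> {z. g z \<noteq> poly A' z / poly B' z} \<union>
    {z. poly B z = 0} \<union> {z. poly B' z = 0}"
  have "finite ?E" using assms by (intro finite_UnI poly_roots_finite)
  then show "infinite (- ?E)"
    unfolding Compl_eq_Diff_UNIV by (rule Diff_infinite_finite[OF _ infinite_UNIV_char_0])
  show "poly (A * B') z = poly (A' * B) z" if "z \<in> - ?E" for z
    using that by (auto simp: field_simps)
qed

lemma power_dvd_cancel:
  fixes A B :: "complex poly"
  assumes "[:-\<zeta>, 1:] ^ m dvd A * B" "poly B \<zeta> \<noteq> 0"
  shows "[:-\<zeta>, 1:] ^ m dvd A"
proof (cases "A = 0")
  case False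
  moreover have "B \<noteq> 0" using assms(2) by auto
  ultimately show ?thesis
    using assms order_mult[of A B \<zeta>] by (simp add: order_divides order_0I)
qed simp

text \<open>The order does not depend on the fraction: two of them cross-multiply to the same
  polynomial, and a denominator that is nonzero at the point contributes no factor.\<close>

lemma vanishing_iff:
  assumes "poly B \<zeta> \<noteq> 0" "finite {z. g z \<noteq> poly A z / poly B z}"
  shows "vanishing m \<zeta> g \<longleftrightarrow> [:-\<zeta>, 1:] ^ m dvd A"
proof
  assume "vanishing m \<zeta> g"
  then obtain A' B' where *: "poly B' \<zeta> \<noteq> 0" "[:-\<zeta>, 1:] ^ m dvd A'" "finite {z. g z \<noteq> poly A' z / poly B' z}"
    by (auto simp: vanishing_def)
  have "A * B' = A' * B" using cofinite_cross assms(2) *(3) assms(1) *(1) by fastforce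
  then have "[:-\<zeta>, 1:] ^ m dvd A * B'" using *(2) by (metis dvd_mult2)
  then show "[:-\<zeta>, 1:] ^ m dvd A" using *(1) by (rule power_dvd_cancel)
qed (use assms in \<open>auto simp: vanishing_def\<close>)

lemma vanishing_add:
  assumes "vanishing m \<zeta> g" "vanishing m \<zeta> h"
  shows "vanishing m \<zeta> (\<lambda>z. g z + h z)"
proof -
  obtain A B where g: "poly B \<zeta> \<noteq> 0" "[:-\<zeta>, 1:] ^ m dvd A" "finite {z. g z \<noteq> poly A z / poly B z}"
    using assms(1) by (auto simp: vanishing_def)
  obtain A' B' where h: "poly B' \<zeta> \<noteq> 0" "[:-\<zeta>, 1:] ^ m dvd A'" "finite {z. h z \<noteq> poly A' z / poly B' z}"
    using assms(2) by (auto simp: vanishing_def)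
  have "{z. g z + h z \<noteq> poly (A * B' + A' * B) z / poly (B * B') z} \<subseteq>
      {z. g z \<noteq> poly A z / poly B z} \<union> {z. h z \<noteq> poly A' z / poly B' z} \<union>
      {z. poly B z = 0} \<union> {z. poly B' z = 0}"
    by (auto simp: field_simps)
  then have "finite {z. g z + h z \<noteq> poly (A * B' + A' * B) z / poly (B * B') z}"
    by (rule finite_subset) (use g h finite_poly_zeros in blast)
  then show ?thesis
    unfolding vanishing_def using g h
    by (intro exI[of _ "A * B' + A' * B"] exI[of _ "B * B'"]) auto
qed

lemma vanishing_mult:
  assumes "vanishing m \<zeta> g" "vanishing m' \<zeta> h"
  shows "vanishing (m + m') \<zeta> (\<lambda>z. g z * h z)"
proof -
  obtain A B where g: "poly B \<zeta> \<noteq> 0" "[:-\<zeta>, 1:] ^ m dvd A" "finite {z. g z \<noteq> poly A z / poly B z}"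
    using assms(1) by (auto simp: vanishing_def)
  obtain A' B' where h: "poly B' \<zeta> \<noteq> 0" "[:-\<zeta>, 1:] ^ m' dvd A'" "finite {z. h z \<noteq> poly A' z / poly B' z}"
    using assms(2) by (auto simp: vanishing_def)
  have "{z. g z * h z \<noteq> poly (A * A') z / poly (B * B') z} \<subseteq>
      {z. g z \<noteq> poly A z / poly B z} \<union> {z. h z \<noteq> poly A' z / poly B' z}"
    by auto
  then have "finite {z. g z * h z \<noteq> poly (A * A') z / poly (B * B') z}"
    by (rule finite_subset) (use g h in blast)
  moreover have "[:-\<zeta>, 1:] ^ (m + m') dvd A * A'"
    unfolding power_add by (rule mult_dvd_mono[OF g(2) h(2)])
  ultimately show ?thesis
    unfolding vanishing_def using g(1) h(1)
    by (intro exI[of _ "A * A'"] exI[of _ "B * B'"]) auto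
qed

lemma vanishing_mono: "vanishing m \<zeta> g \<Longrightarrow> k \<le> m \<Longrightarrow> vanishing k \<zeta> g"
  unfolding vanishing_def by (meson dvd_trans le_imp_power_dvd)

lemma vanishing_poly: "vanishing m \<zeta> (poly p) \<longleftrightarrow> [:-\<zeta>, 1:] ^ m dvd p"
  by (rule vanishing_iff[of 1]) auto

lemma cyl_germ_line:
  assumes "f \<in> cyl_germs C (x, \<zeta>)" "x \<in> C"
  obtains A B where "poly B \<zeta> \<noteq> 0" "finite {z. f (x, z) \<noteq> poly A z / poly B z}"
    "f (x, \<zeta>) = poly A \<zeta> / poly B \<zeta>"
proof -
  obtain d F G where f: "cyl_form d F" "cyl_form d G" "G (hcoords x) \<zeta> \<noteq> 0"
    "\<And>y w. y \<in> C \<Longrightarrow> G (hcoords y) w \<noteq> 0 \<Longrightarrow> f (y, w) = F (hcoords y) w / G (hcoords y) w"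
    using cyl_germE[OF assms(1)] by blast
  obtain A where A: "\<And>z. F (hcoords x) z = poly A z" using cyl_form_line[OF f(1)] by blast
  obtain B where B: "\<And>z. G (hcoords x) z = poly B z" using cyl_form_line[OF f(2)] by blast
  have "{z. f (x, z) \<noteq> poly A z / poly B z} \<subseteq> {z. poly B z = 0}"
    using f(4)[OF assms(2)] A B by auto
  then have "finite {z. f (x, z) \<noteq> poly A z / poly B z}"
    using finite_poly_zeros[of B \<zeta>] f(3) B finite_subset by auto
  then show thesis using that[of B A] f(3,4) A B assms(2) by auto
qed

text \<open>For \<open>x\<close> in \<open>C\<close> this is the ideal generated by the maximal
  ideal of \<open>x\<close> and \<open>(z - \<zeta>)^m\<close>: the subscheme of length
  \<open>m\<close> at \<open>\<zeta>\<close> on the line over \<open>x\<close>.\<close>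

definition line_ideal ::
  "'n::finite proj set \<Rightarrow> 'n proj \<Rightarrow> complex \<Rightarrow> nat \<Rightarrow> ('n proj \<times> complex \<Rightarrow> complex) set" where
  "line_ideal C x \<zeta> m = {f \<in> cyl_germs C (x, \<zeta>). vanishing m \<zeta> (\<lambda>z. f (x, z))}"

section \<open>Ideals of fat points on a vertical line\<close>

context
  fixes C :: "'n::finite proj set" and x :: "'n proj" and \<zeta> :: complex
  assumes x: "x \<in> C"
begin

lemma vanishing_0: "f \<in> cyl_germs C (x, \<zeta>) \<Longrightarrow> vanishing 0 \<zeta> (\<lambda>z. f (x, z))"
  by (rule cyl_germ_line[OF _ x]) (auto simp: vanishing_def)

lemma line_ideal_0: "line_ideal C x \<zeta> 0 = cyl_germs C (x, \<zeta>)"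
  using vanishing_0 by (auto simp: line_ideal_def)

lemma line_ideal_ideal: "cyl_ideal C (x, \<zeta>) (line_ideal C x \<zeta> m)"
  unfolding germ_ideal_def
proof (intro conjI ballI subsetI)
  fix f assume f: "f \<in> null_germs cyl_ratios (cyl C) (x, \<zeta>)"
  obtain d G where G: "cyl_form d G" "G (hcoords x) \<zeta> \<noteq> 0"
    "\<And>y w. y \<in> C \<Longrightarrow> G (hcoords y) w \<noteq> 0 \<Longrightarrow> f (y, w) = 0"
    using cyl_nullE[OF f] by blast
  obtain B where B: "\<And>z. G (hcoords x) z = poly B z" using cyl_form_line[OF G(1)] by blast
  have "{z. f (x, z) \<noteq> poly 0 z / poly B z} \<subseteq> {z. poly B z = 0}" using G(3)[OF x] B by auto
  then have "vanishing m \<zeta> (\<lambda>z. f (x, z))"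
    unfolding vanishing_def using G(2) B finite_poly_zeros[of B \<zeta>] finite_subset
    by (intro exI[of _ 0] exI[of _ B]) auto
  then show "f \<in> line_ideal C x \<zeta> m" using f cyl_null_subset by (auto simp: line_ideal_def)
next
  fix f g assume "f \<in> line_ideal C x \<zeta> m" "g \<in> line_ideal C x \<zeta> m"
  then show "(\<lambda>Q. f Q + g Q) \<in> line_ideal C x \<zeta> m"
    by (auto simp: line_ideal_def intro: cyl_germs_add vanishing_add)
next
  fix f g assume "f \<in> cyl_germs C (x, \<zeta>)" "g \<in> line_ideal C x \<zeta> m"
  then show "(\<lambda>Q. f Q * g Q) \<in> line_ideal C x \<zeta> m"
    using vanishing_mult[of 0 \<zeta> "\<lambda>z. f (x, z)" m "\<lambda>z. g (x, z)"] vanishing_0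
    by (auto simp: line_ideal_def intro: cyl_germs_mult)
qed (auto simp: line_ideal_def)

lemma line_ideal_antimono: "k \<le> m \<Longrightarrow> line_ideal C x \<zeta> m \<subseteq> line_ideal C x \<zeta> k"
  by (auto simp: line_ideal_def intro: vanishing_mono)

lemma poly_in_line_ideal: "(\<lambda>(y, w). poly p w) \<in> line_ideal C x \<zeta> m \<longleftrightarrow> [:-\<zeta>, 1:] ^ m dvd p"
  using cyl_germs_poly vanishing_poly[of m \<zeta> p] by (auto simp: line_ideal_def)

lemma power_in_line_ideal: "(\<lambda>(y, w). (w - \<zeta>) ^ k) \<in> line_ideal C x \<zeta> m \<longleftrightarrow> m \<le> k"
proof -
  have eq: "(\<lambda>(y :: 'n proj, w). (w - \<zeta>) ^ k) = (\<lambda>(y, w). poly ([:-\<zeta>, 1:] ^ k) w)"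
    by (auto simp: fun_eq_iff)
  have "[:-\<zeta>, 1:] ^ k \<noteq> 0" by simp
  then show ?thesis
    unfolding eq poly_in_line_ideal order_divides using order_power_n_n[of \<zeta> k] by simp
qed

text \<open>\<open>c\<close> is the Taylor coefficient of order \<open>m\<close> of the restriction
  of \<open>f\<close> to the line; subtracting this term adds one factor to the numerator.\<close>

lemma line_ideal_step:
  assumes f: "f \<in> line_ideal C x \<zeta> m"
  obtains c where "(\<lambda>Q. f Q - c * (snd Q - \<zeta>) ^ m) \<in> line_ideal C x \<zeta> (Suc m)"
proof -
  have fg: "f \<in> cyl_germs C (x, \<zeta>)" using f by (simp add: line_ideal_def)
  obtain A B where AB: "poly B \<zeta> \<noteq> 0" "finite {z. f (x, z) \<noteq> poly A z / poly B z}"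
    using cyl_germ_line[OF fg x] by blast
  then have "[:-\<zeta>, 1:] ^ m dvd A" using f vanishing_iff by (simp add: line_ideal_def)
  then obtain q where q: "A = [:-\<zeta>, 1:] ^ m * q" by (elim dvdE)
  define c where "c = poly q \<zeta> / poly B \<zeta>"
  have "poly (q - Polynomial.smult c B) \<zeta> = 0" using AB by (simp add: c_def)
  then have "[:-\<zeta>, 1:] dvd q - Polynomial.smult c B" by (rule poly_eq_0_iff_dvd[THEN iffD1])
  then have "[:-\<zeta>, 1:] ^ Suc m dvd [:-\<zeta>, 1:] ^ m * (q - Polynomial.smult c B)"
    unfolding power_Suc2 by (intro mult_dvd_mono) auto
  moreover have "{z. f (x, z) - c * (z - \<zeta>) ^ m \<noteq> poly ([:-\<zeta>, 1:] ^ m * (q - Polynomial.smult c B)) z / poly B z}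
      \<subseteq> {z. f (x, z) \<noteq> poly A z / poly B z} \<union> {z. poly B z = 0}"
    by (auto simp: q field_simps)
  then have "finite {z. f (x, z) - c * (z - \<zeta>) ^ m \<noteq> poly ([:-\<zeta>, 1:] ^ m * (q - Polynomial.smult c B)) z / poly B z}"
    by (rule finite_subset) (use AB finite_poly_zeros in blast)
  ultimately have "vanishing (Suc m) \<zeta> (\<lambda>z. f (x, z) - c * (z - \<zeta>) ^ m)"
    using AB(1) unfolding vanishing_def by blast
  moreover have "(\<lambda>Q. f Q - c * (snd Q - \<zeta>) ^ m) \<in> cyl_germs C (x, \<zeta>)"
  proof -
    have "(\<lambda>Q. f Q + (\<lambda>(y, w). poly (Polynomial.smult (- c) ([:-\<zeta>, 1:] ^ m)) w) Q) \<in> cyl_germs C (x, \<zeta>)"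
      by (intro cyl_germs_add fg cyl_germs_poly)
    then show ?thesis by (simp add: case_prod_unfold algebra_simps)
  qed
  ultimately show thesis using that[of c] by (simp add: line_ideal_def)
qed

text \<open>The powers of \<open>w - \<zeta>\<close> below \<open>m\<close> form a basis: existence
  by stripping leading terms one at a time, independence by looking at the lowest
  coefficient.\<close>

lemma has_codim_line_ideal: "has_codim (cyl_germs C (x, \<zeta>)) (line_ideal C x \<zeta> m) m"
proof -
  define b where "b i = (\<lambda>Q :: 'n proj \<times> complex. (snd Q - \<zeta>) ^ i)" for i :: nat
  have b: "b i \<in> line_ideal C x \<zeta> k \<longleftrightarrow> k \<le> i" for i k
    using power_in_line_ideal[of i k] by (simp add: b_def case_prod_unfold)
  have ex: "\<exists>c. (\<lambda>Q. f Q - (\<Sum>i<m. c i * b i Q)) \<in> line_ideal C x \<zeta> m"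
    if "f \<in> cyl_germs C (x, \<zeta>)" for f
  proof (induction m)
    case (Suc m)
    then obtain c where "(\<lambda>Q. f Q - (\<Sum>i<m. c i * b i Q)) \<in> line_ideal C x \<zeta> m" by blast
    then obtain a where a: "(\<lambda>Q. f Q - (\<Sum>i<m. c i * b i Q) - a * (snd Q - \<zeta>) ^ m) \<in> line_ideal C x \<zeta> (Suc m)"
      by (rule line_ideal_step)
    have "(\<Sum>i<m. (c(m := a)) i * b i Q) = (\<Sum>i<m. c i * b i Q)" for Q by (intro sum.cong) auto
    then show ?case using a by (intro exI[of _ "c(m := a)"]) (simp add: b_def algebra_simps)
  qed (use that in \<open>simp add: line_ideal_0\<close>)
  have indep: "\<forall>i<m. c i = 0" if c: "(\<lambda>Q. \<Sum>i<m. c i * b i Q) \<in> line_ideal C x \<zeta> m" for c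
  proof (intro allI impI)
    fix i assume "i < m"
    then show "c i = 0"
    proof (induction i rule: less_induct)
      case (less i)
      \<comment> \<open>Higher terms lie in \<open>line_ideal C x \<zeta> (Suc i)\<close> and lower
        ones vanish by induction, so \<open>c i * b i\<close> lies there too, which
        \<open>b i\<close> does not.\<close>
      have "(\<lambda>Q. (\<Sum>j<m. c j * b j Q) - (\<Sum>j\<in>{i<..<m}. c j * b j Q)) \<in> line_ideal C x \<zeta> (Suc i)"
      proof (rule ideal_diff[OF line_ideal_ideal])
        show "(\<lambda>Q. \<Sum>j<m. c j * b j Q) \<in> line_ideal C x \<zeta> (Suc i)"
          using c line_ideal_antimono[of "Suc i" m] less.prems by auto
        show "(\<lambda>Q. \<Sum>j\<in>{i<..<m}. c j * b j Q) \<in> line_ideal C x \<zeta> (Suc i)"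
          by (intro ideal_sum[OF line_ideal_ideal] ideal_scale[OF line_ideal_ideal]) (auto simp: b)
      qed
      also have "(\<lambda>Q. (\<Sum>j<m. c j * b j Q) - (\<Sum>j\<in>{i<..<m}. c j * b j Q)) = (\<lambda>Q. c i * b i Q)"
      proof
        fix Q
        have "{..<m} = {..<i} \<union> {i} \<union> {i<..<m}" using less.prems by auto
        then have "(\<Sum>j<m. c j * b j Q) = (\<Sum>j\<in>{..<i} \<union> {i} \<union> {i<..<m}. c j * b j Q)" by simp
        also have "\<dots> = (\<Sum>j<i. c j * b j Q) + c i * b i Q + (\<Sum>j\<in>{i<..<m}. c j * b j Q)"
          by (subst sum.union_disjoint; (subst sum.union_disjoint)?) auto
        also have "(\<Sum>j<i. c j * b j Q) = 0"
          using less.IH less.prems by (intro sum.neutral) auto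
        finally show "(\<Sum>j<m. c j * b j Q) - (\<Sum>j\<in>{i<..<m}. c j * b j Q) = c i * b i Q" by simp
      qed
      finally have "(\<lambda>Q. c i * b i Q) \<in> line_ideal C x \<zeta> (Suc i)" .
      then have "c i \<noteq> 0 \<Longrightarrow> b i \<in> line_ideal C x \<zeta> (Suc i)"
        using ideal_scale[OF line_ideal_ideal, of "\<lambda>Q. c i * b i Q" "Suc i" "1 / c i"] by simp
      then show "c i = 0" using b by auto
    qed
  qed
  have "basis_mod (cyl_germs C (x, \<zeta>)) (line_ideal C x \<zeta> m) m b"
    unfolding basis_mod_def
  proof (intro conjI allI impI ballI)
    show "b i \<in> cyl_germs C (x, \<zeta>)" for i using b[of i 0] by (simp add: line_ideal_0)
    fix f assume f: "f \<in> cyl_germs C (x, \<zeta>)"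
    obtain c where c: "(\<lambda>Q. f Q - (\<Sum>i<m. c i * b i Q)) \<in> line_ideal C x \<zeta> m" using ex[OF f] by blast
    show "\<exists>!c. c \<in> {..<m} \<rightarrow>\<^sub>E UNIV \<and> (\<lambda>Q. f Q - (\<Sum>i<m. c i * b i Q)) \<in> line_ideal C x \<zeta> m"
    proof (rule ex1I[of _ "restrict c {..<m}"])
      show "restrict c {..<m} \<in> {..<m} \<rightarrow>\<^sub>E UNIV \<and>
        (\<lambda>Q. f Q - (\<Sum>i<m. restrict c {..<m} i * b i Q)) \<in> line_ideal C x \<zeta> m" using c by simp
      fix c' assume c': "c' \<in> {..<m} \<rightarrow>\<^sub>E UNIV \<and> (\<lambda>Q. f Q - (\<Sum>i<m. c' i * b i Q)) \<in> line_ideal C x \<zeta> m"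
      have "(\<lambda>Q. (f Q - (\<Sum>i<m. c i * b i Q)) - (f Q - (\<Sum>i<m. c' i * b i Q))) \<in> line_ideal C x \<zeta> m"
        by (rule ideal_diff[OF line_ideal_ideal c conjunct2[OF c']])
      also have "(\<lambda>Q. (f Q - (\<Sum>i<m. c i * b i Q)) - (f Q - (\<Sum>i<m. c' i * b i Q))) =
          (\<lambda>Q. \<Sum>i<m. (c' i - c i) * b i Q)"
        by (simp add: sum_subtractf left_diff_distrib)
      finally have "\<forall>i<m. c' i - c i = 0" by (rule indep)
      then show "c' = restrict c {..<m}"
        using c' by (intro PiE_ext[of c' "{..<m}" "\<lambda>_. UNIV"]) auto
    qed
  qed
  then show ?thesis by (auto simp: has_codim_def)
qed

lemma codim_line_ideal: "codim (cyl_germs C (x, \<zeta>)) (line_ideal C x \<zeta> m) = m"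
  unfolding codim_def
proof (rule the_equality)
  show "has_codim (cyl_germs C (x, \<zeta>)) (line_ideal C x \<zeta> m) m" by (rule has_codim_line_ideal)
  show "d = m" if "has_codim (cyl_germs C (x, \<zeta>)) (line_ideal C x \<zeta> m) d" for d
    using has_codim_unique[OF that has_codim_line_ideal] ideal_zero[OF line_ideal_ideal]
      ideal_add[OF line_ideal_ideal] ideal_scale[OF line_ideal_ideal] by blast
qed

text \<open>Modulo \<open>line_ideal C x \<zeta> m\<close> the local ring is a truncated polynomial
  ring in one variable, whose ideals form a chain. Concretely, with \<open>k\<close> the least index
  of a line ideal inside \<open>I\<close>, an element of \<open>I\<close> of order
  \<open>r < k\<close> on the line would put the power \<open>k - 1\<close> of
  \<open>w - \<zeta>\<close> into \<open>I\<close>, against minimality.\<close>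

lemma ideal_containing_line_ideal:
  assumes I: "cyl_ideal C (x, \<zeta>) I" and m: "line_ideal C x \<zeta> m \<subseteq> I"
  obtains k where "k \<le> m" "I = line_ideal C x \<zeta> k"
proof -
  define k where "k = (LEAST k. line_ideal C x \<zeta> k \<subseteq> I)"
  have k: "line_ideal C x \<zeta> k \<subseteq> I" unfolding k_def by (rule LeastI[of \<open>\<lambda>k. line_ideal C x \<zeta> k \<subseteq> I\<close>, OF m])
  have km: "k \<le> m" unfolding k_def by (rule Least_le[of \<open>\<lambda>k. line_ideal C x \<zeta> k \<subseteq> I\<close>, OF m])
  have "f \<in> line_ideal C x \<zeta> k" if f: "f \<in> I" for f
  proof (rule ccontr)
    assume nf: "f \<notin> line_ideal C x \<zeta> k"
    define r where "r = (LEAST r. f \<notin> line_ideal C x \<zeta> (Suc r))"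
    have f0: "f \<in> line_ideal C x \<zeta> 0" using ideal_subset[OF I] f by (auto simp: line_ideal_0)
    then have "k \<noteq> 0" using nf by (cases k) auto
    then obtain k' where k': "k = Suc k'" by (cases k) auto
    have r: "f \<notin> line_ideal C x \<zeta> (Suc r)" unfolding r_def
      by (rule LeastI[of "\<lambda>r. f \<notin> line_ideal C x \<zeta> (Suc r)" k']) (use nf k' in simp)
    have "r \<le> k'" unfolding r_def
      by (rule Least_le[of "\<lambda>r. f \<notin> line_ideal C x \<zeta> (Suc r)"]) (use nf k' in simp)
    have fr: "f \<in> line_ideal C x \<zeta> r"
    proof (cases r)
      case (Suc r')
      then show ?thesis using not_less_Least[of r' "\<lambda>r. f \<notin> line_ideal C x \<zeta> (Suc r)"] by (simp add: r_def)
    qed (use f0 in simp)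
    obtain c where c: "(\<lambda>Q. f Q - c * (snd Q - \<zeta>) ^ r) \<in> line_ideal C x \<zeta> (Suc r)"
      using line_ideal_step[OF fr] .
    have "c \<noteq> 0" using c r by auto
    \<comment> \<open>The factor \<open>u\<close> raises the order from \<open>r\<close> to exactly
      \<open>k'\<close>; the error term then lies in \<open>line_ideal C x \<zeta> k\<close>, hence
      in \<open>I\<close>.\<close>
    define u where "u = (\<lambda>Q :: 'n proj \<times> complex. (snd Q - \<zeta>) ^ (k' - r))"
    have u: "u \<in> line_ideal C x \<zeta> (k' - r)"
      using power_in_line_ideal[of "k' - r" "k' - r"] by (simp add: u_def case_prod_unfold)
    then have ug: "u \<in> cyl_germs C (x, \<zeta>)" by (simp add: line_ideal_def)
    have "(\<lambda>Q. u Q * (f Q - c * (snd Q - \<zeta>) ^ r)) \<in> line_ideal C x \<zeta> k"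
      using vanishing_mult[of "k' - r" \<zeta> "\<lambda>z. u (x, z)" "Suc r"] u c cyl_germs_mult[OF ug] \<open>r \<le> k'\<close>
      by (auto simp: line_ideal_def k')
    then have "(\<lambda>Q. u Q * f Q - u Q * (f Q - c * (snd Q - \<zeta>) ^ r)) \<in> I"
      using ideal_diff[OF I ideal_mult[OF I ug f]] k by blast
    moreover have "u Q * (snd Q - \<zeta>) ^ r = (snd Q - \<zeta>) ^ k'" for Q
      using \<open>r \<le> k'\<close> by (simp add: u_def flip: power_add)
    ultimately have "(\<lambda>Q. c * (snd Q - \<zeta>) ^ k') \<in> I" by (simp add: algebra_simps)
    then have pw: "(\<lambda>Q. (snd Q - \<zeta>) ^ k') \<in> I"
      using ideal_scale[OF I, of "\<lambda>Q. c * (snd Q - \<zeta>) ^ k'" "1 / c"] \<open>c \<noteq> 0\<close> by simp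
    have "line_ideal C x \<zeta> k' \<subseteq> I"
    proof
      fix g assume "g \<in> line_ideal C x \<zeta> k'"
      then obtain a where "(\<lambda>Q. g Q - a * (snd Q - \<zeta>) ^ k') \<in> line_ideal C x \<zeta> k"
        unfolding k' by (rule line_ideal_step)
      then have "(\<lambda>Q. (g Q - a * (snd Q - \<zeta>) ^ k') + a * (snd Q - \<zeta>) ^ k') \<in> I"
        using k by (intro ideal_add[OF I] ideal_scale[OF I] pw) auto
      then show "g \<in> I" by simp
    qed
    then have "k \<le> k'" unfolding k_def by (rule Least_le[of "\<lambda>k. line_ideal C x \<zeta> k \<subseteq> I"])
    then show False using k' by simp
  qed
  then show thesis using that km k by blast
qed

text \<open>Divide the numerator of \<open>f\<close> by a form \<open>H\<close> not vanishing at
  \<open>x\<close>, so that its coefficients become functions \<open>g j\<close> on the curve.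
  Replacing each by its value at \<open>x\<close> costs an element generated by the maximal ideal
  and leaves the polynomial \<open>A\<close>, which is divisible by
  \<open>(w - \<zeta>)^m\<close>.\<close>

lemma line_ideal_generated:
  assumes I: "cyl_ideal C (x, \<zeta>) I"
    and m: "\<And>g. g \<in> max_ideal proj_ratios C x \<Longrightarrow> (\<lambda>(y, w). g y) \<in> I"
    and p: "(\<lambda>(y, w). (w - \<zeta>) ^ m) \<in> I"
  shows "line_ideal C x \<zeta> m \<subseteq> I"
proof
  fix f assume f: "f \<in> line_ideal C x \<zeta> m"
  then have "f \<in> cyl_germs C (x, \<zeta>)" by (simp add: line_ideal_def)
  then obtain d F G where FG: "cyl_form d F" "cyl_form d G" "G (hcoords x) \<zeta> \<noteq> 0"
    "\<And>y w. y \<in> C \<Longrightarrow> G (hcoords y) w \<noteq> 0 \<Longrightarrow> f (y, w) = F (hcoords y) w / G (hcoords y) w"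
    using cyl_germE by blast
  obtain r a where a: "\<forall>j\<le>r. hom_form d (a j)" "F = (\<lambda>v z. \<Sum>j\<le>r. a j v * z ^ j)"
    using FG(1) by (auto simp: cyl_form_def)
  \<comment> \<open>Some coefficient of the denominator serves as \<open>H\<close>: they cannot all
    vanish at \<open>x\<close>, and they have the required degree \<open>d\<close>.\<close>
  obtain H where H: "hom_form d H" "H (hcoords x) \<noteq> 0"
  proof -
    obtain s b where b: "\<forall>j\<le>s. hom_form d (b j)" "G = (\<lambda>v z. \<Sum>j\<le>s. b j v * z ^ j)"
      using FG(2) by (auto simp: cyl_form_def)
    then have "(\<Sum>j\<le>s. b j (hcoords x) * \<zeta> ^ j) \<noteq> 0" using FG(3) by simp
    then obtain j where "j \<in> {..s}" "b j (hcoords x) * \<zeta> ^ j \<noteq> 0"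
      by (rule sum.not_neutral_contains_not_neutral)
    then show thesis using that[of "b j"] b by auto
  qed
  define g where "g j y = a j (hcoords y) / H (hcoords y)" for j y
  define A where "A = (\<Sum>j\<le>r. monom (g j x) j)"
  obtain B where B: "\<And>z. G (hcoords x) z = poly B z" using cyl_form_line[OF FG(2)] by blast
  have A: "F (hcoords x) z = poly (Polynomial.smult (H (hcoords x)) A) z" for z
    using H(2) by (simp add: a A_def poly_sum poly_monom g_def sum_distrib_left)
  have "{z. f (x, z) \<noteq> poly (Polynomial.smult (H (hcoords x)) A) z / poly B z} \<subseteq> {z. poly B z = 0}"
    using FG(4)[OF x] unfolding A[symmetric] B[symmetric] by auto
  then have "finite {z. f (x, z) \<noteq> poly (Polynomial.smult (H (hcoords x)) A) z / poly B z}"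
    by (rule finite_subset) (use finite_poly_zeros[of B \<zeta>] FG(3) B in simp)
  then have "[:-\<zeta>, 1:] ^ m dvd Polynomial.smult (H (hcoords x)) A"
    using f vanishing_iff[of B \<zeta> "\<lambda>z. f (x, z)" "Polynomial.smult (H (hcoords x)) A" m] FG(3)
    unfolding B line_ideal_def by blast
  then have "[:-\<zeta>, 1:] ^ m dvd A" using H(2) by (simp add: dvd_smult_iff)
  then obtain q where q: "A = q * [:-\<zeta>, 1:] ^ m" by (metis dvdE mult.commute)
  have AI: "(\<lambda>(y, w). poly A w) \<in> I"
  proof -
    have "(\<lambda>Q. (\<lambda>(y, w). poly q w) Q * (\<lambda>(y, w). (w - \<zeta>) ^ m) Q) \<in> I"
      by (rule ideal_mult[OF I cyl_germs_poly p])
    then show ?thesis by (simp add: q case_prod_unfold)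
  qed
  have gI: "(\<lambda>(y, w). (g j y - g j x) * w ^ j) \<in> I" if "j \<le> r" for j
  proof -
    have "(\<lambda>y. g j y - g j x) \<in> germs proj_ratios C x"
    proof (rule proj_germI)
      show "hom_form d (\<lambda>v. a j v - g j x * H v)"
        using a that H by (intro hom_form_diff hom_form_scale) auto
    qed (use H in \<open>auto simp: g_def field_simps\<close>)
    then have "(\<lambda>(y, w). g j y - g j x) \<in> I"
      by (intro m) (simp add: max_ideal_def)
    then have "(\<lambda>Q. (\<lambda>(y, w). poly (monom 1 j) w) Q * (\<lambda>(y, w). g j y - g j x) Q) \<in> I"
      by (rule ideal_mult[OF I cyl_germs_poly])
    then show ?thesis by (simp add: poly_monom case_prod_unfold mult.commute)
  qed
  have "(\<lambda>Q. (\<Sum>j\<le>r. (\<lambda>(y, w). (g j y - g j x) * w ^ j) Q) + (\<lambda>(y, w). poly A w) Q) \<in> I"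
    by (intro ideal_add[OF I] ideal_sum[OF I] gI AI) simp
  also have "(\<lambda>Q. (\<Sum>j\<le>r. (\<lambda>(y, w). (g j y - g j x) * w ^ j) Q) + (\<lambda>(y, w). poly A w) Q) =
      (\<lambda>(y, w). \<Sum>j\<le>r. g j y * w ^ j)"
    by (auto simp: fun_eq_iff A_def poly_sum poly_monom left_diff_distrib simp flip: sum.distrib)
  finally have FI: "(\<lambda>(y, w). \<Sum>j\<le>r. g j y * w ^ j) \<in> I" .
  show "f \<in> I"
  proof (rule ideal_divide[OF I FI FG(2) cyl_form_hom[OF H(1)] FG(3) H(2)])
    fix y w assume y: "y \<in> C" "G (hcoords y) w \<noteq> 0" "H (hcoords y) \<noteq> 0"
    have "(\<Sum>j\<le>r. g j y * w ^ j) = F (hcoords y) w / H (hcoords y)"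
      by (simp add: a g_def sum_divide_distrib)
    then show "(case (y, w) of (y, w) \<Rightarrow> \<Sum>j\<le>r. g j y * w ^ j) =
        f (y, w) * (G (hcoords y) w / H (hcoords y))"
      using FG(4)[OF y(1,2)] y by simp
  qed
qed

end

section \<open>Subschemes of vertical lines\<close>

abbreviation cyl_sections ::
  "'n::finite proj set \<Rightarrow> ('n proj \<times> complex) set \<Rightarrow> ('n proj \<times> complex \<Rightarrow> complex) set" where
  "cyl_sections C V \<equiv> sections cyl_ratios (cyl C) V"

section \<open>Rescaling the affine coordinate\<close>

lemma cyl_form_rescale:
  assumes "cyl_form d F"
  shows "cyl_form d (\<lambda>v z. F v (t * z))"
proof -
  obtain r a where a: "\<forall>j\<le>r. hom_form d (a j)" "F = (\<lambda>v z. \<Sum>j\<le>r. a j v * z ^ j)"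
    using assms by (auto simp: cyl_form_def)
  have "(\<lambda>v z. F v (t * z)) = (\<lambda>v z. \<Sum>j\<le>r. (t ^ j * a j v) * z ^ j)"
    unfolding a by (simp add: power_mult_distrib mult_ac)
  then show ?thesis
    using a(1) by (simp only:) (intro cyl_form_sum cyl_form_monomial hom_form_scale, auto)
qed

lemma cyl_germs_rescale:
  assumes "f \<in> cyl_germs C (x, t * z)"
  shows "(\<lambda>(y, w). f (y, t * w)) \<in> cyl_germs C (x, z)"
proof -
  obtain d F G where f: "cyl_form d F" "cyl_form d G" "G (hcoords x) (t * z) \<noteq> 0"
    "\<And>y w. y \<in> C \<Longrightarrow> G (hcoords y) w \<noteq> 0 \<Longrightarrow> f (y, w) = F (hcoords y) w / G (hcoords y) w"
    using cyl_germE[OF assms] by blast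
  show ?thesis
    by (rule cyl_germI[OF cyl_form_rescale[OF f(1), of t] cyl_form_rescale[OF f(2), of t]])
      (use f(3,4) in auto)
qed

lemma pcompose_power: "pcompose (p ^ n) q = pcompose p q ^ n" for p :: "'a::comm_semiring_1 poly"
proof (induction n)
  case 0
  show ?case by (simp add: one_pCons pcompose_pCons)
qed (simp add: pcompose_mult)

text \<open>The substitution of \<open>t w\<close> for \<open>w\<close> turns \<open>w - t z\<close>
  into \<open>t (w - z)\<close>, so orders of vanishing are kept.\<close>

lemma vanishing_rescale:
  assumes "vanishing m (t * z) g" "t \<noteq> 0"
  shows "vanishing m z (\<lambda>w. g (t * w))"
proof -
  obtain A B where g: "poly B (t * z) \<noteq> 0" "[:-(t * z), 1:] ^ m dvd A" "finite {z. g z \<noteq> poly A z / poly B z}"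
    using assms(1) by (auto simp: vanishing_def)
  obtain q where q: "A = [:-(t * z), 1:] ^ m * q" using g(2) by (elim dvdE)
  have lin: "pcompose [:-(t * z), 1:] [:0, t:] = [:-z, 1:] * [:t:]"
    by (simp add: pcompose_pCons)
  have "pcompose A [:0, t:] = ([:-z, 1:] * [:t:]) ^ m * pcompose q [:0, t:]"
    unfolding q pcompose_mult pcompose_power lin by (rule refl)
  then have "[:-z, 1:] ^ m dvd pcompose A [:0, t:]"
    by (simp only: power_mult_distrib mult.assoc dvd_triv_left)
  moreover have "finite {w. g (t * w) \<noteq> poly (pcompose A [:0, t:]) w / poly (pcompose B [:0, t:]) w}"
  proof -
    have "inj ((*) t)" using assms(2) by (auto simp: inj_on_def)
    then have "finite ((*) t -` {z. g z \<noteq> poly A z / poly B z})" by (rule finite_vimageI[OF g(3)])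
    moreover have "{w. g (t * w) \<noteq> poly (pcompose A [:0, t:]) w / poly (pcompose B [:0, t:]) w} =
      (*) t -` {z. g z \<noteq> poly A z / poly B z}" by (auto simp: poly_pcompose mult.commute)
    ultimately show ?thesis by simp
  qed
  moreover have "poly (pcompose B [:0, t:]) z \<noteq> 0" using g(1) by (simp add: poly_pcompose mult.commute)
  ultimately show ?thesis unfolding vanishing_def by blast
qed

lemma line_ideal_rescale:
  assumes "f \<in> line_ideal C x (t * z) m" "t \<noteq> 0"
  shows "(\<lambda>(y, w). f (y, t * w)) \<in> line_ideal C x z m"
  using assms cyl_germs_rescale[of f C x t z] vanishing_rescale[of m t z "\<lambda>z. f (x, z)"]
  by (simp add: line_ideal_def)

text \<open>\<open>Y x\<close> plays the role of an effective divisor on the line over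
  \<open>x\<close>; the subscheme is the disjoint union of these divisors.\<close>

definition vertical_subscheme ::
  "'n::finite proj set \<Rightarrow> ('n proj \<Rightarrow> complex multiset) \<Rightarrow> 'n subscheme" where
  "vertical_subscheme C Y = (\<lambda>(x, z)\<in>cyl C. line_ideal C x z (count (Y x) z))"

lemma vertical_subscheme_apply:
  "x \<in> C \<Longrightarrow> vertical_subscheme C Y (x, z) = line_ideal C x z (count (Y x) z)"
  by (simp add: vertical_subscheme_def)

lemma act_apply: "x \<in> C \<Longrightarrow> act C t Z (x, z) = {f. (\<lambda>(y, w). f (y, t * w)) \<in> Z (x, z / t)}"
  by (simp add: act_def)

lemma count_image_mset_times:
  fixes t :: "'a::field"
  assumes "t \<noteq> 0"
  shows "count (image_mset ((*) t) M) z = count M (z / t)"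
  using assms by (induction M) (auto simp: field_simps)

lemma act_vertical:
  assumes "t \<noteq> 0"
  shows "act C t (vertical_subscheme C Y) = vertical_subscheme C (\<lambda>x. image_mset ((*) t) (Y x))"
proof (rule extensionalityI[of _ "cyl C"])
  show "act C t (vertical_subscheme C Y) \<in> extensional (cyl C)" by (simp add: act_def)
  show "vertical_subscheme C (\<lambda>x. image_mset ((*) t) (Y x)) \<in> extensional (cyl C)"
    by (simp add: vertical_subscheme_def)
  fix P assume "P \<in> cyl C"
  then obtain x z where P: "P = (x, z)" "x \<in> C" by auto
  have cnt: "count (image_mset ((*) t) (Y x)) z = count (Y x) (z / t)"
    using assms by (rule count_image_mset_times)
  let ?m = "count (Y x) (z / t)"
  have "(\<lambda>(y, w). f (y, t * w)) \<in> line_ideal C x (z / t) ?m \<longleftrightarrow> f \<in> line_ideal C x z ?m" for f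
  proof
    assume "f \<in> line_ideal C x z ?m"
    then show "(\<lambda>(y, w). f (y, t * w)) \<in> line_ideal C x (z / t) ?m"
      using line_ideal_rescale[of f C x t "z / t" ?m] assms by simp
  next
    assume "(\<lambda>(y, w). f (y, t * w)) \<in> line_ideal C x (z / t) ?m"
    then show "f \<in> line_ideal C x z ?m"
      using line_ideal_rescale[of "\<lambda>(y, w). f (y, t * w)" C x "1 / t" z ?m] assms
      by (simp add: case_prod_unfold)
  qed
  then show "act C t (vertical_subscheme C Y) P =
      vertical_subscheme C (\<lambda>x. image_mset ((*) t) (Y x)) P"
    using P by (simp add: act_apply vertical_subscheme_apply cnt)
qed

lemma act_act:
  assumes "t \<noteq> 0"
  shows "act C s (act C t Z) = act C (s * t) Z"
proof (rule extensionalityI[of _ "cyl C"])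
  show "act C s (act C t Z) \<in> extensional (cyl C)" "act C (s * t) Z \<in> extensional (cyl C)"
    by (simp_all add: act_def)
  fix P assume "P \<in> cyl C"
  then obtain x z where "P = (x, z)" "x \<in> C" by auto
  then show "act C s (act C t Z) P = act C (s * t) Z P"
    by (simp add: act_apply mult.assoc)
qed

lemma act_1:
  assumes "Z \<in> extensional (cyl C)"
  shows "act C 1 Z = Z"
proof (rule extensionalityI[of _ "cyl C"])
  show "act C 1 Z \<in> extensional (cyl C)" by (simp add: act_def)
  fix P assume "P \<in> cyl C"
  then obtain x z where "P = (x, z)" "x \<in> C" by auto
  then show "act C 1 Z P = Z P" by (simp add: act_apply)
qed (rule assms)

lemma line_ideal_eq_germs_iff:
  assumes "x \<in> C"
  shows "line_ideal C x z m = cyl_germs C (x, z) \<longleftrightarrow> m = 0"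
  using power_in_line_ideal[OF assms, of z 0 m] cyl_germs_const[of 1 C "(x, z)"] line_ideal_0[OF assms]
  by (auto simp: case_prod_unfold)

section \<open>Support, length and image in the symmetric power of a vertical subscheme\<close>

context
  fixes C X :: "'n::finite proj set" and Y :: "'n proj \<Rightarrow> complex multiset"
  assumes X: "finite X" "X \<subseteq> C" and Y: "\<And>x. x \<notin> X \<Longrightarrow> Y x = {#}"
begin

lemma support_vertical: "support C (vertical_subscheme C Y) = (SIGMA x:X. set_mset (Y x))"
proof (rule Set.set_eqI)
  fix P :: "'n proj \<times> complex"
  obtain x z where P: "P = (x, z)" by fastforce
  show "P \<in> support C (vertical_subscheme C Y) \<longleftrightarrow> P \<in> (SIGMA x:X. set_mset (Y x))"
  proof (cases "x \<in> X")
    case True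
    then have "x \<in> C" using X by blast
    then show ?thesis
      using True by (simp add: P support_def vertical_subscheme_apply line_ideal_eq_germs_iff)
  next
    case False
    then show ?thesis
      using Y[OF False] by (auto simp: P support_def vertical_subscheme_apply line_ideal_eq_germs_iff)
  qed
qed

lemma local_length_vertical:
  "x \<in> C \<Longrightarrow> local_length C (vertical_subscheme C Y) (x, z) = count (Y x) z"
  by (simp add: local_length_def vertical_subscheme_apply codim_line_ideal)

lemma vertical_in_Hilb: "vertical_subscheme C Y \<in> Hilb C (\<Sum>x\<in>X. size (Y x))"
  unfolding Hilb_def mem_Collect_eq
proof (intro conjI ballI)
  show "vertical_subscheme C Y \<in> (\<Pi>\<^sub>E P\<in>cyl C. {I. germ_ideal cyl_ratios (cyl C) P I})"
    by (auto simp: vertical_subscheme_def PiE_def intro: line_ideal_ideal)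
  show "finite (support C (vertical_subscheme C Y))"
    using X by (simp add: support_vertical)
  show "\<exists>d. has_codim (cyl_germs C P) (vertical_subscheme C Y P) d" if "P \<in> cyl C" for P
    using that by (cases P) (auto simp: vertical_subscheme_apply intro!: exI has_codim_line_ideal)
  have "(\<Sum>P\<in>support C (vertical_subscheme C Y). local_length C (vertical_subscheme C Y) P) =
      (\<Sum>(x, z)\<in>(SIGMA x:X. set_mset (Y x)). count (Y x) z)"
    unfolding support_vertical using X by (intro sum.cong) (auto simp: local_length_vertical)
  also have "\<dots> = (\<Sum>x\<in>X. \<Sum>z\<in>set_mset (Y x). count (Y x) z)"
    using X by (simp add: sum.Sigma)
  also have "\<dots> = (\<Sum>x\<in>X. size (Y x))" by (simp add: size_multiset_overloaded_eq)
  finally show "(\<Sum>P\<in>support C (vertical_subscheme C Y). local_length C (vertical_subscheme C Y) P) =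
    (\<Sum>x\<in>X. size (Y x))" .
qed

lemma h_map_vertical: "h_map C (vertical_subscheme C Y) = (\<Sum>x\<in>X. Y x)"
proof -
  have eq: "(\<Sum>z\<in>set_mset M. replicate_mset (count M z) z) = M" for M :: "complex multiset"
    by (rule multiset_eqI) (simp add: count_sum not_in_iff)
  have img: "image_mset snd (\<Sum>P\<in>A. M P) = (\<Sum>P\<in>A. image_mset snd (M P))"
    for A and M :: "'n proj \<times> complex \<Rightarrow> ('n proj \<times> complex) multiset"
    by (induction A rule: infinite_finite_induct) auto
  have "h_map C (vertical_subscheme C Y) =
      (\<Sum>(x, z)\<in>(SIGMA x:X. set_mset (Y x)). replicate_mset (count (Y x) z) z)"
    unfolding h_map_def hilbert_chow_def img support_vertical
    using X by (intro sum.cong) (auto simp: local_length_vertical)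
  also have "\<dots> = (\<Sum>x\<in>X. \<Sum>z\<in>set_mset (Y x). replicate_mset (count (Y x) z) z)"
    using X by (simp add: sum.Sigma)
  also have "\<dots> = (\<Sum>x\<in>X. Y x)" by (simp only: eq)
  finally show ?thesis .
qed

end

text \<open>Multiplicities are recovered as colengths of the stalks.\<close>

lemma vertical_subscheme_inject:
  assumes "vertical_subscheme C Y = vertical_subscheme C Y'" "x \<in> C"
  shows "Y x = Y' x"
proof (rule multiset_eqI)
  fix z
  have "line_ideal C x z (count (Y x) z) = line_ideal C x z (count (Y' x) z)"
    using assms by (metis vertical_subscheme_apply)
  then show "count (Y x) z = count (Y' x) z" using codim_line_ideal[OF assms(2)] by metis
qed

section \<open>Generated ideals and the stalks of generic fixed points\<close>

lemma gen_ideal_subset_iff: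
  assumes "germ_ideal A X P I"
  shows "gen_ideal A X P S \<subseteq> I \<longleftrightarrow> S \<subseteq> I"
  using assms unfolding gen_ideal_def by blast

lemma gen_ideal_germ_ideal:
  assumes "S \<subseteq> cyl_germs C P"
  shows "cyl_ideal C P (gen_ideal cyl_ratios (cyl C) P S)"
  unfolding germ_ideal_def
proof (intro conjI ballI)
  show "gen_ideal cyl_ratios (cyl C) P S \<subseteq> cyl_germs C P"
    using assms gen_ideal_subset_iff[OF cyl_ideal_germs] by blast
  show "null_germs cyl_ratios (cyl C) P \<subseteq> gen_ideal cyl_ratios (cyl C) P S"
    by (auto simp: gen_ideal_def germ_ideal_def)
qed (simp_all add: gen_ideal_def germ_ideal_def)

lemma one_in_max_ideal_pow_0: "(\<lambda>_. 1) \<in> max_ideal_pow proj_ratios C x 0"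
  using proj_germI[OF hom_form_const[of 1] hom_form_const[of 1], where f = "\<lambda>_. 1"] by simp

text \<open>The generators are products of elements of the maximal ideal with arbitrary germs: the
  factor 1 gives one inclusion, and that the maximal ideal is an ideal gives the other. Generic
  fixed points involve only the exponents 0 and 1.\<close>

lemma max_ideal_pow_1:
  assumes "x \<in> C"
  shows "max_ideal_pow proj_ratios C x 1 = max_ideal proj_ratios C x"
proof -
  let ?S = "{\<lambda>Q. f Q * g Q | f g. f \<in> max_ideal proj_ratios C x \<and> g \<in> germs proj_ratios C x}"
  have mult: "(\<lambda>Q. f Q * g Q) \<in> germs proj_ratios C x"
    if f: "f \<in> germs proj_ratios C x" and g: "g \<in> germs proj_ratios C x" for f g
  proof -
    obtain d F G where f: "hom_form d F" "hom_form d G" "G (hcoords x) \<noteq> 0"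
      "\<And>y. y \<in> C \<Longrightarrow> G (hcoords y) \<noteq> 0 \<Longrightarrow> f y = F (hcoords y) / G (hcoords y)"
      using proj_germE[OF f] by blast
    obtain d' F' G' where g: "hom_form d' F'" "hom_form d' G'" "G' (hcoords x) \<noteq> 0"
      "\<And>y. y \<in> C \<Longrightarrow> G' (hcoords y) \<noteq> 0 \<Longrightarrow> g y = F' (hcoords y) / G' (hcoords y)"
      using proj_germE[OF g] by blast
    show ?thesis
      by (rule proj_germI[OF hom_form_mult[OF f(1) g(1)] hom_form_mult[OF f(2) g(2)]])
        (use f(3,4) g(3,4) in auto)
  qed
  have add: "(\<lambda>Q. f Q + g Q) \<in> germs proj_ratios C x"
    if f: "f \<in> germs proj_ratios C x" and g: "g \<in> germs proj_ratios C x" for f g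
  proof -
    obtain d F G where f: "hom_form d F" "hom_form d G" "G (hcoords x) \<noteq> 0"
      "\<And>y. y \<in> C \<Longrightarrow> G (hcoords y) \<noteq> 0 \<Longrightarrow> f y = F (hcoords y) / G (hcoords y)"
      using proj_germE[OF f] by blast
    obtain d' F' G' where g: "hom_form d' F'" "hom_form d' G'" "G' (hcoords x) \<noteq> 0"
      "\<And>y. y \<in> C \<Longrightarrow> G' (hcoords y) \<noteq> 0 \<Longrightarrow> g y = F' (hcoords y) / G' (hcoords y)"
      using proj_germE[OF g] by blast
    show ?thesis
      by (rule proj_germI[OF hom_form_add[OF hom_form_mult[OF f(1) g(2)] hom_form_mult[OF f(2) g(1)]]
            hom_form_mult[OF f(2) g(2)]])
        (use f(3,4) g(3,4) in \<open>auto simp: field_simps\<close>)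
  qed
  have "null_germs proj_ratios C x \<subseteq> max_ideal proj_ratios C x"
  proof
    fix f assume "f \<in> null_germs proj_ratios C x"
    then obtain F' G' where FG': "(F', G') \<in> proj_ratios" "G' x \<noteq> 0" "\<forall>Q\<in>C. G' Q \<noteq> 0 \<longrightarrow> f Q = 0"
      unfolding null_germs_def by blast
    then obtain d G where G: "hom_form d G" "G' = (\<lambda>x. G (hcoords x))"
      unfolding proj_ratios_def by blast
    have "f \<in> germs proj_ratios C x"
      by (rule proj_germI[OF hom_form_zero G(1)]) (use FG' G(2) in auto)
    then show "f \<in> max_ideal proj_ratios C x" using FG' assms by (simp add: max_ideal_def)
  qed
  then have I: "germ_ideal proj_ratios C x (max_ideal proj_ratios C x)"
    unfolding germ_ideal_def by (auto simp: max_ideal_def add mult)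
  have "gen_ideal proj_ratios C x ?S \<subseteq> max_ideal proj_ratios C x"
    unfolding gen_ideal_subset_iff[OF I] by (auto simp: max_ideal_def mult)
  moreover have "max_ideal proj_ratios C x \<subseteq> gen_ideal proj_ratios C x ?S"
  proof
    fix f assume f: "f \<in> max_ideal proj_ratios C x"
    have "(\<lambda>Q. f Q * (\<lambda>_. 1) Q) \<in> ?S" using f one_in_max_ideal_pow_0[of C x] by fastforce
    then show "f \<in> gen_ideal proj_ratios C x ?S" by (auto simp: gen_ideal_def)
  qed
  ultimately show ?thesis by simp
qed

text \<open>At a point of \<open>D\<^sub>i\<close> the stalk is generated by \<open>\<mm>\<^sub>x\<close> and \<open>z\<^sup>i\<close>.\<close>

lemma fixed_subscheme_vertical:
  assumes E: "\<And>k x. x \<in> C \<Longrightarrow> E_mult lam D k x = of_bool (k < wt x)"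
  shows "fixed_subscheme C lam D = vertical_subscheme C (\<lambda>x. replicate_mset (wt x) 0)"
proof (rule extensionalityI[of _ "cyl C"])
  show "fixed_subscheme C lam D \<in> extensional (cyl C)" by (simp add: fixed_subscheme_def)
  show "vertical_subscheme C (\<lambda>x. replicate_mset (wt x) 0) \<in> extensional (cyl C)"
    by (simp add: vertical_subscheme_def)
  fix P assume "P \<in> cyl C"
  then obtain x z where P: "P = (x, z)" and x: "x \<in> C" by auto
  let ?S = "{\<lambda>(y, w). g y * w ^ k | g k. g \<in> max_ideal_pow proj_ratios C x (E_mult lam D k x)}"
  let ?I = "gen_ideal cyl_ratios (cyl C) (x, z) ?S" and ?m = "count (replicate_mset (wt x) (0::complex)) z"
  have gen: "f \<in> ?I" if "f \<in> ?S" for f using that unfolding gen_ideal_def by blast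
  have pw: "(\<lambda>(y, w). w ^ k) \<in> ?I" if "wt x \<le> k" for k
  proof -
    have "(\<lambda>(y, w). (\<lambda>_. 1) y * w ^ k) \<in> ?S"
      using one_in_max_ideal_pow_0[of C x] E[OF x, of k] that by fastforce
    from gen[OF this] show ?thesis by simp
  qed
  have S: "f \<in> line_ideal C x z ?m" if fS: "f \<in> ?S" for f
  proof -
    obtain g k where f: "f = (\<lambda>(y, w). g y * w ^ k)" and
      g: "g \<in> max_ideal_pow proj_ratios C x (E_mult lam D k x)" using fS by blast
    have "g \<in> germs proj_ratios C x \<and> (k < wt x \<longrightarrow> g x = 0)"
    proof (cases "k < wt x")
      case True
      then have "E_mult lam D k x = 1" using E[OF x, of k] by simp
      then have "g \<in> max_ideal proj_ratios C x" using g max_ideal_pow_1[OF x] by metis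
      then show ?thesis by (simp add: max_ideal_def)
    next
      case False
      then show ?thesis using g E[OF x, of k] by simp
    qed
    then have g': "g \<in> germs proj_ratios C x" and gx: "k < wt x \<Longrightarrow> g x = 0" by auto
    have "(\<lambda>Q. (\<lambda>(y, w). g y) Q * (\<lambda>(y, w). poly (monom 1 k) w) Q) \<in> cyl_germs C (x, z)"
      by (intro cyl_germs_mult cyl_germs_fst[OF g'] cyl_germs_poly)
    then have fg: "f \<in> cyl_germs C (x, z)" by (simp add: f case_prod_unfold poly_monom)
    moreover have "vanishing ?m z (\<lambda>w. f (x, w))"
    proof (cases "k < wt x")
      case True
      then have "(\<lambda>w. f (x, w)) = poly 0" using gx by (simp add: f fun_eq_iff)
      then show ?thesis using vanishing_poly[of ?m z 0] by (simp only: dvd_0_right)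
    next
      case False
      have "[:-z, 1:] ^ ?m dvd Polynomial.smult (g x) (monom 1 k)"
      proof (cases "z = 0")
        case True
        then have L: "[:-z, 1:] = ([:0, 1:] :: complex poly)" and m: "?m = wt x" by simp_all
        have "[:-z, 1:] ^ ?m dvd [:0, 1:] ^ k"
          unfolding L m by (rule le_imp_power_dvd) (use False in simp)
        moreover have "monom 1 k = ([:0, 1:] ^ k :: complex poly)" by (simp add: monom_altdef)
        ultimately show ?thesis by (simp only: dvd_smult)
      qed simp
      moreover have "poly (Polynomial.smult (g x) (monom 1 k)) = (\<lambda>w. f (x, w))"
        by (simp add: fun_eq_iff f poly_monom)
      ultimately show ?thesis using vanishing_poly[of ?m z "Polynomial.smult (g x) (monom 1 k)"] by simp
    qed
    ultimately show ?thesis by (simp add: line_ideal_def)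
  qed
  have "?S \<subseteq> cyl_germs C (x, z)" using S by (auto simp: line_ideal_def)
  then have I: "cyl_ideal C (x, z) ?I" by (rule gen_ideal_germ_ideal)
  have "line_ideal C x z ?m \<subseteq> ?I"
  proof (cases "z = 0 \<and> 0 < wt x")
    case True
    show ?thesis
    proof (rule line_ideal_generated[OF x I])
      fix g assume "g \<in> max_ideal proj_ratios C x"
      then have "(\<lambda>(y, w). g y * w ^ 0) \<in> ?S"
        using True E[OF x, of 0] max_ideal_pow_1[OF x] by fastforce
      from gen[OF this] show "(\<lambda>(y, w). g y) \<in> ?I" by simp
    next
      show "(\<lambda>(y, w). (w - z) ^ ?m) \<in> ?I" using pw[of ?m] True by simp
    qed
  next
    \<comment> \<open>Here \<open>w ^ wt x\<close> is a unit at the point, because \<open>z\<close>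
      is nonzero or the exponent is 0, and both ideals are the whole local ring.\<close>
    case False
    have "(\<lambda>_. 1) \<in> ?I"
    proof (rule ideal_divide[OF I pw[OF order_refl] cyl_form_poly cyl_form_const[of 1]])
      show "poly (monom 1 (wt x)) z \<noteq> 0" using False by (auto simp: poly_monom)
    qed (auto simp: poly_monom)
    then show ?thesis using ideal_one[OF I] by (auto simp: line_ideal_def)
  qed
  moreover have "?I \<subseteq> line_ideal C x z ?m"
    unfolding gen_ideal_subset_iff[OF line_ideal_ideal[OF x]] using S by blast
  ultimately show "fixed_subscheme C lam D P = vertical_subscheme C (\<lambda>x. replicate_mset (wt x) 0) P"
    using x by (auto simp: P fixed_subscheme_def vertical_subscheme_apply)
qed

section \<open>Sections on vertical lines\<close>

text \<open>On a line that it meets, a Zariski open set contains the complement of the zeros of one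
  polynomial, the restriction of a denominator.\<close>

lemma zariski_open_line:
  assumes V: "zariski_open cyl_ratios (cyl C) V" and x: "(x, \<zeta>) \<in> V"
  shows "finite (- {z. (x, z) \<in> V})"
proof -
  have xC: "x \<in> C" using V x by (auto simp: zariski_open_def)
  obtain F' G' where FG': "(F', G') \<in> cyl_ratios" "G' (x, \<zeta>) \<noteq> 0" "{Q \<in> cyl C. G' Q \<noteq> 0} \<subseteq> V"
    using V x unfolding zariski_open_def by blast
  then obtain d G where G: "cyl_form d G" "G' = (\<lambda>(x, z). G (hcoords x) z)"
    unfolding cyl_ratios_def by blast
  obtain B where B: "\<And>z. G (hcoords x) z = poly B z" using cyl_form_line[OF G(1)] by blast
  have "(x, z) \<in> V" if "poly B z \<noteq> 0" for z
    by (rule subsetD[OF FG'(3)]) (use that G(2) B xC in simp)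
  then have "- {z. (x, z) \<in> V} \<subseteq> {z. poly B z = 0}" by auto
  then show ?thesis
    using finite_poly_zeros[of B \<zeta>] FG'(2) G(2) B finite_subset by auto
qed

lemma cofinite_complex:
  fixes S :: "complex set"
  assumes "finite (- S)"
  shows "infinite S" "open S"
proof -
  show "infinite S" using assms infinite_UNIV_char_0[where 'a = complex] by (metis Compl_partition finite_UnI)
  show "open S" using finite_imp_closed[OF assms] by (simp add: closed_def)
qed

text \<open>The local fractions of a regular function on a line glue to one fraction in lowest terms.\<close>

lemma section_represents:
  assumes V: "zariski_open cyl_ratios (cyl C) V" and f: "f \<in> cyl_sections C V"
    and x: "(x, \<zeta>) \<in> V"
  obtains A B where "represents {z. (x, z) \<in> V} (\<lambda>z. f (x, z)) A B"
proof -
  have xC: "x \<in> C" using V x by (auto simp: zariski_open_def)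
  have germ: "f \<in> cyl_germs C (x, z)" if "(x, z) \<in> V" for z
    using f that by (auto simp: sections_def)
  obtain A0 B0 where AB0: "poly B0 \<zeta> \<noteq> 0" "finite {z. f (x, z) \<noteq> poly A0 z / poly B0 z}"
    using cyl_germ_line[OF germ[OF x] xC] by blast
  have B0: "B0 \<noteq> 0" using AB0(1) by auto
  \<comment> \<open>The denominators of all fractions equal to \<open>A0 / B0\<close> form, together
    with 0, an ideal of the polynomial ring; one of least degree divides the others.\<close>
  let ?P = "\<lambda>(A, B). B \<noteq> 0 \<and> A * B0 = A0 * B"
  have "?P (A0, B0)" using B0 by simp
  from ex_has_least_nat[where P = ?P and m = "\<lambda>(A, B). degree B", OF this]
  obtain A B where AB: "B \<noteq> 0" "A * B0 = A0 * B"
    and least: "\<And>A' B'. B' \<noteq> 0 \<Longrightarrow> A' * B0 = A0 * B' \<Longrightarrow> degree B \<le> degree B'"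
    by auto
  have "represents {z. (x, z) \<in> V} (\<lambda>z. f (x, z)) A B"
    unfolding represents_def
  proof (intro ballI)
    fix z assume "z \<in> {z. (x, z) \<in> V}"
    then obtain A' B' where AB': "poly B' z \<noteq> 0" "finite {z. f (x, z) \<noteq> poly A' z / poly B' z}"
      "f (x, z) = poly A' z / poly B' z"
      using cyl_germ_line[OF germ xC] by blast
    have "A0 * B' = A' * B0" by (rule cofinite_cross[OF AB0(2) AB'(2)]) (use AB0(1) AB'(1) in auto)
    note A'B0 = this
    have "(A * B') * B0 = (A' * B) * B0" using AB(2) A'B0 by (metis mult.assoc mult.commute)
    then have eq: "A * B' = A' * B" using B0 by simp
    \<comment> \<open>The remainder satisfies the same equation with smaller degree, so minimality
      makes it 0; every zero of \<open>B\<close> is then a zero of each local denominator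
      \<open>B'\<close>.\<close>
    have "(A' - B' div B * A) * B0 = A0 * (B' mod B)"
      using AB(2) A'B0 by (simp add: left_diff_distrib mult.assoc minus_div_mult_eq_mod[symmetric]
          right_diff_distrib mult.left_commute)
    then have "B' mod B = 0"
      using least[of "B' mod B"] degree_mod_less[OF AB(1), of B'] by fastforce
    then have "B dvd B'" by presburger
    then have "poly B z \<noteq> 0" using AB'(1) by (auto elim!: dvdE)
    moreover have "poly A z * poly B' z = poly A' z * poly B z" using eq by (metis poly_mult)
    ultimately show "poly B z \<noteq> 0 \<and> f (x, z) = poly A z / poly B z"
      unfolding AB'(3) using AB'(1) by (simp add: frac_eq_eq)
  qed
  then show thesis by (rule that)
qed

lemma vanishing_represents:
  assumes "finite (- S)" "\<zeta> \<in> S" "represents S g A B"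
  shows "vanishing m \<zeta> g \<longleftrightarrow> [:-\<zeta>, 1:] ^ m dvd A"
proof (rule vanishing_iff)
  show "poly B \<zeta> \<noteq> 0" using assms by (simp add: represents_def)
  show "finite {z. g z \<noteq> poly A z / poly B z}"
    by (rule finite_subset[OF _ assms(1)]) (use assms(3) in \<open>auto simp: represents_def\<close>)
qed

text \<open>Membership in all stalks is a condition on the zero orders of one numerator on each
  line, which the Newton coefficients at the points of \<open>Y x\<close> test. That
  \<open>(x, 0)\<close> lies in \<open>V\<close> ensures that \<open>V\<close> contains almost all
  of the line over \<open>x\<close>.\<close>

lemma ideal_sections_vertical:
  assumes V: "zariski_open cyl_ratios (cyl C) V" and f: "f \<in> cyl_sections C V"
    and X: "X \<subseteq> C" and Y: "\<And>x. x \<notin> X \<Longrightarrow> Y x = {#}"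
    and ys: "\<And>x. x \<in> X \<Longrightarrow> mset (ys x) = Y x"
    and VX: "\<And>x. x \<in> X \<Longrightarrow> (x, 0) \<in> V" "\<And>x. x \<in> X \<Longrightarrow> set (ys x) \<subseteq> {z. (x, z) \<in> V}"
  shows "f \<in> ideal_sections C (vertical_subscheme C Y) V \<longleftrightarrow>
    (\<forall>x\<in>X. \<forall>i<size (Y x). newton_coeffs {z. (x, z) \<in> V} (ys x) (\<lambda>z. f (x, z)) ! i = 0)"
proof -
  have VC: "V \<subseteq> cyl C" using V by (simp add: zariski_open_def)
  have germ: "f \<in> cyl_germs C (x, z)" if "(x, z) \<in> V" for x z
    using f that by (auto simp: sections_def)
  have "f \<in> ideal_sections C (vertical_subscheme C Y) V \<longleftrightarrow>
      (\<forall>x z. (x, z) \<in> V \<longrightarrow> f \<in> line_ideal C x z (count (Y x) z))"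
  proof -
    have "f \<in> vertical_subscheme C Y (x, z) \<longleftrightarrow> f \<in> line_ideal C x z (count (Y x) z)"
      if "(x, z) \<in> V" for x z
      using that VC by (subst vertical_subscheme_apply) auto
    moreover have "f \<in> ideal_sections C (vertical_subscheme C Y) V \<longleftrightarrow>
        (\<forall>x z. (x, z) \<in> V \<longrightarrow> f \<in> vertical_subscheme C Y (x, z))"
      using f by (auto simp: ideal_sections_def)
    ultimately show ?thesis by blast
  qed
  also have "\<dots> \<longleftrightarrow> (\<forall>x\<in>X. \<forall>z. (x, z) \<in> V \<longrightarrow> vanishing (count (Y x) z) z (\<lambda>z. f (x, z)))"
    using germ Y VC vanishing_0[OF _ germ] by (fastforce simp: line_ideal_def)
  also have "\<dots> \<longleftrightarrow> (\<forall>x\<in>X. \<forall>i<size (Y x). newton_coeffs {z. (x, z) \<in> V} (ys x) (\<lambda>z. f (x, z)) ! i = 0)"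
  proof (rule ball_cong[OF refl])
    fix x assume x: "x \<in> X"
    let ?S = "{z. (x, z) \<in> V}"
    obtain A B where rep: "represents ?S (\<lambda>z. f (x, z)) A B"
      using section_represents[OF V f VX(1)[OF x]] .
    have cof: "finite (- ?S)" by (rule zariski_open_line[OF V VX(1)[OF x]])
    have "(\<forall>z. (x, z) \<in> V \<longrightarrow> vanishing (count (Y x) z) z (\<lambda>z. f (x, z))) \<longleftrightarrow>
        (\<forall>z\<in>?S. [:-z, 1:] ^ count (mset (ys x)) z dvd A)"
      using vanishing_represents[OF cof _ rep] ys[OF x] by simp
    also have "\<dots> \<longleftrightarrow> (\<forall>z. [:-z, 1:] ^ count (mset (ys x)) z dvd A)"
    proof -
      \<comment> \<open>There are no nodes outside \<open>V\<close>, so the divisibility conditions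
        there are empty.\<close>
      have "count (mset (ys x)) z = 0" if "z \<notin> ?S" for z
        using VX(2)[OF x] that by (auto simp: count_mset_0_iff)
      then show ?thesis by (metis power_0 one_dvd)
    qed
    also have "\<dots> \<longleftrightarrow> (\<forall>i<length (ys x). newton_coeffs ?S (ys x) (\<lambda>z. f (x, z)) ! i = 0)"
      using newton_coeffs_eq_0_iff[OF cofinite_complex(1)[OF cof] VX(2)[OF x] rep] by blast
    also have "length (ys x) = size (Y x)" using ys[OF x] by (metis size_mset)
    finally show "(\<forall>z. (x, z) \<in> V \<longrightarrow> vanishing (count (Y x) z) z (\<lambda>z. f (x, z))) \<longleftrightarrow>
      (\<forall>i<size (Y x). newton_coeffs ?S (ys x) (\<lambda>z. f (x, z)) ! i = 0)" .
  qed
  finally show ?thesis .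
qed

section \<open>Limits in the charts of the Hilbert scheme\<close>

lemma sections_lincomb:
  fixes n :: nat
  assumes "f \<in> cyl_sections C V" "\<And>i. i < n \<Longrightarrow> b i \<in> cyl_sections C V"
  shows "(\<lambda>Q. f Q - (\<Sum>i<n. c i * b i Q)) \<in> cyl_sections C V"
  using assms cyl_germs_lincomb[of f C] unfolding sections_def by blast

lemma sections_zero: "(\<lambda>_. 0) \<in> cyl_sections C V"
  by (simp add: sections_def cyl_germs_const)

text \<open>\<open>h\<close> will enumerate the pairs of a point \<open>x\<close> and an index below
  the degree over \<open>x\<close>; the functional number \<open>a\<close> is the corresponding
  Newton coefficient on the line over \<open>x\<close>, with the nodes scaled by
  \<open>t\<close>.\<close>

definition node_coeff :: "('n::finite proj \<times> complex) set \<Rightarrow> ('n proj \<Rightarrow> complex list) \<Rightarrow>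
    (nat \<Rightarrow> 'n proj \<times> nat) \<Rightarrow> complex \<Rightarrow> nat \<Rightarrow> ('n proj \<times> complex \<Rightarrow> complex) \<Rightarrow> complex" where
  "node_coeff V ys h t a f = newton_coeffs {z. (fst (h a), z) \<in> V} (map ((*) t) (ys (fst (h a))))
     (\<lambda>z. f (fst (h a), z)) ! snd (h a)"

section \<open>Newton functionals along the action\<close>

context
  fixes C X :: "'n::finite proj set" and wt :: "'n proj \<Rightarrow> nat" and n :: nat
    and h :: "nat \<Rightarrow> 'n proj \<times> nat" and V :: "('n proj \<times> complex) set"
    and Y :: "'n proj \<Rightarrow> complex multiset" and ys :: "'n proj \<Rightarrow> complex list"
  assumes X: "finite X" "X \<subseteq> C" and wt0: "\<forall>x. x \<notin> X \<longrightarrow> wt x = 0"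
    and h: "bij_betw h {..<n} (SIGMA x:X. {..<wt x})"
    and V: "zariski_open cyl_ratios (cyl C) V" and XV0: "\<forall>x\<in>X. (x, 0) \<in> V"
    and Y: "\<And>x. size (Y x) = wt x" and ys: "\<And>x. mset (ys x) = Y x"
begin

private lemma wt: "x \<notin> X \<Longrightarrow> wt x = 0"
  using wt0 by blast

private lemma XV: "x \<in> X \<Longrightarrow> (x, 0) \<in> V"
  using XV0 by blast

private lemma length_nodes: "length (ys x) = wt x"
  using Y ys by (metis size_mset)

private lemma index_mem:
  assumes "a < n"
  shows "fst (h a) \<in> X" "snd (h a) < wt (fst (h a))"
  using bij_betw_apply[OF h, of a] assms by auto

lemma eventually_nodes:
  "\<forall>\<^sub>F t in nhds 0. \<forall>x\<in>X. set (map ((*) t) (ys x)) \<subseteq> {z. (x, z) \<in> V}"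
proof (intro eventually_ball_finite X(1) ballI)
  fix x assume x: "x \<in> X"
  show "\<forall>\<^sub>F t in nhds 0. set (map ((*) t) (ys x)) \<subseteq> {z. (x, z) \<in> V}"
    using eventually_nodes_in[OF cofinite_complex(2)[OF zariski_open_line[OF V XV[OF x]]]] XV[OF x] by simp
qed

lemma node_coeff_lincomb:
  fixes k :: nat
  assumes t: "\<forall>x\<in>X. set (map ((*) t) (ys x)) \<subseteq> {z. (x, z) \<in> V}" and a: "a < n"
    and f: "f \<in> cyl_sections C V" and b: "\<And>i. i < k \<Longrightarrow> b i \<in> cyl_sections C V"
  shows "node_coeff V ys h t a (\<lambda>Q. f Q - (\<Sum>i<k. c i * b i Q)) =
    node_coeff V ys h t a f - (\<Sum>i<k. c i * node_coeff V ys h t a (b i))"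
proof -
  note x = index_mem[OF a]
  obtain A B where "represents {z. (fst (h a), z) \<in> V} (\<lambda>z. f (fst (h a), z)) A B"
    using section_represents[OF V f XV[OF x(1)]] .
  moreover have "\<exists>A B. represents {z. (fst (h a), z) \<in> V} (\<lambda>z. b i (fst (h a), z)) A B" if "i < k" for i
    using section_represents[OF V b[OF that] XV[OF x(1)]] by blast
  ultimately show ?thesis
    unfolding node_coeff_def using x t length_nodes
    by (intro newton_coeffs_lincomb[OF cofinite_complex(1)[OF zariski_open_line[OF V XV[OF x(1)]]]]) auto
qed

lemma tendsto_node_coeff:
  assumes f: "f \<in> cyl_sections C V" and a: "a < n"
  shows "(\<lambda>t. node_coeff V ys h t a f) \<midarrow>0\<rightarrow> node_coeff V ys h 0 a f"
proof -
  note x = index_mem[OF a]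
  note cof = zariski_open_line[OF V XV[OF x(1)]]
  obtain A B where "represents {z. (fst (h a), z) \<in> V} (\<lambda>z. f (fst (h a), z)) A B"
    using section_represents[OF V f XV[OF x(1)]] .
  then show ?thesis
    unfolding node_coeff_def using x XV length_nodes
    by (intro tendsto_newton_coeffs[OF cofinite_complex[OF cof]]) auto
qed

text \<open>The case \<open>t = 0\<close> is included, where all nodes merge; this puts the whole
  family, with its limit, into the form required by \<open>basis_mod_perturbation\<close>.\<close>

lemma ideal_sections_nodes:
  assumes t: "\<forall>x\<in>X. set (map ((*) t) (ys x)) \<subseteq> {z. (x, z) \<in> V}"
  shows "ideal_sections C (vertical_subscheme C (\<lambda>x. image_mset ((*) t) (Y x))) V =
    {f \<in> cyl_sections C V. \<forall>a<n. node_coeff V ys h t a f = 0}"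
proof -
  have "f \<in> ideal_sections C (vertical_subscheme C (\<lambda>x. image_mset ((*) t) (Y x))) V \<longleftrightarrow>
      (\<forall>a<n. node_coeff V ys h t a f = 0)" if f: "f \<in> cyl_sections C V" for f
  proof -
    have "f \<in> ideal_sections C (vertical_subscheme C (\<lambda>x. image_mset ((*) t) (Y x))) V \<longleftrightarrow>
      (\<forall>x\<in>X. \<forall>i<size (image_mset ((*) t) (Y x)).
        newton_coeffs {z. (x, z) \<in> V} (map ((*) t) (ys x)) (\<lambda>z. f (x, z)) ! i = 0)"
    proof (rule ideal_sections_vertical[OF V f X(2)])
      show "image_mset ((*) t) (Y x) = {#}" if "x \<notin> X" for x
        using Y[of x] wt[OF that] by simp
      show "mset (map ((*) t) (ys x)) = image_mset ((*) t) (Y x)" for x by (simp add: ys)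
    qed (use XV t in auto)
    also have "\<dots> \<longleftrightarrow> (\<forall>P\<in>(SIGMA x:X. {..<wt x}).
        newton_coeffs {z. (fst P, z) \<in> V} (map ((*) t) (ys (fst P))) (\<lambda>z. f (fst P, z)) ! snd P = 0)"
      using Y by auto
    also have "\<dots> \<longleftrightarrow> (\<forall>a<n. node_coeff V ys h t a f = 0)"
      unfolding bij_betw_imp_surj_on[OF h, symmetric] node_coeff_def by auto
    finally show ?thesis .
  qed
  then show ?thesis by (auto simp: ideal_sections_def)
qed

end

lemma image_mset_times_0:
  "size M = k \<Longrightarrow> image_mset ((*) (0::complex)) M = replicate_mset k 0"
  by (induction M arbitrary: k) auto

lemma vertical_limit_in_chart:
  fixes C X :: "'n::finite proj set" and wt :: "'n proj \<Rightarrow> nat" and n :: nat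
  assumes X: "finite X" "X \<subseteq> C" and wt: "\<And>x. x \<in> X \<longleftrightarrow> wt x \<noteq> 0" and n: "(\<Sum>x\<in>X. wt x) = n"
    and Y: "\<And>x. size (Y x) = wt x"
    and V: "zariski_open cyl_ratios (cyl C) V" and f: "f \<in> cyl_sections C V"
    and i: "i < n" and U: "open U"
    and p: "vertical_subscheme C (\<lambda>x. replicate_mset (wt x) 0) \<in> Hilb_chart C n V b"
    and c: "c i \<in> U" "(\<lambda>Q. f Q - (\<Sum>j<n. c j * b j Q)) \<in>
      ideal_sections C (vertical_subscheme C (\<lambda>x. replicate_mset (wt x) 0)) V"
  shows "\<forall>\<^sub>F t in at 0. act C t (vertical_subscheme C Y) \<in> {Z \<in> Hilb_chart C n V b.
    \<exists>c. c i \<in> U \<and> (\<lambda>Q. f Q - (\<Sum>j<n. c j * b j Q)) \<in> ideal_sections C Z V}"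
proof -
  let ?p = "vertical_subscheme C (\<lambda>x. replicate_mset (wt x) 0)"
  let ?q = "\<lambda>t. vertical_subscheme C (\<lambda>x. image_mset ((*) t) (Y x))"
  let ?R = "cyl_sections C V"
  have "card (SIGMA x:X. {..<wt x}) = n" using X n by simp
  then obtain h where h: "bij_betw h {..<n} (SIGMA x:X. {..<wt x})"
    using ex_bij_betw_nat_finite[of "SIGMA x:X. {..<wt x}"] X by (auto simp: lessThan_atLeast0)
  define ys where "ys x = (SOME l. mset l = Y x)" for x
  have ys: "mset (ys x) = Y x" for x
    unfolding ys_def by (rule someI_ex[OF ex_mset])
  have wt': "\<forall>x. x \<notin> X \<longrightarrow> wt x = 0" using wt by blast
  have supp: "support C ?p \<subseteq> V" and basis: "basis_mod ?R (ideal_sections C ?p V) n b"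
    using p by (auto simp: Hilb_chart_def)
  have XV: "\<forall>x\<in>X. (x, 0) \<in> V"
  proof
    fix x assume "x \<in> X"
    then have "(x, 0) \<in> support C ?p"
      using support_vertical[OF X, of "\<lambda>x. replicate_mset (wt x) 0"] wt by auto
    then show "(x, 0) \<in> V" using supp by blast
  qed
  note ctx = X wt' h V XV Y ys
  \<comment> \<open>The family \<open>?q\<close> extends the orbit to \<open>t = 0\<close> by
    sending all nodes to 0; \<open>act\<close> describes it only for nonzero
    \<open>t\<close>.\<close>
  have p_eq: "?q 0 = ?p" by (simp only: image_mset_times_0[OF Y])
  have I0: "ideal_sections C ?p V = {f \<in> ?R. \<forall>a<n. node_coeff V ys h 0 a f = 0}"
    unfolding p_eq[symmetric] by (rule ideal_sections_nodes[OF ctx]) (use XV in auto)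
  have bR: "b j \<in> ?R" if "j < n" for j using basis_mod_mem[OF basis that] .
  have "\<forall>\<^sub>F t in at 0. basis_mod ?R {f \<in> ?R. \<forall>a<n. node_coeff V ys h t a f = 0} n b \<and>
    (\<exists>c. c i \<in> U \<and> (\<lambda>Q. f Q - (\<Sum>i<n. c i * b i Q)) \<in> {f \<in> ?R. \<forall>a<n. node_coeff V ys h t a f = 0})"
  proof (rule basis_mod_perturbation)
    show "basis_mod ?R {f \<in> ?R. \<forall>a<n. node_coeff V ys h 0 a f = 0} n b"
      using basis unfolding I0 .
    show "\<forall>\<^sub>F t in nhds 0. \<forall>a<n. \<forall>f\<in>?R. \<forall>c. node_coeff V ys h t a (\<lambda>Q. f Q - (\<Sum>i<n. c i * b i Q)) =
        node_coeff V ys h t a f - (\<Sum>i<n. c i * node_coeff V ys h t a (b i))"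
      using eventually_nodes[OF ctx]
    proof eventually_elim
      case (elim t)
      show ?case
        by (intro allI ballI impI node_coeff_lincomb[OF ctx elim] bR)
    qed
    show "(\<lambda>Q. f Q - (\<Sum>i<n. c i * b i Q)) \<in> ?R" if "f \<in> ?R" for f c
      by (rule sections_lincomb[OF that bR])
    show "(\<lambda>_. 0) \<in> ?R" by (rule sections_zero)
    show "node_coeff V ys h 0 a (\<lambda>_. 0) = 0" if "a < n" for a
    proof -
      have "(\<lambda>_. 0) \<in> ideal_sections C ?p V"
        using sections_zero ideal_zero[OF line_ideal_ideal] V
        by (auto simp: ideal_sections_def vertical_subscheme_def zariski_open_def)
      then show ?thesis using that unfolding I0 by blast
    qed
    show "(\<lambda>t. node_coeff V ys h t a f) \<midarrow>0\<rightarrow> node_coeff V ys h 0 a f" if "f \<in> ?R" "a < n" for f a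
      by (rule tendsto_node_coeff[OF ctx that])
    show "(\<lambda>Q. f Q - (\<Sum>i<n. c i * b i Q)) \<in> {f \<in> ?R. \<forall>a<n. node_coeff V ys h 0 a f = 0}"
      using c(2) unfolding I0 .
  qed (fact f i U c(1))+
  moreover have "\<forall>\<^sub>F t in at 0. \<forall>x\<in>X. set (map ((*) t) (ys x)) \<subseteq> {z. (x, z) \<in> V}"
    using eventually_nodes[OF ctx] unfolding eventually_nhds_conv_at by blast
  moreover have "\<forall>\<^sub>F t in at (0::complex). t \<noteq> 0" by (simp add: eventually_at_filter)
  ultimately show ?thesis
  proof eventually_elim
    case (elim t)
    have q: "act C t (vertical_subscheme C Y) = ?q t" by (rule act_vertical[OF elim(3)])
    have Yt: "image_mset ((*) t) (Y x) = {#}" if "x \<notin> X" for x using Y[of x] wt' that by simp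
    have "?q t \<in> Hilb C n"
      using vertical_in_Hilb[where Y = "\<lambda>x. image_mset ((*) t) (Y x)", OF X Yt] Y n by simp
    moreover have "support C (?q t) = (SIGMA x:X. set_mset (image_mset ((*) t) (Y x)))"
      by (rule support_vertical[OF X Yt])
    then have "support C (?q t) \<subseteq> V"
      using elim(2) by (auto simp flip: ys)
    moreover note ideal_sections_nodes[OF ctx elim(2)]
    ultimately show ?case using elim(1) unfolding q Hilb_chart_def by simp
  qed
qed

text \<open>It is enough to test the generating sets, by induction on how an open set is generated.
  That the limit lies in one of them places it in the topological space.\<close>

lemma limitin_generated:
  assumes "l \<in> \<Union>S" and ev: "\<And>W. W \<in> S \<Longrightarrow> l \<in> W \<Longrightarrow> \<forall>\<^sub>F t in F. f t \<in> W"
  shows "limitin (topology_generated_by S) f l F"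
  unfolding limitin_def
proof (intro conjI allI impI)
  show "l \<in> topspace (topology_generated_by S)" using assms(1) by simp
  fix U assume U: "openin (topology_generated_by S) U \<and> l \<in> U"
  then have "generate_topology_on S U" by (simp add: openin_topology_generated_by_iff)
  then have "l \<in> U \<longrightarrow> (\<forall>\<^sub>F t in F. f t \<in> U)"
  proof induction
    case (Int a b)
    then show ?case by (auto intro: eventually_conj)
  next
    case (UN K)
    then show ?case by (blast intro: eventually_mono)
  qed (use ev in auto)
  then show "\<forall>\<^sub>F t in F. f t \<in> U" using U by blast
qed

section \<open>Counting distributions of a multiset\<close>

text \<open>A multiset has exactly one sorted list, so each monomial of degree \<open>k\<close>
  occurs once.\<close>

lemma h_sym1_eq: "h_sym1 k M = of_bool (size M = k)"
proof -
  have "length l = k \<and> sorted l \<and> mset l = M \<longleftrightarrow> size M = k \<and> l = sorted_list_of_multiset M" for l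
    by (metis mset_sorted_list_of_multiset size_mset sorted_list_of_multiset_mset sorted_sort_id
        sorted_sorted_list_of_multiset)
  then have "{l. length l = k \<and> sorted l \<and> mset l = M} =
      (if size M = k then {sorted_list_of_multiset M} else {})"
    by auto
  then show ?thesis by (simp add: h_sym1_def)
qed

text \<open>This counts the ways to write \<open>M\<close> as a sum of multisets of prescribed
  sizes, the summands being distinguished by their positions.\<close>

primrec fillings :: "nat list \<Rightarrow> 'a multiset \<Rightarrow> nat" where
  "fillings [] M = of_bool (M = {#})"
| "fillings (k # ks) M = (\<Sum>A | A \<subseteq># M \<and> size A = k. fillings ks (M - A))"

lemma finite_subset_mset: "finite {A. A \<subseteq># M \<and> P A}"
proof (rule finite_subset)
  show "finite {A. A \<subseteq># M}"
  proof (induction M)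
    case (add x M)
    have "A \<in> {A. A \<subseteq># M} \<union> add_mset x ` {A. A \<subseteq># M}" if "A \<subseteq># add_mset x M" for A
    proof (cases "x \<in># A")
      case True
      then obtain B where "A = add_mset x B" by (metis insert_DiffM)
      then show ?thesis using that by auto
    next
      case False
      have "count A y \<le> count M y" for y
        using mset_subset_eq_count[OF that, of y] False
        by (cases "y = x") (auto simp: not_in_iff)
      then have "A \<subseteq># M" by (rule mset_subset_eqI)
      then show ?thesis by simp
    qed
    then have "{A. A \<subseteq># add_mset x M} \<subseteq> {A. A \<subseteq># M} \<union> add_mset x ` {A. A \<subseteq># M}" by blast
    then show ?case using add finite_subset by blast
  qed simp
qed auto

lemma h_sym_fillings: "h_sym lam M = int (fillings (sorted_list_of_multiset lam) M)"
proof -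
  have "foldr (\<lambda>k. series_times (h_sym1 k)) ks series_one M = int (fillings ks M)" for ks
  proof (induction ks arbitrary: M)
    case (Cons k ks)
    have "foldr (\<lambda>k. series_times (h_sym1 k)) (k # ks) series_one M =
        (\<Sum>A | A \<subseteq># M. if size A = k then int (fillings ks (M - A)) else 0)"
      unfolding foldr_Cons o_apply series_times_def Cons.IH h_sym1_eq by (intro sum.cong) auto
    also have "\<dots> = int (fillings (k # ks) M)"
      using finite_subset_mset[of M "\<lambda>_. True"] by (simp add: sum.If_cases Int_def conj_commute)
    finally show ?case .
  qed (simp add: series_one_def)
  then show ?thesis by (simp add: h_sym_def)
qed

lemma fillings_eq_0: "size M \<noteq> sum_list ks \<Longrightarrow> fillings ks M = 0"
proof (induction ks arbitrary: M)
  case (Cons k ks)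
  have "fillings ks (M - A) = 0" if "A \<subseteq># M" "size A = k" for A
    using Cons.prems that size_mset_mono[OF that(1)] by (intro Cons.IH) (auto simp: size_Diff_submset)
  then show ?case by (auto intro!: sum.neutral)
qed simp

section \<open>Fillings depend only on multiplicities\<close>

lemma submsets_image_mset:
  assumes "inj_on f (set_mset M)"
  shows "{B. B \<subseteq># image_mset f M} = image_mset f ` {A. A \<subseteq># M}"
proof -
  have "\<exists>A. A \<subseteq># M \<and> B = image_mset f A" if B: "B \<subseteq># image_mset f M" for B
  proof -
    obtain D where "image_mset f M = B + D" using B unfolding mset_subset_eq_exists_conv by blast
    then obtain A A' where "M = A + A'" "B = image_mset f A"
      using image_mset_eq_plusD by blast
    then show ?thesis by (intro exI[of _ A]) simp
  qed
  then show ?thesis by (auto intro: image_mset_subseteq_mono)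
qed

lemma inj_on_image_mset_submsets:
  assumes "inj_on f (set_mset M)"
  shows "inj_on (image_mset f) {A. A \<subseteq># M}"
proof (rule inj_onI)
  fix A B assume *: "A \<in> {A. A \<subseteq># M}" "B \<in> {A. A \<subseteq># M}" "image_mset f A = image_mset f B"
  define g where "g = the_inv_into (set_mset M) f"
  have "image_mset g (image_mset f A) = A" if "A \<subseteq># M" for A
    using that the_inv_into_f_f[OF assms] set_mset_mono[OF that]
    by (auto simp: multiset.map_comp g_def o_def intro!: multiset.map_ident_strong)
  then show "A = B" using * by (metis mem_Collect_eq)
qed

lemma fillings_image_mset:
  "inj_on f (set_mset M) \<Longrightarrow> fillings ks (image_mset f M) = fillings ks M"
proof (induction ks arbitrary: M)
  case (Cons k ks)
  have "{B. B \<subseteq># image_mset f M \<and> size B = k} = image_mset f ` {A. A \<subseteq># M \<and> size A = k}"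
    using submsets_image_mset[OF Cons.prems] by (auto simp: set_eq_iff image_iff)
  moreover have "inj_on (image_mset f) {A. A \<subseteq># M \<and> size A = k}"
    by (rule inj_on_subset[OF inj_on_image_mset_submsets[OF Cons.prems]]) auto
  ultimately have "fillings (k # ks) (image_mset f M) =
      (\<Sum>A | A \<subseteq># M \<and> size A = k. fillings ks (image_mset f M - image_mset f A))"
    by (simp add: sum.reindex)
  also have "\<dots> = (\<Sum>A | A \<subseteq># M \<and> size A = k. fillings ks (M - A))"
  proof (rule sum.cong[OF refl])
    fix A assume "A \<in> {A. A \<subseteq># M \<and> size A = k}"
    then have "image_mset f M - image_mset f A = image_mset f (M - A)"
      by (simp add: image_mset_Diff)
    then show "fillings ks (image_mset f M - image_mset f A) = fillings ks (M - A)"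
      using Cons.IH[of "M - A"] inj_on_subset[OF Cons.prems] by (metis in_diffD subsetI)
  qed
  finally show ?case by simp
qed simp

text \<open>The partition formed by the multiplicities, that is, by the exponents of a monomial;
  \<open>m_sym mu\<close> collects the monomials with profile \<open>mu\<close>.\<close>

definition profile :: "'a multiset \<Rightarrow> nat multiset" where
  "profile M = image_mset (count M) (mset_set (set_mset M))"

text \<open>Elements are matched one at a time. This turns equality of profiles into a relabelling
  of the underlying sets that keeps multiplicities.\<close>

lemma image_mset_eq_bij:
  assumes "finite A" "finite B" "image_mset f (mset_set A) = image_mset g (mset_set B)"
  shows "\<exists>h. bij_betw h A B \<and> (\<forall>a\<in>A. g (h a) = f a)"
  using assms
proof (induction A arbitrary: B rule: finite_induct)
  case empty
  then show ?case by (auto simp: bij_betw_def mset_set_empty_iff)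
next
  case (insert a A)
  then have "f a \<in># image_mset g (mset_set B)"
    by (metis image_mset_add_mset mset_set.insert union_single_eq_member)
  then obtain b where b: "b \<in> B" "g b = f a" using insert.prems(1) by auto
  have "image_mset f (mset_set A) = image_mset g (mset_set (B - {b}))"
    using insert b by (simp add: mset_set_Diff image_mset_Diff) (metis add_mset_remove_trivial)
  then obtain h where h: "bij_betw h A (B - {b})" "\<forall>a\<in>A. g (h a) = f a"
    using insert.IH[of "B - {b}"] insert.prems by auto
  have "bij_betw (h(a := b)) A (B - {b})"
    using h(1) insert.hyps by (subst bij_betw_cong[of _ _ h]) auto
  then have "bij_betw (h(a := b)) ({a} \<union> A) ({b} \<union> (B - {b}))"
    by (intro bij_betw_combine) (auto simp: bij_betw_def)
  then have "bij_betw (h(a := b)) (insert a A) B" using b by (simp add: insert_absorb)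
  moreover have "\<forall>a'\<in>insert a A. g ((h(a := b)) a') = f a'" using h(2) b(2) insert.hyps by auto
  ultimately show ?case by blast
qed

text \<open>Two element types are allowed because fibres concern multisets of complex numbers,
  whereas monomials are multisets of indices of variables.\<close>

lemma fillings_cong_profile:
  fixes M :: "'a multiset" and M' :: "'b multiset"
  assumes "profile M = profile M'"
  shows "fillings ks M = fillings ks M'"
proof -
  obtain h where h: "bij_betw h (set_mset M) (set_mset M')" "\<forall>a\<in>set_mset M. count M' (h a) = count M a"
    using image_mset_eq_bij[OF finite_set_mset finite_set_mset assms[unfolded profile_def]] by blast
  have "image_mset h M = M'"
  proof (rule multiset_eqI)
    fix b
    show "count (image_mset h M) b = count M' b"
    proof (cases "b \<in># M'")
      case True
      then obtain a where a: "a \<in># M" "b = h a" using h(1) by (auto simp: bij_betw_def)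
      then have "h -` {b} \<inter> set_mset M = {a}"
        using h(1) by (auto simp: bij_betw_def inj_on_def)
      then show ?thesis using h(2) a by (simp add: count_image_mset)
    next
      case False
      then have "b \<notin># image_mset h M" using h(1) by (auto simp: bij_betw_def)
      then show ?thesis using False by (metis not_in_iff)
    qed
  qed
  then show ?thesis using fillings_image_mset[of h M ks] h(1) by (auto simp: bij_betw_def)
qed

text \<open>Distinct \<open>z i\<close> keep the blocks apart, and as no part is 0 every block
  contributes a point to the support.\<close>

lemma profile_collision:
  assumes "mset ms = mu" "0 \<notin># mu" "inj_on z {..<length ms}"
  shows "profile (\<Sum>i<length ms. replicate_mset (ms ! i) (z i)) = mu"
proof -
  let ?y = "\<Sum>i<length ms. replicate_mset (ms ! i) (z i)"
  have cnt: "count ?y (z i) = ms ! i" if "i < length ms" for i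
  proof -
    have "count (replicate_mset (ms ! j) (z j)) (z i) = (if j = i then ms ! j else 0)"
      if "j < length ms" for j
      using inj_on_eq_iff[OF assms(3), of j i] that \<open>i < length ms\<close> by auto
    then show ?thesis using that by (simp add: count_sum)
  qed
  have pos: "ms ! i > 0" if "i < length ms" for i
    using assms(1,2) nth_mem[OF that] by (metis gr0I set_mset_mset)
  have "set_mset ?y = z ` {..<length ms}"
    using pos by (auto simp: set_mset_sum split: if_splits)
  then have "profile ?y = image_mset (\<lambda>i. count ?y (z i)) (mset_set {..<length ms})"
    using assms(3) by (simp add: profile_def image_mset_mset_set[symmetric] multiset.map_comp o_def)
  also have "\<dots> = image_mset (\<lambda>i. ms ! i) (mset_set {..<length ms})"
    using cnt by (intro image_mset_cong) auto
  also have "\<dots> = mset (map (\<lambda>i. ms ! i) [0..<length ms])"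
    by (simp add: lessThan_atLeast0 flip: mset_upt)
  finally show ?thesis using assms(1) by (simp add: map_nth)
qed

section \<open>Coefficients in the monomial symmetric functions\<close>

lemma partition_of_profile: "partition_of (profile M) (size M)"
  by (auto simp: partition_of_def profile_def size_multiset_overloaded_eq sum_unfold_sum_mset count_eq_zero_iff)

lemma finite_partitions: "finite {mu. partition_of mu n}"
proof (rule finite_subset)
  show "{mu. partition_of mu n} \<subseteq> mset ` {xs. set xs \<subseteq> {..n} \<and> length xs \<le> n}"
  proof
    fix mu assume "mu \<in> {mu. partition_of mu n}"
    then have mu: "0 \<notin># mu" "sum_mset mu = n" by (auto simp: partition_of_def)
    obtain xs where xs: "mset xs = mu" using ex_mset by blast
    have "x \<le> n" if "x \<in># mu" for x
      using mu(2) that by (auto dest!: multi_member_split)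
    moreover have "size mu \<le> sum_mset mu"
      using mu(1) by (induction mu) (auto simp: Suc_le_eq intro: add_mono)
    ultimately show "mu \<in> mset ` {xs. set xs \<subseteq> {..n} \<and> length xs \<le> n}"
      using xs mu(2) by (auto simp: image_iff intro!: exI[of _ xs])
  qed
  show "finite (mset ` {xs. set xs \<subseteq> {..n} \<and> length xs \<le> n})"
    by (intro finite_imageI finite_lists_length_le) simp
qed

lemma ex_profile:
  assumes "0 \<notin># mu"
  obtains M :: "nat multiset" where "profile M = mu"
proof -
  obtain ms where ms: "mset ms = mu" using ex_mset by blast
  have "profile (\<Sum>i<length ms. replicate_mset (ms ! i) i) = mu"
    using profile_collision[OF ms assms, of "\<lambda>i. i"] by simp
  then show ?thesis by (rule that)
qed

text \<open>The coefficient of \<open>m_sym mu\<close> is read off at any monomial whose exponents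
  form \<open>mu\<close>, as no other monomial symmetric function contains it. This yields both
  existence and uniqueness of the family that \<open>hm_coeff\<close> describes.\<close>

lemma hm_coeff_fillings:
  fixes M :: "'a multiset"
  assumes mu: "partition_of mu (sum_mset lam)" and M: "profile M = mu"
  shows "hm_coeff lam mu = int (fillings (sorted_list_of_multiset lam) M)"
proof -
  let ?n = "sum_mset lam" and ?ks = "sorted_list_of_multiset lam"
  let ?P = "\<lambda>N. (\<forall>mu. \<not> partition_of mu ?n \<longrightarrow> N mu = 0) \<and>
     h_sym lam = (\<lambda>M. \<Sum>mu | partition_of mu ?n. N mu * m_sym mu M)"
  define R where "R mu = (SOME M :: nat multiset. profile M = mu)" for mu
  have R: "profile (R mu) = mu" if "partition_of mu ?n" for mu
    unfolding R_def by (rule someI_ex) (use ex_profile that in \<open>auto simp: partition_of_def\<close>)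
  define N where "N mu = (if partition_of mu ?n then int (fillings ?ks (R mu)) else 0)" for mu
  have sum: "(\<Sum>mu | partition_of mu ?n. N mu * m_sym mu M) = (if size M = ?n then N (profile M) else 0)"
    if "\<forall>mu. \<not> partition_of mu ?n \<longrightarrow> N mu = 0" for N and M :: "nat multiset"
  proof -
    have "(\<Sum>mu | partition_of mu ?n. N mu * m_sym mu M) =
        (\<Sum>mu | partition_of mu ?n. if mu = profile M then N mu else 0)"
      by (intro sum.cong) (auto simp: m_sym_def profile_def)
    also have "\<dots> = (if partition_of (profile M) ?n then N (profile M) else 0)"
      using finite_partitions by (simp add: sum.delta)
    also have "partition_of (profile M) ?n \<longleftrightarrow> size M = ?n"
      using partition_of_profile[of M] by (auto simp: partition_of_def)
    finally show ?thesis .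
  qed
  have N0: "\<forall>mu. \<not> partition_of mu ?n \<longrightarrow> N mu = 0" by (simp add: N_def)
  have "?P N"
  proof (intro conjI ext)
    fix M :: "nat multiset"
    show "h_sym lam M = (\<Sum>mu | partition_of mu ?n. N mu * m_sym mu M)"
    proof (cases "size M = ?n")
      case True
      then have "partition_of (profile M) ?n" using partition_of_profile[of M] by simp
      then have "fillings ?ks M = fillings ?ks (R (profile M))" "N (profile M) = int (fillings ?ks (R (profile M)))"
        using fillings_cong_profile[of M "R (profile M)"] R by (simp_all add: N_def)
      then show ?thesis
        using True sum[OF N0, of M] by (simp add: h_sym_fillings)
    next
      case False
      have "sum_list ?ks = ?n" by (metis mset_sorted_list_of_multiset sum_mset_sum_list)
      then show ?thesis using False by (simp add: sum[OF N0] h_sym_fillings fillings_eq_0)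
    qed
  qed (use N0 in auto)
  moreover have "N' = N" if N': "?P N'" for N'
  proof
    fix mu
    show "N' mu = N mu"
    proof (cases "partition_of mu ?n")
      case True
      have "size (R mu) = ?n"
        using partition_of_profile[of "R mu"] R[OF True] True by (simp add: partition_of_def)
      then have "N' mu = h_sym lam (R mu)" "N mu = h_sym lam (R mu)"
        using sum[of N' "R mu"] sum[of N "R mu"] N0 R[OF True]
          fun_cong[OF conjunct2[OF N'], of "R mu"] fun_cong[OF conjunct2[OF \<open>?P N\<close>], of "R mu"]
          conjunct1[OF N'] by simp_all
      then show ?thesis by simp
    qed (use N' N0 in auto)
  qed
  ultimately have "hm_coeff lam = N" unfolding hm_coeff_def by (rule the_equality)
  then show ?thesis using mu fillings_cong_profile[of "R mu" M ?ks] R[OF mu] M by (simp add: N_def)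
qed

text \<open>Recursion on the points: the value at the first point is the first summand, and the rest
  distributes the remainder. Requiring size 0 off the list makes \<open>Y\<close> determined by its
  values on it.\<close>

lemma card_distributions_fillings:
  fixes wt :: "'a \<Rightarrow> nat" and y :: "'b multiset"
  assumes "distinct xs"
  defines "D \<equiv> \<lambda>xs y. {Y. (\<forall>x. size (Y x :: 'b multiset) = (if x \<in> set xs then wt x else 0)) \<and>
    (\<Sum>x\<in>set xs. Y x) = y}"
  shows "finite (D xs y) \<and> card (D xs y) = fillings (map wt xs) y"
  using assms(1)
proof (induction xs arbitrary: y)
  case Nil
  have "D [] y = (if y = {#} then {\<lambda>_. {#}} else {})" by (auto simp: D_def)
  then show ?case by simp
next
  case (Cons x xs)
  let ?S = "{A. A \<subseteq># y \<and> size A = wt x}"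
  have bij: "bij_betw (\<lambda>(A, Y). Y(x := A)) (SIGMA A:?S. D xs (y - A)) (D (x # xs) y)"
  proof (rule bij_betw_byWitness[where f' = "\<lambda>Y. (Y x, Y(x := {#}))"])
    have sum_upd: "(\<Sum>v\<in>set xs. (Y(x := A)) v) = (\<Sum>v\<in>set xs. Y v)" for Y :: "_ \<Rightarrow> 'b multiset" and A
      using Cons.prems by (intro sum.cong) auto
    show "\<forall>a\<in>SIGMA A:?S. D xs (y - A). (\<lambda>Y. (Y x, Y(x := {#}))) ((\<lambda>(A, Y). Y(x := A)) a) = a"
      using Cons.prems by (auto simp: D_def fun_eq_iff)
    show "\<forall>Y\<in>D (x # xs) y. (\<lambda>(A, Y). Y(x := A)) (Y x, Y(x := {#})) = Y" by auto
    show "(\<lambda>(A, Y). Y(x := A)) ` (SIGMA A:?S. D xs (y - A)) \<subseteq> D (x # xs) y"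
      using Cons.prems sum_upd by (auto simp: D_def)
    show "(\<lambda>Y. (Y x, Y(x := {#}))) ` D (x # xs) y \<subseteq> (SIGMA A:?S. D xs (y - A))"
      using Cons.prems sum_upd by (auto simp: D_def)
  qed
  have fin: "finite ?S" by (rule finite_subset_mset)
  have IH: "finite (D xs y)" "card (D xs y) = fillings (map wt xs) y" for y
    using Cons by auto
  have "finite (SIGMA A:?S. D xs (y - A))" using fin IH by blast
  then show ?case
    using bij_betw_finite[OF bij] bij_betw_same_card[OF bij] fin IH by simp
qed

theorem card_distributions:
  fixes wt :: "'a \<Rightarrow> nat" and y :: "complex multiset"
  assumes "finite X" "lam = image_mset wt (mset_set X)" "partition_of mu (sum_mset lam)"
    and "y \<in> collision_stratum mu"
  defines "D \<equiv> {Y. (\<forall>x. size (Y x) = (if x \<in> X then wt x else 0)) \<and> (\<Sum>x\<in>X. Y x) = y}"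
  shows "finite D \<and> int (card D) = hm_coeff lam mu"
proof -
  obtain xs0 where xs0: "set xs0 = X" "distinct xs0" using finite_distinct_list[OF assms(1)] by blast
  \<comment> \<open>Ordering the points by weight makes \<open>map wt xs\<close> the very list over
    which \<open>h_sym\<close> multiplies, so symmetry of \<open>fillings\<close> in the sizes is
    never invoked.\<close>
  define xs where "xs = sort_key wt xs0"
  have xs: "set xs = X" "distinct xs" using xs0 by (auto simp: xs_def)
  have "mset xs = mset_set X" using xs by (metis mset_set_set)
  then have "sorted_list_of_multiset lam = sort (map wt xs)"
    using assms(2) by (metis mset_map sorted_list_of_multiset_mset)
  also have "\<dots> = map wt xs" by (simp add: xs_def sorted_sort_id)
  finally have eq: "sorted_list_of_multiset lam = map wt xs" .
  have "profile y = mu"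
    using assms(3,4) profile_collision by (auto simp: collision_stratum_def partition_of_def)
  then have "hm_coeff lam mu = int (fillings (map wt xs) y)"
    using hm_coeff_fillings[OF assms(3)] eq by metis
  then show ?thesis
    using card_distributions_fillings[OF xs(2), of wt y] by (simp add: D_def xs(1))
qed

section \<open>Subschemes flowing to a generic fixed point\<close>

text \<open>\<open>V\<close> is a union of whole lines, so rescaling keeps it, and the pullback in
  the definition of \<open>act\<close> undoes the division by \<open>s\<close>.\<close>

lemma ideal_sections_act:
  assumes V: "V \<subseteq> cyl C" "\<And>x z z'. (x, z) \<in> V \<Longrightarrow> (x, z') \<in> V"
    and f: "f \<in> ideal_sections C Z V" and s: "s \<noteq> 0"
  shows "(\<lambda>(y, w). f (y, w / s)) \<in> ideal_sections C (act C s Z) V"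
proof -
  have "(\<lambda>(y, w). f (y, w / s)) \<in> cyl_germs C P \<and> (\<lambda>(y, w). f (y, w / s)) \<in> act C s Z P"
    if P: "P \<in> V" for P
  proof -
    obtain x z where xz: "P = (x, z)" by fastforce
    have x: "x \<in> C" using P V(1) xz by auto
    have "(x, z / s) \<in> V" using P V(2) xz by blast
    then have fz: "f \<in> cyl_germs C (x, 1 / s * z)" "f \<in> Z (x, z / s)"
      using f by (auto simp: ideal_sections_def sections_def)
    show ?thesis
      using cyl_germs_rescale[OF fz(1)] fz(2) s x by (simp add: xz act_apply)
  qed
  then show ?thesis by (simp add: ideal_sections_def sections_def)
qed

text \<open>A chart around \<open>p\<close>: with Lagrange forms \<open>E\<^sub>x\<close> for the finite set \<open>X\<close>, the quotients of the \<open>E\<^sub>x\<close>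
  by their sum restrict to the indicator functions of the points of \<open>X\<close>, and their products with
  powers of the coordinate of the affine line form a basis of the functions on \<open>p\<close>.\<close>

definition chart_denom :: "'n::finite proj set \<Rightarrow> ('n proj \<Rightarrow> complex ^ 'n \<Rightarrow> complex) \<Rightarrow> complex ^ 'n \<Rightarrow> complex" where
  "chart_denom X E v = (\<Sum>x\<in>X. E x v)"

definition chart_open :: "'n::finite proj set \<Rightarrow> 'n proj set \<Rightarrow> ('n proj \<Rightarrow> complex ^ 'n \<Rightarrow> complex) \<Rightarrow>
    ('n proj \<times> complex) set" where
  "chart_open C X E = {(y, w). y \<in> C \<and> chart_denom X E (hcoords y) \<noteq> 0}"

definition chart_basis :: "'n::finite proj set \<Rightarrow> ('n proj \<Rightarrow> complex ^ 'n \<Rightarrow> complex) \<Rightarrow>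
    (nat \<Rightarrow> 'n proj \<times> nat) \<Rightarrow> nat \<Rightarrow> 'n proj \<times> complex \<Rightarrow> complex" where
  "chart_basis X E h a = (\<lambda>(y, w). E (fst (h a)) (hcoords y) / chart_denom X E (hcoords y) * w ^ snd (h a))"

section \<open>The chart around the fixed point\<close>

context
  fixes C X :: "'n::finite proj set" and wt :: "'n proj \<Rightarrow> nat" and n :: nat
    and h :: "nat \<Rightarrow> 'n proj \<times> nat" and E :: "'n proj \<Rightarrow> complex ^ 'n \<Rightarrow> complex"
  assumes X: "finite X" "X \<subseteq> C" and wt: "\<And>x. x \<in> X \<longleftrightarrow> wt x \<noteq> 0"
    and n: "(\<Sum>x\<in>X. wt x) = n" and n_pos: "n > 0"
    and h: "bij_betw h {..<n} (SIGMA x:X. {..<wt x})"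
    and E_form: "\<forall>x\<in>X. hom_form (card X) (E x)" and E_nz: "\<forall>x\<in>X. E x (hcoords x) \<noteq> 0"
    and E_zero: "\<forall>x\<in>X. \<forall>y\<in>X. x \<noteq> y \<longrightarrow> E x (hcoords y) = 0"
begin

private abbreviation "L \<equiv> chart_denom X E"
private abbreviation "V \<equiv> chart_open C X E"
private abbreviation "b \<equiv> chart_basis X E h"
private abbreviation "p \<equiv> vertical_subscheme C (\<lambda>x. replicate_mset (wt x) 0)"

private lemma X_pos: "card X > 0"
proof -
  have "X \<noteq> {}" using n n_pos by auto
  then show ?thesis using X by (simp add: card_gt_0_iff)
qed

lemma denom_form: "hom_form (card X) L"
  unfolding chart_denom_def[abs_def] using E_form by (intro hom_form_sum) auto

lemma denom_at: "x \<in> X \<Longrightarrow> L (hcoords x) = E x (hcoords x)"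
proof -
  assume x: "x \<in> X"
  have "L (hcoords x) = (\<Sum>y\<in>X. if y = x then E x (hcoords x) else 0)"
    unfolding chart_denom_def using E_zero x by (intro sum.cong) auto
  then show ?thesis using x X by simp
qed

lemma denom_nz: "x \<in> X \<Longrightarrow> L (hcoords x) \<noteq> 0"
  using denom_at E_nz by simp

lemma lagrange_at: "x \<in> X \<Longrightarrow> y \<in> X \<Longrightarrow> E x (hcoords y) / L (hcoords y) = of_bool (x = y)"
  using denom_at[of y] denom_nz[of y] E_zero by auto

lemma mem_chart_open: "(y, w) \<in> V \<longleftrightarrow> y \<in> C \<and> L (hcoords y) \<noteq> 0"
  by (simp add: chart_open_def)

lemma chart_open_subset: "V \<subseteq> cyl C"
  by (auto simp: chart_open_def)

lemma X_chart_open: "x \<in> X \<Longrightarrow> (x, z) \<in> V"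
  using X denom_nz by (auto simp: mem_chart_open)

lemma zariski_chart_open: "zariski_open cyl_ratios (cyl C) V"
  unfolding zariski_open_def
proof (intro conjI ballI chart_open_subset)
  fix P assume P: "P \<in> V"
  have "((\<lambda>(x, z). L (hcoords x)), (\<lambda>(x, z). L (hcoords x))) \<in> cyl_ratios"
    unfolding cyl_ratios_def mem_Collect_eq
    by (intro exI[of _ "\<lambda>v z. L v"] exI[of _ "card X"] conjI refl cyl_form_hom denom_form)
  then show "\<exists>(F, G)\<in>cyl_ratios. G P \<noteq> 0 \<and> {Q \<in> cyl C. G Q \<noteq> 0} \<subseteq> V"
    by (rule bexI[rotated]) (use P in \<open>auto simp: chart_open_def\<close>)
qed

text \<open>Powers of the denominator are allowed so that germs with denominators of any degree can
  be turned into sections, as in \<open>max_ideal_mem\<close>.\<close>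

lemma chart_section:
  assumes "hom_form (card X * k) F"
  shows "(\<lambda>(y, w). F (hcoords y) / L (hcoords y) ^ k * w ^ i) \<in> cyl_sections C V"
  unfolding sections_def mem_Collect_eq
proof
  fix P assume P: "P \<in> V"
  obtain x z where xz: "P = (x, z)" by fastforce
  show "(\<lambda>(y, w). F (hcoords y) / L (hcoords y) ^ k * w ^ i) \<in> cyl_germs C P"
    unfolding xz
    by (rule cyl_germI[OF cyl_form_monomial[OF assms, of i] cyl_form_hom[OF hom_form_power[OF denom_form, of k]]])
      (use P in \<open>auto simp: xz mem_chart_open\<close>)
qed

private lemma index: "a < n \<Longrightarrow> fst (h a) \<in> X" "a < n \<Longrightarrow> snd (h a) < wt (fst (h a))"
  using bij_betw_apply[OF h, of a] by auto

lemma chart_basis_section: "a < n \<Longrightarrow> b a \<in> cyl_sections C V"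
  using chart_section[of 1 "E (fst (h a))" "snd (h a)"] E_form index(1)[of a] by (simp add: chart_basis_def)

text \<open>At \<open>t = 0\<close> the Newton coefficients of the basis elements are Taylor
  coefficients on the lines, and \<open>E x / L\<close> restricts to an indicator function on
  \<open>X\<close>. Hence the functionals are dual to the chart basis and the matrix to invert is
  the identity.\<close>

lemma fixed_in_chart: "p \<in> Hilb_chart C n V b"
proof -
  let ?ys = "\<lambda>x. replicate (wt x) (0::complex)"
  let ?R = "cyl_sections C V"
  have wt0: "\<forall>x. x \<notin> X \<longrightarrow> wt x = 0" using wt by blast
  have XV: "\<forall>x\<in>X. (x, 0) \<in> V" using X_chart_open by blast
  have sz: "size (replicate_mset (wt x) (0::complex)) = wt x" for x by simp
  have ys: "mset (?ys x) = replicate_mset (wt x) 0" for x by simp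
  note ctx = X wt0 h zariski_chart_open XV sz ys
  have good: "\<forall>x\<in>X. set (map ((*) 0) (?ys x)) \<subseteq> {z. (x, z) \<in> V}" using XV by auto
  have I: "ideal_sections C p V = {f \<in> ?R. \<forall>a<n. node_coeff V ?ys h 0 a f = 0}"
    using ideal_sections_nodes[OF ctx good] by simp
  have T: "node_coeff V ?ys h 0 a (b j) = of_bool (a = j)" if a: "a < n" and j: "j < n" for a j
  proof -
    let ?x = "fst (h a)" and ?i = "snd (h a)" and ?j = "snd (h j)"
    let ?c = "of_bool (fst (h j) = ?x) :: complex"
    let ?S = "{z. (?x, z) \<in> V}"
    have "b j (?x, z) = ?c * z ^ ?j" for z
      by (simp only: chart_basis_def prod.case lagrange_at[OF index(1)[OF j] index(1)[OF a]])
    then have rep: "represents ?S (\<lambda>z. b j (?x, z)) (monom ?c ?j) 1"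
      by (simp add: represents_def poly_monom)
    have "infinite ?S"
      using cofinite_complex(1)[OF zariski_open_line[OF zariski_chart_open]] X_chart_open[OF index(1)[OF a]] .
    moreover have "set (replicate (wt ?x) 0) \<subseteq> ?S" using X_chart_open[OF index(1)[OF a]] by auto
    ultimately have "newton_coeffs ?S (replicate (wt ?x) 0) (\<lambda>z. b j (?x, z)) =
        newton 1 (replicate (wt ?x) 0) (monom ?c ?j)"
      using rep by (rule newton_coeffs_eq)
    then have "node_coeff V ?ys h 0 a (b j) = coeff (monom ?c ?j) ?i"
      using newton_zeros[OF index(2)[OF a], of "monom ?c ?j"] by (simp add: node_coeff_def)
    also have "\<dots> = of_bool (h a = h j)" by (auto simp: prod_eq_iff)
    also have "h a = h j \<longleftrightarrow> a = j" using h a j by (auto simp: bij_betw_def inj_on_def)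
    finally show ?thesis .
  qed
  have "basis_mod ?R {f \<in> ?R. \<forall>a<n. node_coeff V ?ys h 0 a f = 0} n b"
  proof (rule basis_modI(1)[where N = "\<lambda>i j. of_bool (i = j)"])
    show "node_coeff V ?ys h 0 a (\<lambda>Q. f Q - (\<Sum>i<n. c i * b i Q)) =
        node_coeff V ?ys h 0 a f - (\<Sum>i<n. c i * node_coeff V ?ys h 0 a (b i))"
      if "a < n" "f \<in> ?R" for a f c
      by (rule node_coeff_lincomb[OF ctx good that chart_basis_section])
    show "(\<lambda>Q. f Q - (\<Sum>i<n. c i * b i Q)) \<in> ?R" if "f \<in> ?R" for f c
      by (rule sections_lincomb[OF that chart_basis_section])
    show "(\<Sum>k<n. of_bool (i = k) * node_coeff V ?ys h 0 k (b j)) = of_bool (i = j)"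
      if "i < n" "j < n" for i j
    proof -
      have "(\<Sum>k<n. of_bool (i = k) * node_coeff V ?ys h 0 k (b j)) =
          (\<Sum>k<n. if i = k then of_bool (k = j) else 0)"
        using T that by (intro sum.cong) auto
      then show ?thesis using that by simp
    qed
    show "(\<Sum>k<n. node_coeff V ?ys h 0 i (b k) * of_bool (k = j)) = of_bool (i = j)"
      if "i < n" "j < n" for i j
    proof -
      have "(\<Sum>k<n. node_coeff V ?ys h 0 i (b k) * of_bool (k = j)) =
          (\<Sum>k<n. if k = j then of_bool (i = k) else 0)"
        using T that by (intro sum.cong) auto
      then show ?thesis using that by simp
    qed
  qed (rule chart_basis_section)
  moreover have "p \<in> Hilb C n"
    using vertical_in_Hilb[where Y = "\<lambda>x. replicate_mset (wt x) 0", OF X] wt n by simp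
  moreover have "support C p = (SIGMA x:X. set_mset (replicate_mset (wt x) 0))"
    by (rule support_vertical[OF X]) (use wt in auto)
  then have "support C p \<subseteq> V" using X_chart_open by (auto split: if_splits)
  ultimately show ?thesis by (simp add: Hilb_chart_def I)
qed

lemma chart_ideal_mem:
  assumes Z: "Z \<in> Hilb C n" and P: "(x, \<zeta>) \<in> V"
  shows "cyl_ideal C (x, \<zeta>) (Z (x, \<zeta>))"
  using Z P chart_open_subset by (auto simp: Hilb_def)

section \<open>Chart points whose ideal contains the curve functions vanishing on X\<close>

context
  fixes q
  assumes q: "q \<in> Hilb_chart C n V b"
    and van: "\<And>\<phi>. (\<lambda>(y, w). \<phi> y) \<in> cyl_sections C V \<Longrightarrow> \<forall>x\<in>X. \<phi> x = 0 \<Longrightarrow>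
      (\<lambda>(y, w). \<phi> y) \<in> ideal_sections C q V"
begin

lemma chart_ideal: "(x, \<zeta>) \<in> V \<Longrightarrow> cyl_ideal C (x, \<zeta>) (q (x, \<zeta>))"
  using q by (intro chart_ideal_mem) (simp_all add: Hilb_chart_def)

text \<open>A form vanishing on \<open>X\<close> but not at \<open>x\<close> gives a function from
  the curve that lies in the ideal and is a unit at \<open>x\<close>. Beyond the chart the support
  condition applies.\<close>

lemma ideal_outside:
  assumes x: "x \<in> C" "x \<notin> X"
  shows "q (x, \<zeta>) = cyl_germs C (x, \<zeta>)"
proof (cases "(x, \<zeta>) \<in> V")
  case True
  note I = chart_ideal[OF True]
  obtain F where F: "hom_form (card X) F" "F (hcoords x) \<noteq> 0" "\<And>y. y \<in> X \<Longrightarrow> F (hcoords y) = 0"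
    using separate_point_from_finite[OF X(1) x(2)] by blast
  have "(\<lambda>(y, w). F (hcoords y) / L (hcoords y)) \<in> ideal_sections C q V"
    using chart_section[of 1 F 0] F by (intro van) auto
  then have "(\<lambda>(y, w). F (hcoords y) / L (hcoords y)) \<in> q (x, \<zeta>)"
    using True by (auto simp: ideal_sections_def)
  then have "(\<lambda>_. 1) \<in> q (x, \<zeta>)"
    by (rule ideal_divide[OF I _ cyl_form_hom[OF F(1)] cyl_form_hom[OF denom_form]])
      (use F True in \<open>auto simp: mem_chart_open\<close>)
  then show ?thesis by (rule ideal_one[OF I])
next
  case False
  have "support C q \<subseteq> V" using q by (simp add: Hilb_chart_def)
  then show ?thesis using False x by (auto simp: support_def)
qed

text \<open>A germ \<open>A / B\<close> is controlled only near \<open>x\<close>, while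
  \<open>van\<close> needs a section over \<open>V\<close>. Multiplying by
  \<open>H / L ^ Suc d\<close>, where \<open>H\<close> is \<open>B ^ card X\<close> times
  \<open>E x\<close>, clears the denominator and kills the other points of \<open>X\<close>, and it
  is a unit at \<open>x\<close>; the exponents are chosen so that both forms have degree
  \<open>card X * Suc d\<close>.\<close>

lemma max_ideal_mem:
  assumes x: "x \<in> X" and g: "g \<in> max_ideal proj_ratios C x"
  shows "(\<lambda>(y, w). g y) \<in> q (x, \<zeta>)"
proof -
  have V: "(x, \<zeta>) \<in> V" by (rule X_chart_open[OF x])
  have xC: "x \<in> C" using x X by blast
  obtain d A B where g': "hom_form d A" "hom_form d B" "B (hcoords x) \<noteq> 0"
    "\<And>y. y \<in> C \<Longrightarrow> B (hcoords y) \<noteq> 0 \<Longrightarrow> g y = A (hcoords y) / B (hcoords y)"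
    using g proj_germE[of g C x] unfolding max_ideal_def by blast
  have A0: "A (hcoords x) = 0" using g g'(3,4) xC by (auto simp: max_ideal_def)
  obtain m where m: "card X = Suc m" using X_pos by (cases "card X") auto
  define F where "F v = A v * B v ^ m * E x v" for v
  define H where "H v = B v ^ Suc m * E x v" for v
  have Ex: "hom_form (card X) (E x)" using E_form x by blast
  have "hom_form (d + d * m + card X) F"
    unfolding F_def[abs_def] by (intro hom_form_mult hom_form_power g'(1,2) Ex)
  moreover have "d + d * m + card X = card X * Suc d" by (simp add: m algebra_simps)
  ultimately have F: "hom_form (card X * Suc d) F" by metis
  have "hom_form (d * Suc m + card X) H"
    unfolding H_def[abs_def] by (intro hom_form_mult hom_form_power g'(2) Ex)
  moreover have "d * Suc m + card X = card X * Suc d" by (simp add: m algebra_simps)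
  ultimately have H: "hom_form (card X * Suc d) H" by metis
  have "(\<lambda>(y, w). F (hcoords y) / L (hcoords y) ^ Suc d) \<in> ideal_sections C q V"
  proof (rule van)
    show "(\<lambda>(y, w). F (hcoords y) / L (hcoords y) ^ Suc d) \<in> cyl_sections C V"
      using chart_section[OF F, of 0] by simp
    show "\<forall>y\<in>X. F (hcoords y) / L (hcoords y) ^ Suc d = 0"
    proof
      fix y assume "y \<in> X"
      then show "F (hcoords y) / L (hcoords y) ^ Suc d = 0"
        using A0 E_zero x by (cases "y = x") (auto simp: F_def)
    qed
  qed
  then have "(\<lambda>(y, w). F (hcoords y) / L (hcoords y) ^ Suc d) \<in> q (x, \<zeta>)"
    using V by (auto simp: ideal_sections_def)
  then show ?thesis
  proof (rule ideal_divide[OF chart_ideal[OF V] _ cyl_form_hom[OF H] cyl_form_hom[OF hom_form_power[OF denom_form, of "Suc d"]]])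
    show "H (hcoords x) \<noteq> 0" using g'(3) E_nz x by (simp add: H_def)
    show "L (hcoords x) ^ Suc d \<noteq> 0" using denom_nz[OF x] by simp
    fix y w assume "y \<in> C" "H (hcoords y) \<noteq> 0"
    then show "(case (y, w) of (y, w) \<Rightarrow> F (hcoords y) / L (hcoords y) ^ Suc d) =
        (case (y, w) of (y, w) \<Rightarrow> g y) * (H (hcoords y) / L (hcoords y) ^ Suc d)"
      using g'(4)[of y] by (simp add: F_def H_def)
  qed
qed

text \<open>Expand the Lagrange quotient of \<open>x\<close> times \<open>w ^ wt x\<close> in the
  chart basis modulo the ideal of \<open>q\<close>. At \<open>x\<close> every Lagrange quotient is
  congruent to 0 or 1 modulo the maximal ideal, so besides the leading term only powers of
  \<open>w\<close> below \<open>wt x\<close> survive, and the relation becomes a monic polynomial.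
  It is the same for all \<open>\<zeta>\<close>, which is what bounds the total degree over
  \<open>x\<close>.\<close>

lemma monic_mem:
  assumes x: "x \<in> X"
  obtains P where "degree P = wt x" "P \<noteq> 0" "\<And>\<zeta>. (\<lambda>(y, w). poly P w) \<in> q (x, \<zeta>)"
proof -
  define e where "e x y = E x (hcoords y) / L (hcoords y)" for x y
  have e_max: "(\<lambda>y. e x' y - of_bool (x' = x)) \<in> max_ideal proj_ratios C x" if "x' \<in> X" for x'
  proof -
    have "(\<lambda>y. e x' y - of_bool (x' = x)) \<in> germs proj_ratios C x"
    proof (rule proj_germI[OF _ denom_form])
      show "hom_form (card X) (\<lambda>v. E x' v - of_bool (x' = x) * L v)"
        using E_form that denom_form by (intro hom_form_diff hom_form_scale) auto
    qed (use denom_nz[OF x] in \<open>auto simp: e_def field_simps\<close>)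
    then show ?thesis using lagrange_at[OF that x] by (simp add: max_ideal_def e_def)
  qed
  have "(\<lambda>(y, w). e x y * w ^ wt x) \<in> cyl_sections C V"
    using chart_section[of 1 "E x" "wt x"] E_form x by (simp add: e_def)
  then obtain c where c: "(\<lambda>Q. (\<lambda>(y, w). e x y * w ^ wt x) Q - (\<Sum>a<n. c a * b a Q)) \<in> ideal_sections C q V"
    using basis_mod_expand[of _ "ideal_sections C q V" n b] q unfolding Hilb_chart_def by blast
  define P where "P = monom 1 (wt x) - (\<Sum>a<n. monom (c a * of_bool (fst (h a) = x)) (snd (h a)))"
  have coeffP: "coeff P k = of_bool (k = wt x)" if "k \<ge> wt x" for k
  proof -
    have "coeff (monom (c a * of_bool (fst (h a) = x)) (snd (h a))) k = 0" if "a < n" for a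
      using index(2)[OF that] \<open>k \<ge> wt x\<close> by (auto simp: coeff_monom)
    then show ?thesis by (auto simp: P_def coeff_sum coeff_monom)
  qed
  then have "degree P = wt x"
    by (intro antisym degree_le le_degree) (auto simp: coeffP)
  moreover have "P \<noteq> 0" using coeffP[of "wt x"] by auto
  moreover have "(\<lambda>(y, w). poly P w) \<in> q (x, \<zeta>)" for \<zeta>
  proof -
    have V: "(x, \<zeta>) \<in> V" by (rule X_chart_open[OF x])
    note I = chart_ideal[OF V]
    have em: "(\<lambda>(y, w). (e x' y - of_bool (x' = x)) * w ^ k) \<in> q (x, \<zeta>)" if "x' \<in> X" for x' k
    proof -
      have "(\<lambda>Q. (\<lambda>(y, w). poly (monom 1 k) w) Q * (\<lambda>(y, w). e x' y - of_bool (x' = x)) Q) \<in> q (x, \<zeta>)"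
        by (rule ideal_mult[OF I cyl_germs_poly max_ideal_mem[OF x e_max[OF that]]])
      then show ?thesis by (simp add: case_prod_unfold poly_monom mult.commute)
    qed
    have 1: "(\<lambda>Q. (\<lambda>(y, w). e x y * w ^ wt x) Q - (\<Sum>a<n. c a * b a Q)) \<in> q (x, \<zeta>)"
      using c V by (auto simp: ideal_sections_def)
    have 2: "(\<lambda>Q. \<Sum>a<n. c a * (\<lambda>(y, w). (e (fst (h a)) y - of_bool (fst (h a) = x)) * w ^ snd (h a)) Q) \<in> q (x, \<zeta>)"
      by (intro ideal_sum[OF I] ideal_scale[OF I] em index) simp
    \<comment> \<open>The two corrections replace the Lagrange quotients, in the sum and in the
      leading term, by their values at \<open>x\<close>.\<close>
    note ideal_diff[OF I ideal_add[OF I 1 2] em[OF x, of "wt x"]]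
    also have "(\<lambda>Q. (\<lambda>(y, w). e x y * w ^ wt x) Q - (\<Sum>a<n. c a * b a Q) +
        (\<Sum>a<n. c a * (\<lambda>(y, w). (e (fst (h a)) y - of_bool (fst (h a) = x)) * w ^ snd (h a)) Q) -
        (\<lambda>(y, w). (e x y - of_bool (x = x)) * w ^ wt x) Q) = (\<lambda>(y, w). poly P w)"
      by (auto simp: fun_eq_iff P_def poly_sum poly_monom chart_basis_def e_def algebra_simps
          sum_subtractf sum.distrib)
    finally show ?thesis .
  qed
  ultimately show thesis by (rule that)
qed

text \<open>Over a point of \<open>X\<close> each stalk contains the line ideal given by the order
  of the polynomial from \<open>monic_mem\<close>, so it is a line ideal of at most that exponent,
  and the degree over \<open>x\<close> is at most \<open>wt x\<close>. The lengths add up to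
  \<open>n\<close>, the sum of the \<open>wt x\<close>, so no bound is strict.\<close>

lemma vertical_of_chart:
  obtains Y where "\<And>x. size (Y x) = wt x" "q = vertical_subscheme C Y"
proof -
  have "\<exists>M. size M \<le> wt x \<and> (\<forall>\<zeta>. q (x, \<zeta>) = line_ideal C x \<zeta> (count M \<zeta>))" if x: "x \<in> C" for x
  proof (cases "x \<in> X")
    case False
    then show ?thesis
      using ideal_outside[OF x] by (intro exI[of _ "{#}"]) (simp add: line_ideal_0[OF x])
  next
    case True
    obtain P where P: "degree P = wt x" "P \<noteq> 0" "\<And>\<zeta>. (\<lambda>(y, w). poly P w) \<in> q (x, \<zeta>)"
      using monic_mem[OF True] by blast
    have "\<exists>k\<le>count (proots P) \<zeta>. q (x, \<zeta>) = line_ideal C x \<zeta> k" for \<zeta>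
    proof -
      have V: "(x, \<zeta>) \<in> V" by (rule X_chart_open[OF True])
      note I = chart_ideal[OF V]
      let ?m = "order \<zeta> P"
      obtain r where r: "P = [:-\<zeta>, 1:] ^ ?m * r" "\<not> [:-\<zeta>, 1:] dvd r"
        using order_decomp[OF P(2)] by blast
      have rz: "poly r \<zeta> \<noteq> 0" using r(2) by (simp add: poly_eq_0_iff_dvd)
      have "(\<lambda>(y, w). (w - \<zeta>) ^ ?m) \<in> q (x, \<zeta>)"
      proof (rule ideal_divide[OF I P(3) cyl_form_poly cyl_form_const[of 1]])
        show "poly r \<zeta> \<noteq> 0" by (rule rz)
        have "poly P w = (w - \<zeta>) ^ ?m * poly r w" for w
          using arg_cong[OF r(1), of "\<lambda>p. poly p w"] by simp
        then show "(case (y, w) of (y, w) \<Rightarrow> poly P w) =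
            (case (y, w) of (y, w) \<Rightarrow> (w - \<zeta>) ^ ?m) * (poly r w / 1)" for y :: "'n proj" and w
          by simp
      qed simp
      from line_ideal_generated[OF x I max_ideal_mem[OF True] this]
      obtain k where "k \<le> ?m" "q (x, \<zeta>) = line_ideal C x \<zeta> k"
        using ideal_containing_line_ideal[OF x I] by blast
      then show ?thesis using P(2) by auto
    qed
    then obtain k where k: "\<And>\<zeta>. k \<zeta> \<le> count (proots P) \<zeta>" "\<And>\<zeta>. q (x, \<zeta>) = line_ideal C x \<zeta> (k \<zeta>)"
      by metis
    \<comment> \<open>The exponents \<open>k\<close> vanish off the roots of \<open>P\<close>, so a
      sum over the finitely many roots collects all of them.\<close>
    define M where "M = (\<Sum>\<zeta>\<in>set_mset (proots P). replicate_mset (k \<zeta>) \<zeta>)"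
    have M: "count M \<zeta> = k \<zeta>" for \<zeta>
      using k(1)[of \<zeta>] by (auto simp: M_def count_sum not_in_iff)
    then have "M \<subseteq># proots P" using k(1) by (simp add: subseteq_mset_def)
    then have "size M \<le> wt x" using size_mset_mono P(1) size_proots_complex by metis
    then show ?thesis using k(2) M by auto
  qed
  then obtain Y0 where Y0: "\<And>x. x \<in> C \<Longrightarrow> size (Y0 x) \<le> wt x"
    "\<And>x \<zeta>. x \<in> C \<Longrightarrow> q (x, \<zeta>) = line_ideal C x \<zeta> (count (Y0 x) \<zeta>)"
    by metis
  define Y where "Y x = (if x \<in> C then Y0 x else {#})" for x
  have qH: "q \<in> Hilb C n" using q by (simp add: Hilb_chart_def)
  have qY: "q = vertical_subscheme C Y"
  proof (rule extensionalityI[of _ "cyl C"])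
    show "q \<in> extensional (cyl C)" using qH by (auto simp: Hilb_def PiE_def)
    show "vertical_subscheme C Y \<in> extensional (cyl C)" by (simp add: vertical_subscheme_def)
    show "q P = vertical_subscheme C Y P" if "P \<in> cyl C" for P
      using that Y0(2) by (auto simp: vertical_subscheme_apply Y_def)
  qed
  have le: "size (Y x) \<le> wt x" for x using Y0(1) by (simp add: Y_def)
  have Y_out: "Y x = {#}" if "x \<notin> X" for x using le[of x] wt[of x] that by auto
  have "q \<in> Hilb C (\<Sum>x\<in>X. size (Y x))" unfolding qY by (rule vertical_in_Hilb[OF X Y_out])
  then have "(\<Sum>x\<in>X. size (Y x)) = (\<Sum>x\<in>X. wt x)" using qH n unfolding Hilb_def by simp
  then have "size (Y x) = wt x" if "x \<in> X" for x
    using sum_mono_inv[of "\<lambda>x. size (Y x)" X wt x] le that X by blast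
  then have "size (Y x) = wt x" for x
    using Y_out[of x] wt[of x] by (cases "x \<in> X") auto
  then show thesis using qY by (rule that)
qed

end

text \<open>Convergence places only the points of the orbit with small \<open>t\<close> in the
  chart. The analysis is therefore done for some \<open>q' = act C t0 q\<close> and undone by acting
  with \<open>1 / t0\<close>, which keeps subschemes vertical.\<close>

lemma flow_subset:
  assumes q: "q \<in> Hilb C n" and lim: "limitin (Hilb_topology C n) (\<lambda>t. act C t q) p (at 0)"
  obtains Y where "\<And>x. size (Y x) = wt x" "q = vertical_subscheme C Y"
proof -
  let ?R = "cyl_sections C V"
  let ?W = "\<lambda>f i U. {Z \<in> Hilb_chart C n V b. \<exists>c. c i \<in> U \<and>
    (\<lambda>Q. f Q - (\<Sum>j<n. c j * b j Q)) \<in> ideal_sections C Z V}"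
  have ev: "\<forall>\<^sub>F t in at 0. act C t q \<in> ?W f i U"
    if "f \<in> ?R" "i < n" "open U" "p \<in> ?W f i U" for f i U
  proof -
    have "openin (Hilb_topology C n) (?W f i U)"
      unfolding Hilb_topology_def
      by (rule topology_generated_by_Basis) (use that zariski_chart_open in blast)
    then show ?thesis using lim that(4) unfolding limitin_def by blast
  qed
  have p: "basis_mod ?R (ideal_sections C p V) n b" using fixed_in_chart by (simp add: Hilb_chart_def)
  \<comment> \<open>With \<open>f = 0\<close> and \<open>U = UNIV\<close> the generating open set is
    the whole chart; the coordinate index 0 is legitimate because \<open>n > 0\<close>.\<close>
  have "p \<in> ?W (\<lambda>_. 0) 0 UNIV"
    using fixed_in_chart basis_mod_expand[OF p sections_zero] by simp
  from ev[OF sections_zero n_pos open_UNIV this]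
  have ev_chart: "\<forall>\<^sub>F t in at 0. act C t q \<in> Hilb_chart C n V b" by (rule eventually_mono) simp
  moreover have "\<forall>\<^sub>F t in at (0::complex). t \<noteq> 0" by (simp add: eventually_at_filter)
  ultimately have "\<forall>\<^sub>F t in at 0. t \<noteq> 0 \<and> act C t q \<in> Hilb_chart C n V b" by eventually_elim simp
  then obtain t0 where t0: "t0 \<noteq> 0" "act C t0 q \<in> Hilb_chart C n V b"
    using eventually_happens'[OF at_neq_bot] by blast
  define q' where "q' = act C t0 q"
  have act_q: "act C t q = act C (t / t0) q'" for t
    using t0(1) by (simp add: q'_def act_act)
  \<comment> \<open>The coefficients of such a function at \<open>act C t q\<close> are those at \<open>q'\<close> divided by powers
    of \<open>t / t0\<close>, and they tend to the coefficients at \<open>p\<close>, which are 0; so they all vanish.\<close>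
  have van: "(\<lambda>(y, w). \<phi> y) \<in> ideal_sections C q' V"
    if sec: "(\<lambda>(y, w). \<phi> y) \<in> ?R" and zero: "\<forall>x\<in>X. \<phi> x = 0" for \<phi>
  proof -
    let ?f = "\<lambda>(y :: 'n proj, w :: complex). \<phi> y"
    have bq': "basis_mod ?R (ideal_sections C q' V) n b"
      using t0 by (simp add: q'_def Hilb_chart_def)
    obtain c where c: "(\<lambda>Q. ?f Q - (\<Sum>a<n. c a * b a Q)) \<in> ideal_sections C q' V"
      using basis_mod_expand[OF bq' sec] by blast
    have fp: "?f \<in> ideal_sections C p V"
    proof -
      have "?f \<in> p P" if P: "P \<in> V" for P
      proof -
        obtain x z where xz: "P = (x, z)" by fastforce
        have x: "x \<in> C" using P xz by (simp add: mem_chart_open)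
        have g: "?f \<in> cyl_germs C (x, z)" using sec P xz by (auto simp: sections_def)
        show ?thesis
        proof (cases "x \<in> X")
          case True
          then have "(\<lambda>z. ?f (x, z)) = poly 0" using zero by (simp add: fun_eq_iff)
          then have "vanishing (count (replicate_mset (wt x) 0) z) z (\<lambda>z. ?f (x, z))"
            using vanishing_poly[of _ z 0] by (simp only: dvd_0_right)
          then show ?thesis using g x by (simp add: xz vertical_subscheme_apply line_ideal_def)
        next
          case False
          then have "wt x = 0" using wt by blast
          then show ?thesis using g x by (simp add: xz vertical_subscheme_apply line_ideal_0)
        qed
      qed
      then show ?thesis using sec by (simp add: ideal_sections_def)
    qed
    have "c a = 0" if a: "a < n" for a
    proof (rule ccontr)
      assume ca: "c a \<noteq> 0"
      \<comment> \<open>The coefficient at \<open>act C s q'\<close> is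
        \<open>c a / s ^ snd (h a)\<close>, of norm at least \<open>norm (c a)\<close> when
        \<open>norm s \<le> 1\<close>. This radius therefore excludes it for every exponent, 0
        included, whereas the coefficient at \<open>p\<close> is the centre.\<close>
      let ?U = "ball (0::complex) (norm (c a))"
      have "p \<in> ?W ?f a ?U"
        using fixed_in_chart fp ca by (auto intro!: exI[of _ "\<lambda>_. 0"])
      from ev[OF sec a open_ball this]
      have "\<forall>\<^sub>F t in at 0. act C t q \<in> ?W ?f a ?U" .
      moreover have "\<forall>\<^sub>F t in at (0::complex). t \<noteq> 0" by (simp add: eventually_at_filter)
      moreover have "\<forall>\<^sub>F t in at (0::complex). norm t < norm t0"
        using t0(1) by (auto simp: eventually_at dist_norm intro!: exI[of _ "norm t0"])
      ultimately have "\<forall>\<^sub>F t in at (0::complex). False"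
      proof eventually_elim
        case (elim t)
        define s where "s = t / t0"
        have s: "s \<noteq> 0" "norm s \<le> 1" using elim t0(1) by (auto simp: s_def norm_divide)
        obtain c' where c': "c' a \<in> ?U"
          "(\<lambda>Q. ?f Q - (\<Sum>j<n. c' j * b j Q)) \<in> ideal_sections C (act C s q') V"
          using elim(1) unfolding act_q s_def by blast
        have bs: "basis_mod ?R (ideal_sections C (act C s q') V) n b"
          using elim(1) unfolding act_q s_def by (simp add: Hilb_chart_def)
        have "(\<lambda>(y, w). (\<lambda>Q. ?f Q - (\<Sum>a<n. c a * b a Q)) (y, w / s)) \<in> ideal_sections C (act C s q') V"
          by (rule ideal_sections_act[OF chart_open_subset _ c s(1)]) (simp add: mem_chart_open)
        also have "(\<lambda>(y, w). (\<lambda>Q. ?f Q - (\<Sum>a<n. c a * b a Q)) (y, w / s)) =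
            (\<lambda>Q. ?f Q - (\<Sum>j<n. (c j / s ^ snd (h j)) * b j Q))"
          by (auto simp: fun_eq_iff chart_basis_def power_divide intro!: sum.cong)
        finally have scaled: "(\<lambda>Q. ?f Q - (\<Sum>j<n. (c j / s ^ snd (h j)) * b j Q)) \<in>
          ideal_sections C (act C s q') V" .
        have "c' a = c a / s ^ snd (h a)"
          by (rule basis_mod_unique[OF bs sec c'(2), where c' = "\<lambda>j. c j / s ^ snd (h j)"])
            (fact scaled a)+
        then have "norm (c a) / norm s ^ snd (h a) < norm (c a)"
          using c'(1) by (simp add: norm_divide norm_power)
        moreover have "norm (c a) \<le> norm (c a) / norm s ^ snd (h a)"
          using s by (simp add: le_divide_eq power_le_one mult_left_le)
        ultimately show False by simp
      qed
      then show False by (simp add: eventually_False)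
    qed
    then have "(\<lambda>Q. ?f Q - (\<Sum>a<n. c a * b a Q)) = ?f" by simp
    then show ?thesis using c by simp
  qed
  obtain Y where Y: "\<And>x. size (Y x) = wt x" "q' = vertical_subscheme C Y"
    using vertical_of_chart[of q', OF _ van] t0(2) unfolding q'_def by blast
  have "q = act C 1 q" using q by (intro act_1[symmetric]) (auto simp: Hilb_def PiE_def)
  also have "\<dots> = act C (1 / t0) q'" by (rule act_q)
  also have "\<dots> = vertical_subscheme C (\<lambda>x. image_mset ((*) (1 / t0)) (Y x))"
    unfolding Y(2) using t0(1) by (intro act_vertical) simp
  finally show thesis using Y(1) by (intro that[of "\<lambda>x. image_mset ((*) (1 / t0)) (Y x)"]) auto
qed

lemma fixed_in_topspace: "p \<in> topspace (Hilb_topology C n)"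
proof -
  let ?W = "{Z \<in> Hilb_chart C n V b. \<exists>c. c 0 \<in> UNIV \<and>
    (\<lambda>Q. 0 - (\<Sum>j<n. c j * b j Q)) \<in> ideal_sections C Z V}"
  have "p \<in> ?W"
    using fixed_in_chart basis_mod_expand[OF _ sections_zero, of C V "ideal_sections C p V" n b]
    by (simp add: Hilb_chart_def)
  moreover have "openin (Hilb_topology C n) ?W"
    unfolding Hilb_topology_def
    by (rule topology_generated_by_Basis, rule CollectI, rule exI[of _ V], rule exI[of _ b],
        rule exI[of _ "\<lambda>_. 0"], rule exI[of _ 0], rule exI[of _ UNIV])
      (intro conjI refl zariski_chart_open sections_zero n_pos open_UNIV)
  ultimately show ?thesis using openin_subset by blast
qed

end

theorem upward_flow_eq:
  fixes C X :: "'n::finite proj set" and wt :: "'n proj \<Rightarrow> nat"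
  assumes X: "finite X" "X \<subseteq> C" and wt: "\<And>x. x \<in> X \<longleftrightarrow> wt x \<noteq> 0"
    and n: "(\<Sum>x\<in>X. wt x) = n" "n > 0"
  shows "upward_flow C n (vertical_subscheme C (\<lambda>x. replicate_mset (wt x) 0)) =
    vertical_subscheme C ` {Y. \<forall>x. size (Y x) = wt x}"
proof (intro subset_antisym subsetI)
  let ?p = "vertical_subscheme C (\<lambda>x. replicate_mset (wt x) 0)"
  obtain E where E: "\<forall>x\<in>X. hom_form (card X) (E x)" "\<forall>x\<in>X. E x (hcoords x) \<noteq> 0"
    "\<forall>x\<in>X. \<forall>y\<in>X. x \<noteq> y \<longrightarrow> E x (hcoords y) = 0"
    using lagrange_forms[OF X(1)] by blast
  have "card (SIGMA x:X. {..<wt x}) = n" using X n by simp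
  then obtain h where h: "bij_betw h {..<n} (SIGMA x:X. {..<wt x})"
    using ex_bij_betw_nat_finite[of "SIGMA x:X. {..<wt x}"] X by (auto simp: lessThan_atLeast0)
  note ctx = X wt n h E
  show "q \<in> vertical_subscheme C ` {Y. \<forall>x. size (Y x) = wt x}" if "q \<in> upward_flow C n ?p" for q
    using that flow_subset[OF ctx, of q] unfolding upward_flow_def by blast
  fix q assume "q \<in> vertical_subscheme C ` {Y. \<forall>x. size (Y x) = wt x}"
  then obtain Y where Y: "\<And>x. size (Y x) = wt x" and q: "q = vertical_subscheme C Y" by blast
  have "Y x = {#}" if "x \<notin> X" for x using Y[of x] wt[of x] that by simp
  then have "q \<in> Hilb C n" using vertical_in_Hilb[OF X, of Y] Y n(1) by (simp add: q)
  moreover have "limitin (Hilb_topology C n) (\<lambda>t. act C t q) ?p (at 0)"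
    unfolding Hilb_topology_def
  proof (rule limitin_generated)
    show "?p \<in> \<Union>{{Z \<in> Hilb_chart C n V b. \<exists>c. c i \<in> U \<and>
          (\<lambda>Q. f Q - (\<Sum>j<n. c j * b j Q)) \<in> ideal_sections C Z V} | V b f i U.
        zariski_open cyl_ratios (cyl C) V \<and> f \<in> cyl_sections C V \<and> i < n \<and> open U}"
      using fixed_in_topspace[OF ctx] unfolding Hilb_topology_def topology_generated_by_topspace .
    fix W assume "W \<in> {{Z \<in> Hilb_chart C n V b. \<exists>c. c i \<in> U \<and>
          (\<lambda>Q. f Q - (\<Sum>j<n. c j * b j Q)) \<in> ideal_sections C Z V} | V b f i U.
        zariski_open cyl_ratios (cyl C) V \<and> f \<in> cyl_sections C V \<and> i < n \<and> open U}"
      and p: "?p \<in> W"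
    then obtain V b f i U where W: "W = {Z \<in> Hilb_chart C n V b. \<exists>c. c i \<in> U \<and>
          (\<lambda>Q. f Q - (\<Sum>j<n. c j * b j Q)) \<in> ideal_sections C Z V}"
      and V: "zariski_open cyl_ratios (cyl C) V" and f: "f \<in> cyl_sections C V"
      and i: "i < n" and U: "open U"
      by blast
    obtain c where c: "c i \<in> U" "(\<lambda>Q. f Q - (\<Sum>j<n. c j * b j Q)) \<in> ideal_sections C ?p V"
      and pc: "?p \<in> Hilb_chart C n V b"
      using p unfolding W by blast
    show "\<forall>\<^sub>F t in at 0. act C t q \<in> W"
      unfolding W q by (rule vertical_limit_in_chart[where wt = wt]; fact X wt n(1) Y V f i U pc c)
  qed
  ultimately show "q \<in> upward_flow C n ?p" by (simp add: upward_flow_def)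
qed

section \<open>Generic fixed points\<close>

text \<open>Genericity puts each point into at most one \<open>D i\<close>, with multiplicity one.
  So \<open>wt x\<close> is that index, or 0 off the supports, and the divisor E_k has multiplicity
  1 at \<open>x\<close> exactly for \<open>k < wt x\<close>.\<close>

lemma generic_weights:
  assumes D: "D \<in> generic_tuples C lam" and lam: "partition_of lam n"
  obtains X wt where "finite X" "X \<subseteq> C" "\<And>x. x \<in> X \<longleftrightarrow> wt x \<noteq> 0"
    "lam = image_mset wt (mset_set X)" "\<And>k x. E_mult lam D k x = of_bool (k < wt x)"
proof -
  have n: "sum_mset lam = n" and lam0: "0 \<notin># lam" using lam by (auto simp: partition_of_def)
  have DC: "set_mset (D i) \<subseteq> C" and sz: "size (D i) = count lam i"
    and c1: "count (D i) x \<le> 1" if "i \<ge> 1" for i x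
    using D that by (auto simp: generic_tuples_def divisor_tuples_def)
  have disj: "set_mset (D i) \<inter> set_mset (D j) = {}" if "i \<ge> 1" "j \<ge> 1" "i \<noteq> j" for i j
    using D that by (simp add: generic_tuples_def)
  have big: "D i = {#}" if "i > n" for i
  proof -
    have "i \<notin># lam"
    proof
      assume "i \<in># lam"
      then have "i \<le> sum_mset lam" by (auto dest!: multi_member_split)
      then show False using n that by simp
    qed
    then show ?thesis using sz[of i] that by (simp add: not_in_iff)
  qed
  \<comment> \<open>The sum starts at 1 because a tuple is unconstrained at index 0; at most one of
    its terms is nonzero.\<close>
  define wt where "wt x = (\<Sum>i\<in>{0<..n}. i * count (D i) x)" for x
  define X where "X = (\<Union>i\<in>{0<..n}. set_mset (D i))"
  have cnt: "count (D j) x = of_bool (j = i)" if "x \<in># D i" "1 \<le> i" "1 \<le> j" for x i j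
  proof (cases "j = i")
    case True
    have "count (D i) x > 0" using that by simp
    then have "count (D i) x = 1" using c1[OF that(2), of x] by linarith
    then show ?thesis using True by simp
  next
    case False
    then have "x \<notin># D j" using disj[of i j] that by blast
    then show ?thesis using False by (simp add: not_in_iff)
  qed
  have wt_i: "wt x = i" if x: "x \<in># D i" and i: "1 \<le> i" for x i
  proof -
    have "i \<le> n" using big[of i] x by (cases "i \<le> n") auto
    have "wt x = (\<Sum>j\<in>{0<..n}. if j = i then i else 0)"
      unfolding wt_def using cnt[OF x i] by (intro sum.cong) auto
    then show ?thesis using i \<open>i \<le> n\<close> by simp
  qed
  have wt_0: "wt x = 0" if "x \<notin> X" for x
    using that by (auto simp: wt_def X_def not_in_iff)
  have X_wt: "x \<in> X \<longleftrightarrow> wt x \<noteq> 0" for x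
  proof
    assume "x \<in> X"
    then obtain i where "x \<in># D i" "1 \<le> i" by (auto simp: X_def)
    then show "wt x \<noteq> 0" using wt_i[of x i] by simp
  next
    assume "wt x \<noteq> 0"
    then show "x \<in> X" using wt_0[of x] by (cases "x \<in> X") simp_all
  qed
  have level: "{x \<in> X. wt x = i} = set_mset (D i)" if "i \<ge> 1" for i
  proof (intro Set.set_eqI iffI)
    fix x assume "x \<in> {x \<in> X. wt x = i}"
    then show "x \<in># D i" using wt_i by (auto simp: X_def)
  next
    fix x assume x: "x \<in># D i"
    then have "i \<le> n" using big[of i] by (cases "i \<le> n") auto
    then show "x \<in> {x \<in> X. wt x = i}" using x wt_i[OF x that] that by (auto simp: X_def)
  qed
  have finX: "finite X" by (simp add: X_def)
  show thesis
  proof (rule that[OF finX _ X_wt])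
    show "X \<subseteq> C" unfolding X_def by (intro UN_least DC) simp
    show "lam = image_mset wt (mset_set X)"
    proof (rule multiset_eqI)
      fix i
      have "count (image_mset wt (mset_set X)) i = card {x \<in> X. wt x = i}"
        using finX by (simp add: count_image_mset vimage_def Int_def conj_commute)
      also have "\<dots> = count lam i"
      proof (cases "i \<ge> 1")
        case True
        have "size (D i) = (\<Sum>x\<in>set_mset (D i). count (D i) x)" by (simp add: size_multiset_overloaded_eq)
        also have "\<dots> = card (set_mset (D i))" using cnt True by simp
        finally show ?thesis using level[OF True] sz[OF True] by simp
      next
        case False
        then have i: "i = 0" by simp
        have empty: "{x \<in> X. wt x = 0} = {}" using X_wt by blast
        show ?thesis unfolding i empty using lam0 by (simp add: not_in_iff)
      qed
      finally show "count lam i = count (image_mset wt (mset_set X)) i" by simp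
    qed
    show "E_mult lam D k x = of_bool (k < wt x)" for k x
    proof (cases "x \<in> X")
      case False
      then have "count (D i) x = 0" if "i \<in> {k<..n}" for i
        using that by (auto simp: X_def not_in_iff)
      then show ?thesis using wt_0[OF False] by (simp add: E_mult_def n)
    next
      case True
      then obtain i where i: "x \<in># D i" "1 \<le> i" "i \<le> n" by (auto simp: X_def)
      have "E_mult lam D k x = (\<Sum>j\<in>{k<..n}. if j = i then 1 else 0)"
        unfolding E_mult_def n using cnt[OF i(1,2)] by (intro sum.cong) auto
      then show ?thesis using i wt_i[OF i(1,2)] by simp
    qed
  qed
qed

theorem proposition1p3:
  fixes C :: "'n::finite proj set" and n :: nat and lam mu :: "nat multiset"
    and p :: "'n subscheme"
  assumes "smooth_projective_curve C"
    and "n \<ge> 1"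
    and "partition_of lam n" and "partition_of mu n"
    and "p \<in> generic_fixed C lam"
  shows "\<forall>y\<in>collision_stratum mu.
           finite {q \<in> upward_flow C n p. h_map C q = y} \<and>
           int (card {q \<in> upward_flow C n p. h_map C q = y}) = hm_coeff lam mu"
proof
  fix y assume y: "y \<in> collision_stratum mu"
  obtain D where D: "D \<in> generic_tuples C lam" and p: "p = fixed_subscheme C lam D"
    using assms(5) by (auto simp: generic_fixed_def)
  obtain X wt where X: "finite X" "X \<subseteq> C" and wt: "\<And>x. x \<in> X \<longleftrightarrow> wt x \<noteq> 0"
    and lam: "lam = image_mset wt (mset_set X)" and E: "\<And>k x. E_mult lam D k x = of_bool (k < wt x)"
    using generic_weights[OF D assms(3)] by blast
  have sum_lam: "sum_mset lam = n" using assms(3) by (simp add: partition_of_def)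
  then have n: "(\<Sum>x\<in>X. wt x) = n" by (simp add: lam sum_unfold_sum_mset)
  have p': "p = vertical_subscheme C (\<lambda>x. replicate_mset (wt x) 0)"
    unfolding p by (rule fixed_subscheme_vertical[OF E])
  have flow: "upward_flow C n p = vertical_subscheme C ` {Y. \<forall>x. size (Y x) = wt x}"
    unfolding p' by (rule upward_flow_eq[OF X wt n]) (use assms(2) in simp)
  let ?D = "{Y. (\<forall>x. size (Y x) = (if x \<in> X then wt x else 0)) \<and> (\<Sum>x\<in>X. Y x) = y}"
  have wt_if: "(if x \<in> X then wt x else 0) = wt x" for x using wt[of x] by auto
  have out: "Y x = {#}" if "\<forall>x. size (Y x) = wt x" "x \<notin> X" for Y :: "'n proj \<Rightarrow> complex multiset" and x
    using that wt[of x] by (metis size_eq_0_iff_empty)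
  have "{q \<in> upward_flow C n p. h_map C q = y} = vertical_subscheme C ` ?D"
  proof -
    have "h_map C (vertical_subscheme C Y) = (\<Sum>x\<in>X. Y x)" if "\<forall>x. size (Y x) = wt x" for Y
      by (rule h_map_vertical[OF X out[OF that]])
    then have "{Y. \<forall>x. size (Y x) = wt x} \<inter> {Y. h_map C (vertical_subscheme C Y) = y} =
        {Y. (\<forall>x. size (Y x) = wt x) \<and> (\<Sum>x\<in>X. Y x) = y}"
      by (intro Set.set_eqI) (simp cong: conj_cong)
    moreover have "{q \<in> upward_flow C n p. h_map C q = y} = vertical_subscheme C `
        ({Y. \<forall>x. size (Y x) = wt x} \<inter> {Y. h_map C (vertical_subscheme C Y) = y})"
      unfolding flow by blast
    ultimately show ?thesis unfolding wt_if by simp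
  qed
  moreover have "inj_on (vertical_subscheme C) ?D"
  proof (rule inj_onI, rule ext)
    fix Y Y' x assume Y: "Y \<in> ?D" "Y' \<in> ?D" and eq: "vertical_subscheme C Y = vertical_subscheme C Y'"
    show "Y x = Y' x"
    proof (cases "x \<in> C")
      case True
      then show ?thesis by (rule vertical_subscheme_inject[OF eq])
    next
      \<comment> \<open>The subscheme does not see \<open>Y\<close> off \<open>C\<close>, but there
        the weight is 0 and \<open>Y\<close> is empty.\<close>
      case False
      then have "x \<notin> X" using X by blast
      then show ?thesis using Y unfolding wt_if by (simp add: out)
    qed
  qed
  moreover have "finite ?D \<and> int (card ?D) = hm_coeff lam mu"
    by (rule card_distributions[OF X(1) lam _ y]) (use assms(4) sum_lam in simp)
  ultimately show "finite {q \<in> upward_flow C n p. h_map C q = y} \<and>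
      int (card {q \<in> upward_flow C n p. h_map C q = y}) = hm_coeff lam mu"
    by (simp add: card_image)
qed

end
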